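(* Let $m\le n$. Consider the mechanical system $$\dot q=\nabla_pH(q,p),\qquad \dot p=-\nabla_qH(q,p)+G(u+d),\qquad H(q,p)=\tfrac12p^\top M^{-1}p+V(q),$$ with constant inertia matrix $M\succ0$, constant input matrix $G$, constant unknown disturbance $d\in\mathbb{R}^m$, and a feasible trajectory $x^\star(t)=[q^\star(t)^\top,p^\star(t)^\top]^\top$, $p^\star=M\dot q^\star$. Suppose there exist a constant matrix $J_{d_{12}}\in\mathbb{R}^{n\times n}$, a constant positive definite $M_d\in\mathbb{R}^{n\times n}$, a function $V_{d_3}:\mathbb{R}^n\times\mathbb{R}^m\times\mathbb{R}_+\to\mathbb{R}_+$, a constant positive definite $K_z\in\mathbb{R}^{m\times m}$, and constant matrices $$\digamma_1=[\Gamma_{11},\Gamma_{12}],\qquad \digamma_2=\begin{bmatrix}\Gamma_{21}\\\Gamma_{22}\end{bmatrix},\qquad \digamma_3=\begin{bmatrix}-\Gamma_{33}&0\\0&0\end{bmatrix},$$ with $\Gamma_{11},\Gamma_{12}\in\mathbb{R}^{n\times m}$ and $\Gamma_{21},\Gamma_{22}\in\mathbb{R}^{m\times n}$ of full rank and $\Gamma_{33}\in\mathbb{R}^{m\times m}$ positive definite, and a function $z_1^\star(t)\in\mathbb{R}^m$ such that, with $\Phi(q,z_1,t)=\nabla_qV_{d_3}(q,z_1,t)$ and $$\gamma_2(t)=(G^\top\Gamma_{12}K_z)^{-1}\Big(G^\top\big(-J_{d_{12}}^\top\Phi(q^\star,z_1^\star,t)+\Gamma_{11}\nabla_{z_1}V_{d_3}(q^\star,z_1^\star,t)\big)-G^\top\dot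 p^\star\Big),$$ the following hold. (i) The matching equations $$M^{-1}p=J_{d_{12}}M_d^{-1}p,$$ $$G^\perp\big(\nabla_qV(q)-J_{d_{12}}^\top\nabla_qV_{d_3}(q,z_1,t)+\Gamma_{11}\nabla_{z_1}V_{d_3}(q,z_1,t)+\Gamma_{12}K_z(z_2-\gamma_2)\big)=0$$ hold identically (in $q,p,z_1,z_2,t$, with $z_1,z_2\in\mathbb{R}^m$). (ii) With $\mathcal Z=[z_1^\top,z_2^\top]^\top$, $\theta=[q^\top,p^\top,\mathcal Z^\top]^\top$, $\mu_2=(\Gamma_{12}K_z)^\dagger Gd$ and $$\bar H_{d_3}(\theta,t)=\tfrac12p^\top M_d^{-1}p+V_{d_3}(q,z_1,t)+\tfrac12(z_2-\gamma_2+\mu_2)^\top K_z(z_2-\gamma_2+\mu_2),$$ the matrix $P_3=\begin{bmatrix}0&J_{d_{12}}&0\\-J_{d_{12}}^\top&0&\digamma_1\\\digamma_2&0&\digamma_3\end{bmatrix}$ is Hurwitz; there are constants $0<\alpha_3<\beta_3$ and an open set $D_3\subseteq\mathbb{R}^{2n+2m}$ with $\alpha_3I\prec\nabla_\theta^2\bar H_{d_3}(\theta,t)\prec\beta_3I$ for all $\theta\in D_3$ and all $t$; and for some $\varepsilon_3>0$ the matrix $$N_3=\begin{bmatrix}P_3&\big(1-\frac{\alpha_3}{\beta_3}\big)P_3P_3^\top\\-\big(1-\frac{\alpha_3}{\beta_3}+\varepsilon_3\big)I&-P_3^\top\end{bmatrix}$$ has no eigenvalues on the imaginary axis. (iii)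 For all $t$, $$\dot z_1^\star=\Gamma_{21}\Phi(q^\star,z_1^\star,t)-\Gamma_{33}\nabla_{z_1}V_{d_3}(q^\star,z_1^\star,t),\qquad 0=\Gamma_{22}\Phi(q^\star,z_1^\star,t).$$ Then the controller $$u=G^\dagger\Big(-J_{d_{12}}^\top\Phi(q,z_1,t)+\Gamma_{11}\nabla_{z_1}V_{d_3}(q,z_1,t)+\Gamma_{12}K_z(z_2-\gamma_2)+\nabla_qH\Big),$$ with $$\dot z_1=\Gamma_{21}\Phi(q,z_1,t)-\Gamma_{33}\nabla_{z_1}V_{d_3}(q,z_1,t),\qquad \dot z_2=\Gamma_{22}\Phi(q,z_1,t),$$ realizes exponential tracking of $x^\star(t)$ without velocity measurements while eliminating the disturbance effect; that is, with the disturbance $d$ present, the $(q,p)$-trajectories of the closed loop converge exponentially to $x^\star(t)$.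
   Context: $q,p\in\mathbb{R}^n$ are positions and momenta, $u\in\mathbb{R}^m$ the input, $V:\mathbb{R}^n\to\mathbb{R}_+$ the potential energy, $G\in\mathbb{R}^{n\times m}$ with $\mathrm{rank}(G)=m\le n$. Since $M$ is constant, $\nabla_qH=\nabla_qV(q)$, so the controller does not involve $p$ or $\dot q$. All functions are sufficiently smooth. $A\succ0$ means $A$ is (symmetric) positive definite. $\nabla$ denotes the column gradient, $\nabla^2$ the Hessian. For full-column-rank $g$, $g^\dagger=(g^\top g)^{-1}g^\top$. $G^\perp$ is a full-rank left annihilator of $G$ ($G^\perp G=0$, $G^\perp\in\mathbb{R}^{(n-m)\times n}$). A matrix is Hurwitz if all its eigenvalues have strictly negative real parts. A feasible trajectory is a function $x^\star=[{q^\star}^\top,{p^\star}^\top]^\top$ of time for which there is an input $u^\star(t)$ such that $\dot q^\star=\nabla_pH(q^\star,p^\star)$ and $\dot p^\star=-\nabla_qH(q^\star,p^\star)+Gu^\star$ for all $t$ in its time domain, here $\mathbb{R}_+$. A system $\dot x=f(x,t)$ is contractive on an open set $D$ if there are a symmetric matrix function $Q(x,t)$, uniformly positive definite and bounded, and $\lambda>0$ with $\frac{\partial f}{\partial x}^\top Q+Q\frac{\partial f}{\partial x}+\dot Q\preceq-2\lambda Q$ on $D$ for all $t$. Convergence to the desired trajectory is understood in the sense of the convergence property of contractive systems (Lohmiller and Slotine): trajectories starting in a ball (with respect to the contraction metric) centered at the desired trajectory of the (extended) closed-loop system, this moving ball being contained at all times in the contraction region ($D_3$ here), remain in that ball and converge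 exponentially to the desired trajectory as $t\to\infty$; if the region is the whole space, all trajectories do. *)

theory Defs
  imports "HOL-Analysis.Analysis"
begin

section \<open>Matrices\<close>

definition pos_semidef :: "real^'n^'n \<Rightarrow> bool" where
  "pos_semidef A \<longleftrightarrow> transpose A = A \<and> (\<forall>x. 0 \<le> x \<bullet> (A *v x))"

definition pos_def :: "real^'n^'n \<Rightarrow> bool" where
  "pos_def A \<longleftrightarrow> transpose A = A \<and> (\<forall>x. x \<noteq> 0 \<longrightarrow> 0 < x \<bullet> (A *v x))"

definition loewner_le :: "real^'n^'n \<Rightarrow> real^'n^'n \<Rightarrow> bool" (infix "\<preceq>" 50) where
  "A \<preceq> B \<longleftrightarrow> pos_semidef (B - A)"

definition loewner_less :: "real^'n^'n \<Rightarrow> real^'n^'n \<Rightarrow> bool" (infix "\<prec>" 50) where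
  "A \<prec> B \<longleftrightarrow> pos_def (B - A)"

text \<open>Complex eigenvalues of a real matrix.\<close>

definition eigenvalue :: "real^'n^'n \<Rightarrow> complex \<Rightarrow> bool" where
  "eigenvalue A \<mu> \<longleftrightarrow> (\<exists>v. v \<noteq> 0 \<and> map_matrix complex_of_real A *v v = \<mu> *s v)"

definition hurwitz :: "real^'n^'n \<Rightarrow> bool" where
  "hurwitz A \<longleftrightarrow> (\<forall>\<mu>. eigenvalue A \<mu> \<longrightarrow> Re \<mu> < 0)"

definition pinv :: "real^'m^'n \<Rightarrow> real^'n^'m" where
  "pinv g = matrix_inv (transpose g ** g) ** transpose g"

text \<open>
  The rows of a full-rank left annihilator of an \<open>n \<times> m\<close> matrix are the values
  \<open>N i\<close> for \<open>i < n - m\<close>; indexing them by natural numbers rather than by a type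
  keeps the case \<open>n = m\<close>, in which there are no rows.
\<close>

definition left_annihilator :: "(nat \<Rightarrow> real^'n) \<Rightarrow> real^'m^'n \<Rightarrow> bool" where
  "left_annihilator N G \<longleftrightarrow>
     (\<forall>i < CARD('n) - CARD('m). N i v* G = 0) \<and>
     inj_on N {..<CARD('n) - CARD('m)} \<and>
     independent (N ` {..<CARD('n) - CARD('m)})"

text \<open>
  Since a matrix is the vector of its rows, \<open>vjoin\<close> concatenates vectors and also
  stacks two matrices on top of each other.
\<close>

definition vjoin :: "'a^'i \<Rightarrow> 'a^'j \<Rightarrow> 'a^('i + 'j)" where
  "vjoin x y = (\<chi> k. case k of Inl i \<Rightarrow> x $ i | Inr j \<Rightarrow> y $ j)"

definition hjoin :: "'a^'i^'k \<Rightarrow> 'a^'j^'k \<Rightarrow> 'a^('i + 'j)^'k" where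
  "hjoin A B = (\<chi> k. vjoin (A $ k) (B $ k))"

definition block :: "'a^'i^'k \<Rightarrow> 'a^'j^'k \<Rightarrow> 'a^'i^'l \<Rightarrow> 'a^'j^'l \<Rightarrow> 'a^('i + 'j)^('k + 'l)" where
  "block A B C D = vjoin (hjoin A B) (hjoin C D)"


section \<open>Calculus\<close>

definition grad :: "(real^'n \<Rightarrow> real) \<Rightarrow> real^'n \<Rightarrow> real^'n" where
  "grad f x = (\<chi> i. frechet_derivative f (at x) (axis i 1))"

definition hess :: "(real^'n \<Rightarrow> real) \<Rightarrow> real^'n \<Rightarrow> real^'n^'n" where
  "hess f x = jacobian (grad f) (at x)"

definition C2 :: "('a::real_normed_vector \<Rightarrow> real) \<Rightarrow> bool" where
  "C2 f \<longleftrightarrow> (\<exists>(f' :: 'a \<Rightarrow> 'a \<Rightarrow>\<^sub>L real) (f'' :: 'a \<Rightarrow> 'a \<Rightarrow>\<^sub>L ('a \<Rightarrow>\<^sub>L real)).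
     (\<forall>x. (f has_derivative blinfun_apply (f' x)) (at x)) \<and>
     (\<forall>x. (f' has_derivative blinfun_apply (f'' x)) (at x)) \<and>
     continuous_on UNIV f'')"


section \<open>Time-varying systems and contraction\<close>

definition trajectory :: "(real^'k \<Rightarrow> real \<Rightarrow> real^'k) \<Rightarrow> real set \<Rightarrow> (real \<Rightarrow> real^'k) \<Rightarrow> bool" where
  "trajectory f I x \<longleftrightarrow> (\<forall>t\<in>I. (x has_vector_derivative f (x t) t) (at t within I))"

text \<open>
  \<open>Q'\<close> is the total derivative of \<open>Q\<close> in \<open>(x, t)\<close>, so that
  \<open>Q' (f x t, 1)\<close> is the derivative of \<open>Q\<close> along the flow of \<open>f\<close>.
\<close>

definition contraction_metric ::
    "(real^'k \<Rightarrow> real \<Rightarrow> real^'k) \<Rightarrow> (real^'k) set \<Rightarrow> (real^'k \<Rightarrow> real \<Rightarrow> real^'k^'k) \<Rightarrow> real \<Rightarrow> bool" where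
  "contraction_metric f D Q \<rho> \<longleftrightarrow>
     0 < \<rho> \<and>
     (\<exists>c1 c2. 0 < c1 \<and> (\<forall>x. \<forall>t\<ge>0. transpose (Q x t) = Q x t \<and> mat c1 \<preceq> Q x t \<and> Q x t \<preceq> mat c2)) \<and>
     (\<forall>x. \<forall>t\<ge>0. (\<lambda>(x, t). Q x t) differentiable (at (x, t) within UNIV \<times> {0..})) \<and>
     (\<forall>x\<in>D. \<forall>t\<ge>0. \<exists>A Q'.
        ((\<lambda>x. f x t) has_derivative (\<lambda>h. A *v h)) (at x) \<and>
        ((\<lambda>(x, t). Q x t) has_derivative Q') (at (x, t) within UNIV \<times> {0..}) \<and>
        transpose A ** Q x t + Q x t ** A + Q' (f x t, 1) \<preceq> (- 2 * \<rho>) *\<^sub>R Q x t)"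

text \<open>
  The Riemannian distance of the metric \<open>Q(\<cdot>, t)\<close> at a fixed time \<open>t\<close>. Paths are
  \<open>C1\<close> up to the end points, so the length integrand is continuous for continuous \<open>Q\<close>.
\<close>

definition metric_length :: "(real^'k \<Rightarrow> real \<Rightarrow> real^'k^'k) \<Rightarrow> real \<Rightarrow> (real \<Rightarrow> real^'k) \<Rightarrow> real" where
  "metric_length Q t \<gamma> =
     integral {0..1} (\<lambda>s. sqrt (vector_derivative \<gamma> (at s) \<bullet> (Q (\<gamma> s) t *v vector_derivative \<gamma> (at s))))"

definition metric_dist :: "(real^'k \<Rightarrow> real \<Rightarrow> real^'k^'k) \<Rightarrow> real \<Rightarrow> real^'k \<Rightarrow> real^'k \<Rightarrow> real" where
  "metric_dist Q t x y =
     Inf {metric_length Q t \<gamma> | \<gamma>. \<gamma> C1_differentiable_on {0..1} \<and> pathstart \<gamma> = x \<and> pathfinish \<gamma> = y}"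

definition metric_ball :: "(real^'k \<Rightarrow> real \<Rightarrow> real^'k^'k) \<Rightarrow> real \<Rightarrow> real^'k \<Rightarrow> real \<Rightarrow> (real^'k) set" where
  "metric_ball Q t x r = {y. metric_dist Q t x y < r}"


section \<open>The mechanical system\<close>

definition hamiltonian :: "real^'n^'n \<Rightarrow> (real^'n \<Rightarrow> real) \<Rightarrow> real^'n \<Rightarrow> real^'n \<Rightarrow> real" where
  "hamiltonian M V q p = 1/2 * (p \<bullet> (matrix_inv M *v p)) + V q"

definition q_dot :: "real^'n^'n \<Rightarrow> (real^'n \<Rightarrow> real) \<Rightarrow> real^'n \<Rightarrow> real^'n \<Rightarrow> real^'n" where
  "q_dot M V q p = grad (\<lambda>p. hamiltonian M V q p) p"

definition p_dot ::
    "real^'n^'n \<Rightarrow> (real^'n \<Rightarrow> real) \<Rightarrow> real^'m^'n \<Rightarrow> real^'n \<Rightarrow> real^'n \<Rightarrow> real^'m \<Rightarrow> real^'n" where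
  "p_dot M V G q p v = - grad (\<lambda>q. hamiltonian M V q p) q + G *v v"

definition feasible ::
    "real^'n^'n \<Rightarrow> (real^'n \<Rightarrow> real) \<Rightarrow> real^'m^'n \<Rightarrow> (real \<Rightarrow> real^'n) \<Rightarrow> (real \<Rightarrow> real^'n) \<Rightarrow> bool" where
  "feasible M V G qs ps \<longleftrightarrow> (\<exists>us :: real \<Rightarrow> real^'m. \<forall>t\<ge>0.
     (qs has_vector_derivative q_dot M V (qs t) (ps t)) (at t within {0..}) \<and>
     (ps has_vector_derivative p_dot M V G (qs t) (ps t) (us t)) (at t within {0..}))"


section \<open>The controller and the extended closed loop\<close>

text \<open>Gradients of \<open>W(q, z1, t)\<close> in its first and second argument.\<close>

definition grad_q :: "(real^'n \<Rightarrow> real^'m \<Rightarrow> real \<Rightarrow> real) \<Rightarrow> real^'n \<Rightarrow> real^'m \<Rightarrow> real \<Rightarrow> real^'n" where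
  "grad_q W q z1 t = grad (\<lambda>q. W q z1 t) q"

definition grad_z :: "(real^'n \<Rightarrow> real^'m \<Rightarrow> real \<Rightarrow> real) \<Rightarrow> real^'n \<Rightarrow> real^'m \<Rightarrow> real \<Rightarrow> real^'m" where
  "grad_z W q z1 t = grad (\<lambda>z1. W q z1 t) z1"

text \<open>
  The control law does not take \<open>p\<close> as an argument (no velocity measurements): since \<open>M\<close> is
  constant, the gradient of the Hamiltonian in \<open>q\<close> is that of \<open>V\<close>.
\<close>

definition control ::
    "(real^'n \<Rightarrow> real) \<Rightarrow> real^'m^'n \<Rightarrow> real^'n^'n \<Rightarrow> (real^'n \<Rightarrow> real^'m \<Rightarrow> real \<Rightarrow> real) \<Rightarrow>
     real^'m^'n \<Rightarrow> real^'m^'n \<Rightarrow> real^'m^'m \<Rightarrow> (real \<Rightarrow> real^'m) \<Rightarrow>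
     real^'n \<Rightarrow> real^'m \<Rightarrow> real^'m \<Rightarrow> real \<Rightarrow> real^'m" where
  "control V G J W \<Gamma>11 \<Gamma>12 Kz \<gamma>2 q z1 z2 t =
     pinv G *v (- (transpose J *v grad_q W q z1 t) + \<Gamma>11 *v grad_z W q z1 t
                + \<Gamma>12 *v (Kz *v (z2 - \<gamma>2 t)) + grad V q)"

text \<open>The extended state is \<open>((q, p), (z1, z2))\<close>.\<close>

type_synonym ('n, 'm) ext = "('n + 'n) + ('m + 'm)"

definition ext_state :: "real^'n \<Rightarrow> real^'n \<Rightarrow> real^'m \<Rightarrow> real^'m \<Rightarrow> real^('n, 'm) ext" where
  "ext_state q p z1 z2 = vjoin (vjoin q p) (vjoin z1 z2)"

definition q_of :: "real^('n::finite, 'm::finite) ext \<Rightarrow> real^'n" where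
  "q_of \<theta> = (\<chi> i. \<theta> $ Inl (Inl i))"

definition p_of :: "real^('n::finite, 'm::finite) ext \<Rightarrow> real^'n" where
  "p_of \<theta> = (\<chi> i. \<theta> $ Inl (Inr i))"

definition z1_of :: "real^('n::finite, 'm::finite) ext \<Rightarrow> real^'m" where
  "z1_of \<theta> = (\<chi> i. \<theta> $ Inr (Inl i))"

definition z2_of :: "real^('n::finite, 'm::finite) ext \<Rightarrow> real^'m" where
  "z2_of \<theta> = (\<chi> i. \<theta> $ Inr (Inr i))"

definition H_d3 ::
    "real^'n^'n \<Rightarrow> (real^'n \<Rightarrow> real^'m \<Rightarrow> real \<Rightarrow> real) \<Rightarrow> real^'m^'m \<Rightarrow> (real \<Rightarrow> real^'m) \<Rightarrow> real^'m \<Rightarrow>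
     real^('n, 'm) ext \<Rightarrow> real \<Rightarrow> real" where
  "H_d3 Md W Kz \<gamma>2 \<mu>2 \<theta> t =
     1/2 * (p_of \<theta> \<bullet> (matrix_inv Md *v p_of \<theta>)) + W (q_of \<theta>) (z1_of \<theta>) t
     + 1/2 * ((z2_of \<theta> - \<gamma>2 t + \<mu>2) \<bullet> (Kz *v (z2_of \<theta> - \<gamma>2 t + \<mu>2)))"

definition P3 ::
    "real^'n^'n \<Rightarrow> real^'m^'n \<Rightarrow> real^'m^'n \<Rightarrow> real^'n^'m \<Rightarrow> real^'n^'m \<Rightarrow> real^'m^'m \<Rightarrow>
     real^('n, 'm) ext^('n, 'm) ext" where
  "P3 J \<Gamma>11 \<Gamma>12 \<Gamma>21 \<Gamma>22 \<Gamma>33 =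
     block (block 0 J (- transpose J) 0)      (vjoin 0 (hjoin \<Gamma>11 \<Gamma>12))
           (hjoin (vjoin \<Gamma>21 \<Gamma>22) 0)         (block (- \<Gamma>33) 0 0 0)"

definition N3 :: "real^'k^'k \<Rightarrow> real \<Rightarrow> real \<Rightarrow> real \<Rightarrow> real^('k + 'k)^('k + 'k)" where
  "N3 P \<alpha> \<beta> \<epsilon> =
     block P                          ((1 - \<alpha> / \<beta>) *\<^sub>R (P ** transpose P))
           (- mat (1 - \<alpha> / \<beta> + \<epsilon>))    (- transpose P)"

definition closed_loop ::
    "real^'n^'n \<Rightarrow> (real^'n \<Rightarrow> real) \<Rightarrow> real^'m^'n \<Rightarrow> real^'m \<Rightarrow>
     real^'n^'n \<Rightarrow> (real^'n \<Rightarrow> real^'m \<Rightarrow> real \<Rightarrow> real) \<Rightarrow>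
     real^'m^'n \<Rightarrow> real^'m^'n \<Rightarrow> real^'n^'m \<Rightarrow> real^'n^'m \<Rightarrow> real^'m^'m \<Rightarrow> real^'m^'m \<Rightarrow>
     (real \<Rightarrow> real^'m) \<Rightarrow> real^('n, 'm) ext \<Rightarrow> real \<Rightarrow> real^('n, 'm) ext" where
  "closed_loop M V G d J W \<Gamma>11 \<Gamma>12 \<Gamma>21 \<Gamma>22 \<Gamma>33 Kz \<gamma>2 \<theta> t =
     (let q = q_of \<theta>; p = p_of \<theta>; z1 = z1_of \<theta>; z2 = z2_of \<theta>;
          u = control V G J W \<Gamma>11 \<Gamma>12 Kz \<gamma>2 q z1 z2 t
      in ext_state
           (q_dot M V q p)
           (p_dot M V G q p (u + d))
           (\<Gamma>21 *v grad_q W q z1 t - \<Gamma>33 *v grad_z W q z1 t)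
           (\<Gamma>22 *v grad_q W q z1 t))"

end

theory Submission
  imports Defs "HOL-Computational_Algebra.Fundamental_Theorem_Algebra"
begin

text \<open>
  The matching equations turn the closed loop into the gradient system
  \<open>d\<theta>/dt = P \<nabla>H(\<theta>, t)\<close> with \<open>P = P3\<close> and \<open>H = H_d3\<close>, disturbance included, and
  \<open>(qs, ps, z1s, - \<mu>2)\<close> is one of its trajectories. Its Jacobian is \<open>P\<close> times a Hessian between
  \<open>\<alpha>3\<close> and \<open>\<beta>3\<close>, so a constant metric \<open>X\<close> contracts as soon as it satisfies the strict
  bounded real inequality of the transfer function \<open>(s - P)\<^sup>-\<^sup>1 P\<close>.

  That \<open>N3\<close> has no imaginary eigenvalue bounds this transfer function on the imaginary axis
  (continuity from infinite frequency). Existence of \<open>X\<close> is the Kalman-Yakubovich-Popov lemma,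
  proved as by Rantzer: separate the form values from the half line, and decompose an
  obstructing positive semidefinite matrix into pieces of a single frequency. Positivity of
  \<open>X\<close> is Lyapunov's theorem for the Hurwitz matrix \<open>P\<close>, obtained from the Cayley transform.
  Since \<open>X\<close> is constant, its metric balls are ellipsoids, hence convex, and two
  trajectories are compared by the mean value theorem on the segment between them.
\<close>


text \<open>One \<open>X\<close> has to serve every Hessian H met on \<open>D3\<close>, at all
  times. After division by \<open>\<beta>3\<close> each H differs from the identity by an operator
  of norm at most c = 1 - \<alpha>3 / \<beta>3, so with y = H x / \<beta>3 all that is kept of H is
  |y - x| \<le> c |x|. It is enough that P y . X x + (c + \<epsilon>) |x|^2 \<le> |y - x|^2 / c for
  all x and y: for admissible y the right-hand side is at most c |x|^2, and
  \<open>\<epsilon>3\<close> remains as the rate of decay. The constants c and c + \<epsilon> are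
  those of the off-diagonal blocks of \<open>N3\<close>, the Hamiltonian matrix of this inequality.
  The matching equation holds for all \<open>z2\<close>, so the range of
  \<open>\<Gamma>12 ** Kz\<close> lies in that of \<open>G\<close>, and equal rank makes them equal.
  Hence the unknown disturbance is a shift of \<open>z2\<close>, that is, a translation of the
  storage function. Extremal vectors and first-order conditions stand in for spectral
  decompositions, and discrete iterates for the matrix exponential.\<close>

section \<open>A Kalman-Yakubovich-Popov lemma\<close>

text \<open>The map b \<mapsto> b - (a . b) a is the orthogonal projection along the unit vector a,
  and the sums are traces. With a form pulled back along S, composing S with this projection
  subtracts the rank one matrix (S a)(S a)^T from S S^T.\<close>

lemma trace_deflate:
  fixes \<beta> :: "'w::euclidean_space \<Rightarrow> 'w \<Rightarrow> real"
  assumes "bilinear \<beta>" "norm a = 1"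
  shows "(\<Sum>b\<in>Basis. \<beta> (b - (a \<bullet> b) *\<^sub>R a) (b - (a \<bullet> b) *\<^sub>R a)) = (\<Sum>b\<in>Basis. \<beta> b b) - \<beta> a a"
proof -
  have l: "linear (\<lambda>u. \<beta> u a)" "linear (\<lambda>u. \<beta> a u)"
    using assms(1) by (auto simp: bilinear_def)
  have r: "(\<Sum>b\<in>Basis. (a \<bullet> b) *\<^sub>R b) = a"
    by (rule euclidean_representation)
  have 1: "(\<Sum>b\<in>Basis. (a \<bullet> b) * \<beta> b a) = \<beta> a a"
    using linear_sum[OF l(1), of "\<lambda>b. (a \<bullet> b) *\<^sub>R b" Basis] r by (simp add: linear_cmul[OF l(1)])
  have 2: "(\<Sum>b\<in>Basis. (a \<bullet> b) * \<beta> a b) = \<beta> a a"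
    using linear_sum[OF l(2), of "\<lambda>b. (a \<bullet> b) *\<^sub>R b" Basis] r by (simp add: linear_cmul[OF l(2)])
  have 3: "(\<Sum>b\<in>Basis. (a \<bullet> b) * (a \<bullet> b)) = 1"
    using assms(2) by (simp flip: euclidean_inner add: norm_eq_1)
  have "\<beta> (b - (a \<bullet> b) *\<^sub>R a) (b - (a \<bullet> b) *\<^sub>R a) =
      \<beta> b b - (a \<bullet> b) * \<beta> b a - (a \<bullet> b) * \<beta> a b + ((a \<bullet> b) * (a \<bullet> b)) * \<beta> a a" for b
    using assms(1) by (simp add: bilinear_lsub bilinear_rsub bilinear_lmul bilinear_rmul algebra_simps)
  then have "(\<Sum>b\<in>Basis. \<beta> (b - (a \<bullet> b) *\<^sub>R a) (b - (a \<bullet> b) *\<^sub>R a)) =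
      (\<Sum>b\<in>Basis. \<beta> b b) - (\<Sum>b\<in>Basis. (a \<bullet> b) * \<beta> b a) - (\<Sum>b\<in>Basis. (a \<bullet> b) * \<beta> a b)
      + (\<Sum>b\<in>Basis. (a \<bullet> b) * (a \<bullet> b)) * \<beta> a a"
    by (simp add: sum.distrib sum_subtractf sum_distrib_right)
  then show ?thesis
    by (simp add: 1 2 3)
qed

text \<open>First-order condition: the quadratic attains its minimum 0 at t = 0, where its slope is
  2 b. It turns extremal properties of quadratic forms into linear identities.\<close>

lemma nonneg_quadratic_imp_linear_zero:
  fixes b c :: real
  assumes "\<And>t. 0 \<le> 2 * b * t + c * t\<^sup>2"
  shows "b = 0"
proof (rule ccontr)
  assume b: "b \<noteq> 0"
  \<comment> \<open>The summand 1 keeps the divisor positive when c = 0 and makes c / d less than 1,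
    so that the factor c / d - 2 is negative.\<close>
  let ?d = "\<bar>c\<bar> + 1"
  have "0 \<le> 2 * b * (- b / ?d) + c * (- b / ?d)\<^sup>2"
    using assms by blast
  also have "\<dots> = (b\<^sup>2 / ?d) * (c / ?d - 2)"
    by (simp add: power2_eq_square algebra_simps)
  also have "\<dots> < 0"
  proof -
    have "c / ?d < 2" by (simp add: field_simps)
    then show ?thesis using b by (intro mult_pos_neg) (auto intro!: divide_pos_pos)
  qed
  finally show False by simp
qed

text \<open>A unit vector a of W at which |\<Theta> w| is largest is an eigenvector of \<Theta>^2
  with eigenvalue - \<omega>^2, so a and \<Theta> a / \<omega> span an invariant plane. This
  replaces the normal form of skew matrices. Skewness is asked for on W only, since \<Theta> will be
  built from a left inverse that is controlled only there.\<close>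

lemma skew_top_plane:
  fixes \<Theta> :: "'w::euclidean_space \<Rightarrow> 'w"
  assumes lin: "linear \<Theta>" and W: "subspace W" "W \<noteq> {0}" and inv: "\<And>w. \<Theta> w \<in> W"
    and skew: "\<And>f g. f \<in> W \<Longrightarrow> g \<in> W \<Longrightarrow> f \<bullet> \<Theta> g + g \<bullet> \<Theta> f = 0"
  obtains "\<And>w. w \<in> W \<Longrightarrow> \<Theta> w = 0"
  | a b \<omega> where "a \<in> W" "b \<in> W" "norm a = 1" "norm b = 1" "a \<bullet> b = 0"
      "\<Theta> a = \<omega> *\<^sub>R b" "\<Theta> b = - (\<omega> *\<^sub>R a)"
proof -
  let ?K = "W \<inter> sphere 0 1"
  obtain w0 where w0: "w0 \<in> W" "w0 \<noteq> 0"
    using W subspace_0 by blast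
  have "compact ?K"
    using closed_Int_compact[OF closed_subspace[OF W(1)]] by auto
  moreover have "?K \<noteq> {}"
  proof -
    have "(1 / norm w0) *\<^sub>R w0 \<in> ?K"
      using w0 W(1) by (simp add: subspace_scale)
    then show ?thesis by blast
  qed
  moreover have "continuous_on ?K (\<lambda>w. norm (\<Theta> w))"
    by (intro continuous_on_norm linear_continuous_on linear_conv_bounded_linear[THEN iffD1] lin)
  ultimately obtain a where a: "a \<in> ?K" and top: "\<And>w. w \<in> ?K \<Longrightarrow> norm (\<Theta> w) \<le> norm (\<Theta> a)"
    using continuous_attains_sup by (metis (no_types, lifting))
  define \<omega> where "\<omega> = norm (\<Theta> a)"
  have le: "norm (\<Theta> w) \<le> \<omega> * norm w" if "w \<in> W" for w
  proof (cases "w = 0")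
    case True
    then show ?thesis by (simp add: linear_0[OF lin])
  next
    case False
    then have "(1 / norm w) *\<^sub>R w \<in> ?K"
      using that W(1) by (simp add: subspace_scale)
    from top[OF this] have "norm (\<Theta> w) / norm w \<le> \<omega>"
      by (simp add: linear_cmul[OF lin] \<omega>_def)
    then show ?thesis using False by (simp add: field_simps)
  qed
  have ww: "\<omega> * \<omega> = \<Theta> a \<bullet> \<Theta> a"
    by (simp add: \<omega>_def flip: power2_eq_square power2_norm_eq_inner)
  have aW: "a \<in> W" and na: "norm a = 1" using a by auto
  have sq: "\<Theta> (\<Theta> a) = - ((\<omega> * \<omega>) *\<^sub>R a)"
  proof -
    let ?v = "(\<omega> * \<omega>) *\<^sub>R a + \<Theta> (\<Theta> a)"
    have vW: "?v \<in> W" using aW inv W(1) by (intro subspace_add subspace_scale)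
    \<comment> \<open>First variation at a of the form \<omega>^2 |w|^2 - |\<Theta> w|^2, which is
      nonnegative on W and zero at a.\<close>
    have "(\<omega> * \<omega>) * (a \<bullet> w) - \<Theta> a \<bullet> \<Theta> w = 0" if w: "w \<in> W" for w
    proof (rule nonneg_quadratic_imp_linear_zero)
      fix t
      have "a + t *\<^sub>R w \<in> W" using aW w W(1) by (simp add: subspace_add subspace_scale)
      from le[OF this] have "(norm (\<Theta> (a + t *\<^sub>R w)))\<^sup>2 \<le> (\<omega> * norm (a + t *\<^sub>R w))\<^sup>2"
        by (simp add: power_mono)
      moreover have "(norm (\<Theta> (a + t *\<^sub>R w)))\<^sup>2 = \<omega> * \<omega> + 2 * t * (\<Theta> a \<bullet> \<Theta> w) + t\<^sup>2 * (\<Theta> w \<bullet> \<Theta> w)"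
        using ww by (simp add: linear_add[OF lin] linear_cmul[OF lin] power2_norm_eq_inner inner_simps
            inner_commute) (simp add: power2_eq_square)
      moreover have "(norm (a + t *\<^sub>R w))\<^sup>2 = 1 + 2 * t * (a \<bullet> w) + t\<^sup>2 * (w \<bullet> w)"
        using na by (simp add: power2_norm_eq_inner inner_simps inner_commute norm_eq_1)
          (simp add: power2_eq_square)
      ultimately show "0 \<le> 2 * (\<omega> * \<omega> * (a \<bullet> w) - \<Theta> a \<bullet> \<Theta> w) * t + (\<omega> * \<omega> * (w \<bullet> w) - \<Theta> w \<bullet> \<Theta> w) * t\<^sup>2"
        by (simp add: power_mult_distrib algebra_simps power2_eq_square)
    qed
    \<comment> \<open>Skewness moves the outer \<Theta> from w to \<Theta> a. So ?v is orthogonal to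
      W while lying in W.\<close>
    then have "?v \<bullet> w = 0" if "w \<in> W" for w
      using skew[OF inv[of a] that] that by (fastforce simp: inner_simps inner_commute)
    from this[OF vW] have "?v = 0" by (simp only: inner_eq_zero_iff)
    then show ?thesis by (metis add.commute add_eq_0_iff)
  qed
  show ?thesis
  proof (cases "\<omega> = 0")
    case True
    then show ?thesis using that(1) le by force
  next
    case False
    show ?thesis
    proof (rule that(2)[of a "(1 / \<omega>) *\<^sub>R \<Theta> a" \<omega>])
      show "a \<bullet> (1 / \<omega>) *\<^sub>R \<Theta> a = 0" using skew[OF aW aW] by simp
      show "norm ((1 / \<omega>) *\<^sub>R \<Theta> a) = 1" using False by (simp add: \<omega>_def)
      show "(1 / \<omega>) *\<^sub>R \<Theta> a \<in> W" using inv W(1) by (simp add: subspace_scale)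
      show "\<Theta> ((1 / \<omega>) *\<^sub>R \<Theta> a) = - (\<omega> *\<^sub>R a)"
        using False by (simp add: linear_cmul[OF lin] sq)
    qed (use aW na False in auto)
  qed
qed

lemma bilinear_compose_linear:
  "bilinear \<beta> \<Longrightarrow> linear f \<Longrightarrow> linear g \<Longrightarrow> bilinear (\<lambda>u v. \<beta> (f u) (g v))"
  unfolding bilinear_def by (auto intro: linear_compose[unfolded o_def])

text \<open>
  The positive semidefinite matrix in question is \<open>S S\<^sup>T\<close> for \<open>S = (X, Y)\<close>. If \<open>X w = 0\<close> for some
  \<open>w\<close> outside the kernel of \<open>S\<close>, the rank one piece \<open>S w\<close> has infinite frequency. Otherwise
  \<open>P Y = X \<Theta>\<close> with \<open>\<Theta>\<close> skew, and the top singular plane of \<open>\<Theta>\<close> is a rank two piece of a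
  single frequency. Either piece is removed by deflating \<open>S\<close>, which enlarges its kernel.
\<close>

lemma frequency_condition_imp_trace_neg:
  fixes S :: "'w::euclidean_space \<Rightarrow> 'a::euclidean_space \<times> 'a" and P :: "'a \<Rightarrow> 'a"
    and \<beta> :: "'a \<times> 'a \<Rightarrow> 'a \<times> 'a \<Rightarrow> real"
  assumes P: "linear P" "inj P" and \<beta>: "bilinear \<beta>"
    and inf: "\<And>y. y \<noteq> 0 \<Longrightarrow> \<beta> (0, y) (0, y) < 0"
    and freq: "\<And>\<omega> x1 x2 y1 y2. P y1 = \<omega> *\<^sub>R x2 \<Longrightarrow> P y2 = - (\<omega> *\<^sub>R x1) \<Longrightarrow> x1 \<noteq> 0 \<or> x2 \<noteq> 0 \<Longrightarrow>
        \<beta> (x1, y1) (x1, y1) + \<beta> (x2, y2) (x2, y2) < 0"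
    and S: "linear S"
    and skew: "\<And>\<xi> \<eta>. (\<Sum>b\<in>Basis. (\<xi> \<bullet> P (snd (S b))) * (\<eta> \<bullet> fst (S b)) + (\<eta> \<bullet> P (snd (S b))) * (\<xi> \<bullet> fst (S b))) = 0"
    and nz: "\<exists>w. S w \<noteq> 0"
  shows "(\<Sum>b\<in>Basis. \<beta> (S b) (S b)) < 0"
  using S skew nz
\<comment> \<open>The measure is the rank of \<open>S\<close>.\<close>
proof (induction "DIM('w) - dim {w. S w = 0}" arbitrary: S rule: less_induct)
  case less
  note S = less.prems(1)
  have subS: "subspace {w. S w = 0}" if "linear S" for S :: "'w \<Rightarrow> 'a \<times> 'a"
    using that by (simp add: linear_subspace_kernel)
  define X Y where "X w = fst (S w)" and "Y w = snd (S w)" for w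
  have S_eq: "S w = (X w, Y w)" for w by (simp add: X_def Y_def)
  have X: "linear X" and Y: "linear Y"
    using linear_compose[OF S linear_fst] linear_compose[OF S linear_snd]
    by (simp_all add: X_def[abs_def] Y_def[abs_def] o_def)
  define T where "T S \<xi> \<eta> = (\<Sum>b\<in>Basis. (\<xi> \<bullet> P (snd (S b))) * (\<eta> \<bullet> fst (S b)) + (\<eta> \<bullet> P (snd (S b))) * (\<xi> \<bullet> fst (S b)))"
    for S :: "'w \<Rightarrow> 'a \<times> 'a" and \<xi> \<eta>
  have T0: "T S \<xi> \<eta> = 0" for \<xi> \<eta> using less.prems(2) by (simp add: T_def)
  define d where "d a S = (\<lambda>w. S (w - (a \<bullet> w) *\<^sub>R a))" for a :: 'w and S :: "'w \<Rightarrow> 'a \<times> 'a"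
  have d_lin: "linear (d a S)" if "linear S" for a S
    unfolding d_def
    by (rule linearI) (simp_all add: linear_diff[OF that] linear_add[OF that] linear_cmul[OF that] inner_simps algebra_simps)
  have d_T: "T (d a S) \<xi> \<eta> = T S \<xi> \<eta> - ((\<xi> \<bullet> P (snd (S a))) * (\<eta> \<bullet> fst (S a)) + (\<eta> \<bullet> P (snd (S a))) * (\<xi> \<bullet> fst (S a)))"
    if "linear S" "norm a = 1" for a S \<xi> \<eta>
  proof -
    have "bilinear (\<lambda>u v. (\<xi> \<bullet> P (snd (S u))) * (\<eta> \<bullet> fst (S v)) + (\<eta> \<bullet> P (snd (S u))) * (\<xi> \<bullet> fst (S v)))"
      unfolding bilinear_def
      by (auto intro!: linearI simp: linear_add[OF that(1)] linear_cmul[OF that(1)] linear_add[OF P(1)]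
          linear_cmul[OF P(1)] inner_simps algebra_simps)
    from trace_deflate[OF this that(2)] show ?thesis by (simp add: T_def d_def)
  qed
  have d_\<beta>: "(\<Sum>b\<in>Basis. \<beta> (d a S b) (d a S b)) = (\<Sum>b\<in>Basis. \<beta> (S b) (S b)) - \<beta> (S a) (S a)"
    if "linear S" "norm a = 1" for a S
    using trace_deflate[OF bilinear_compose_linear[OF \<beta> that(1) that(1)] that(2)] by (simp add: d_def)
  have d_ker: "dim {w. S w = 0} < dim {w. d a S w = 0}"
    if "linear S" "norm a = 1" and ort: "\<And>w. S w = 0 \<Longrightarrow> a \<bullet> w = 0" for a S
  proof (rule dim_psubset)
    have "{w. S w = 0} \<subset> {w. d a S w = 0}"
    proof
      show "{w. S w = 0} \<subseteq> {w. d a S w = 0}" using ort by (auto simp: d_def)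
      have "a \<in> {w. d a S w = 0}" using that by (simp add: d_def norm_eq_1 linear_0)
      moreover have "a \<notin> {w. S w = 0}" using ort[of a] that(2) by (auto simp: norm_eq_1)
      ultimately show "{w. S w = 0} \<noteq> {w. d a S w = 0}" by blast
    qed
    then show "span {w. S w = 0} \<subset> span {w. d a S w = 0}"
      unfolding subS[OF that(1), folded span_eq_iff] subS[OF d_lin[OF that(1)], folded span_eq_iff] .
  qed
  have dim_le: "dim A \<le> DIM('w)" for A :: "'w set" by (rule dim_subset_UNIV)
  \<comment> \<open>Only a weak inequality, because a deflated map may vanish altogether. Whenever a
    piece is removed, the strict sign comes from that piece.\<close>
  have le: "(\<Sum>b\<in>Basis. \<beta> (S' b) (S' b)) \<le> 0"
    if "linear S'" "\<And>\<xi> \<eta>. T S' \<xi> \<eta> = 0" "dim {w. S w = 0} < dim {w. S' w = 0}" for S'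
  proof (cases "\<exists>w. S' w \<noteq> 0")
    case True
    have "(\<Sum>b\<in>Basis. \<beta> (S' b) (S' b)) < 0"
      using that(1,2) True unfolding T_def
      by (rule less.hyps[rotated]) (use that(3) dim_le[of "{w. S' w = 0}"] in linarith)
    then show ?thesis by simp
  next
    case False
    then have "S' w = 0" for w by blast
    then show ?thesis using bilinear_lzero[OF \<beta>] by simp
  qed
  show ?case
  proof (cases "\<exists>w. X w = 0 \<and> S w \<noteq> 0")
    case True
    then obtain w where w: "X w = 0" "S w \<noteq> 0" by blast
    \<comment> \<open>the direction must be orthogonal to the kernel, or deflation need not enlarge the kernel\<close>
    obtain u v where uv: "u \<in> span {w. S w = 0}" "\<And>z. z \<in> span {w. S w = 0} \<Longrightarrow> orthogonal v z" "w = u + v"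
      using orthogonal_subspace_decomp_exists[of "{w. S w = 0}" w] by metis
    have u0: "S u = 0" using uv(1) subS[OF S] by (simp add: span_eq_iff[THEN iffD2])
    then have Sv: "S v = S w" using uv(3) linear_add[OF S] by simp
    then have v0: "v \<noteq> 0" using w linear_0[OF S] by auto
    define a where "a = (1 / norm v) *\<^sub>R v"
    have na: "norm a = 1" using v0 by (simp add: a_def)
    have ort: "a \<bullet> z = 0" if "S z = 0" for z
      using uv(2)[of z] that by (simp add: a_def span_base orthogonal_def)
    have Sa: "S a = (0, (1 / norm v) *\<^sub>R Y w)"
      using Sv w(1) by (simp add: a_def linear_cmul[OF X] linear_cmul[OF Y] S_eq)
    have "Y w \<noteq> 0" using w by (auto simp: S_eq zero_prod_def)
    then have "\<beta> (S a) (S a) < 0" using v0 unfolding Sa by (intro inf) simp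
    moreover have "(\<Sum>b\<in>Basis. \<beta> (d a S b) (d a S b)) \<le> 0"
      using d_T[OF S na] T0 Sa by (intro le d_lin S d_ker na ort) simp_all
    ultimately show ?thesis using d_\<beta>[OF S na] by simp
  next
    case False
    then have kerX: "X w = 0 \<Longrightarrow> S w = 0" for w by blast
    define W where "W = {w. \<forall>z. X z = 0 \<longrightarrow> orthogonal w z}"
    have W: "subspace W"
      unfolding W_def subspace_def orthogonal_def by (auto simp: inner_simps)
    have decomp: "\<exists>u v. X u = 0 \<and> v \<in> W \<and> w = u + v" for w
    proof -
      obtain u v where uv: "u \<in> span {w. X w = 0}" "\<And>z. z \<in> span {w. X w = 0} \<Longrightarrow> orthogonal v z" "w = u + v"
        using orthogonal_subspace_decomp_exists[of "{w. X w = 0}" w] by metis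
      have "subspace {w. X w = 0}" using X by (simp add: linear_subspace_kernel)
      then have "X u = 0" using uv(1) by (simp add: span_eq_iff[THEN iffD2])
      moreover have "v \<in> W" using uv(2) by (simp add: W_def span_base)
      ultimately show ?thesis using uv(3) by blast
    qed
    have injW: "inj_on X W"
    proof (rule inj_onI)
      fix u v assume uv: "u \<in> W" "v \<in> W" "X u = X v"
      then have "X (u - v) = 0" by (simp add: linear_diff[OF X])
      moreover have "u - v \<in> W" using uv W by (simp add: subspace_diff)
      ultimately have "orthogonal (u - v) (u - v)" by (simp add: W_def)
      then show "u = v" by (simp add: orthogonal_def)
    qed
    obtain g where g: "range g \<subseteq> W" "linear g" "\<And>v. v \<in> W \<Longrightarrow> g (X v) = v"
      using linear_exists_left_inverse_on[OF X W injW] by blast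
    have PY: "linear (\<lambda>w. P (Y w))" using linear_compose[OF Y P(1)] by (simp add: o_def)
    have T': "X (\<Sum>b\<in>Basis. (\<xi> \<bullet> P (Y b)) *\<^sub>R b) \<bullet> \<eta> + (\<Sum>b\<in>Basis. (\<eta> \<bullet> P (Y b)) * (\<xi> \<bullet> X b)) = 0" for \<xi> \<eta>
      using T0[of \<xi> \<eta>]
      by (simp add: T_def S_eq linear_sum[OF X] linear_cmul[OF X] inner_sum_left inner_sum_right sum.distrib inner_commute)
    \<comment> \<open>Let n be the part of P (Y w) orthogonal to the range of X, and u the image of
      n under the adjoint of w \<mapsto> P (Y w). By \<open>T'\<close>, X u is orthogonal to
      everything, so X u = 0 and then Y u = 0 by \<open>kerX\<close>; thus |u|^2 = n . P (Y u) = 0.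
      So n is orthogonal to P (Y w), of which it is a component, and vanishes.\<close>
    have rng: "\<exists>v\<in>W. X v = P (Y w)" for w
    proof -
      obtain p n where pn: "p \<in> span (range X)" "\<And>z. z \<in> span (range X) \<Longrightarrow> orthogonal n z" "P (Y w) = p + n"
        using orthogonal_subspace_decomp_exists[of "range X" "P (Y w)"] by metis
      have nX: "n \<bullet> X z = 0" for z using pn(2) by (simp add: span_base orthogonal_def)
      define u where "u = (\<Sum>b\<in>Basis. (n \<bullet> P (Y b)) *\<^sub>R b)"
      have un: "u \<bullet> z = n \<bullet> P (Y z)" for z
      proof -
        have "n \<bullet> P (Y z) = n \<bullet> P (Y (\<Sum>b\<in>Basis. (z \<bullet> b) *\<^sub>R b))" by (simp add: euclidean_representation)
        also have "\<dots> = (\<Sum>b\<in>Basis. (z \<bullet> b) * (n \<bullet> P (Y b)))"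
          by (simp add: linear_sum[OF PY] linear_cmul[OF PY] inner_sum_right)
        finally show ?thesis by (simp add: u_def inner_sum_left inner_sum_right inner_commute mult.commute)
      qed
      have "X u \<bullet> \<eta> = 0" for \<eta> using T'[of n \<eta>] by (simp add: nX u_def)
      from this[of "X u"] have "X u = 0" by simp
      then have "Y u = 0" using kerX[of u] by (simp add: S_eq zero_prod_def)
      then have "u \<bullet> u = 0" unfolding un using linear_0[OF P(1)] by simp
      then have "n \<bullet> P (Y w) = 0" using un[of w] by simp
      moreover have "n \<bullet> p = 0" using pn(1,2) by (simp add: orthogonal_def)
      ultimately have "n = 0" using pn(3) by (simp add: inner_simps)
      moreover have "subspace (range X)" using linear_subspace_image[OF X subspace_UNIV] .
      ultimately obtain z where z: "P (Y w) = X z" using pn by (auto simp: span_eq_iff[THEN iffD2])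
      obtain u v where "X u = 0" "v \<in> W" "z = u + v" using decomp by blast
      then show ?thesis using z by (auto simp: linear_add[OF X])
    qed
    define \<Theta> where "\<Theta> w = g (P (Y w))" for w
    have \<Theta>: "linear \<Theta>" using linear_compose[OF PY g(2)] by (simp add: \<Theta>_def[abs_def] o_def)
    have X\<Theta>: "X (\<Theta> w) = P (Y w)" for w using rng[of w] g(3) by (metis \<Theta>_def)
    have \<Theta>W: "\<Theta> w \<in> W" for w using g(1) by (auto simp: \<Theta>_def)
    \<comment> \<open>On W every functional factors through X. This lets the trace identity, tested
      with arbitrary \<xi> and \<eta>, be read as skewness of \<Theta> on W.\<close>
    have adjW: "\<exists>\<xi>. \<forall>z. f \<bullet> z = \<xi> \<bullet> X z" if f: "f \<in> W" for f
    proof (intro exI allI)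
      fix z
      obtain u v where uv: "X u = 0" "v \<in> W" "z = u + v" using decomp by blast
      have "f \<bullet> z = f \<bullet> g (X z)"
        using uv f g(3) by (simp add: W_def orthogonal_def inner_simps linear_add[OF X])
      then show "f \<bullet> z = adjoint g f \<bullet> X z"
        by (simp add: adjoint_clauses[OF g(2)])
    qed
    have skew: "f \<bullet> \<Theta> h + h \<bullet> \<Theta> f = 0" if fh: "f \<in> W" "h \<in> W" for f h
    proof -
      obtain \<xi> \<eta> where e: "\<And>z. f \<bullet> z = \<xi> \<bullet> X z" "\<And>z. h \<bullet> z = \<eta> \<bullet> X z"
        using adjW fh by meson
      have tr: "(\<Sum>b\<in>Basis. (u \<bullet> \<Theta> b) * (v \<bullet> b)) = u \<bullet> \<Theta> v" for u v
      proof -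
        have "u \<bullet> \<Theta> v = u \<bullet> \<Theta> (\<Sum>b\<in>Basis. (v \<bullet> b) *\<^sub>R b)" by (simp add: euclidean_representation)
        then show ?thesis
          by (simp add: linear_sum[OF \<Theta>] linear_cmul[OF \<Theta>] inner_sum_right mult.commute)
      qed
      have "0 = T S \<xi> \<eta>" using T0 by simp
      also have "\<dots> = (\<Sum>b\<in>Basis. (f \<bullet> \<Theta> b) * (h \<bullet> b) + (h \<bullet> \<Theta> b) * (f \<bullet> b))"
        unfolding T_def S_eq fst_conv snd_conv e X\<Theta> ..
      finally show ?thesis by (simp add: sum.distrib tr)
    qed
    obtain w0 where w0: "S w0 \<noteq> 0" using less.prems(3) by blast
    have "W \<noteq> {0}"
    proof
      assume "W = {0}"
      then obtain u where "X u = 0" "w0 = u" using decomp[of w0] by auto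
      then show False using kerX w0 by blast
    qed
    then show ?thesis
    proof (rule skew_top_plane[OF \<Theta> W _ \<Theta>W skew])
      \<comment> \<open>Zero frequency: injectivity of P forces Y = 0, and every nonzero column (X
        b, 0) is covered by \<open>freq\<close> with \<omega> = 0.\<close>
      assume z: "\<And>w. w \<in> W \<Longrightarrow> \<Theta> w = 0"
      have Y0: "Y w = 0" for w
      proof -
        obtain u v where uv: "X u = 0" "v \<in> W" "w = u + v" using decomp by blast
        have "P (Y v) = 0" using X\<Theta>[of v] z[OF uv(2)] linear_0[OF X] by simp
        then have "Y v = 0" using P by (metis linear_injective_0)
        moreover have "Y u = 0" using kerX[OF uv(1)] by (simp add: S_eq zero_prod_def)
        ultimately show ?thesis using uv(3) by (simp add: linear_add[OF Y])
      qed
      have neg: "\<beta> (S b) (S b) \<le> 0" "S b \<noteq> 0 \<Longrightarrow> \<beta> (S b) (S b) < 0" for b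
      proof -
        show n: "S b \<noteq> 0 \<Longrightarrow> \<beta> (S b) (S b) < 0"
          using freq[of 0 0 0 0 "X b"] linear_0[OF P(1)] bilinear_lzero[OF \<beta>] by (simp add: S_eq Y0 zero_prod_def)
        show "\<beta> (S b) (S b) \<le> 0"
          using n bilinear_lzero[OF \<beta>] by (cases "S b = 0") auto
      qed
      obtain b where "b \<in> Basis" "S b \<noteq> 0"
        using w0 linear_eq_0_on_span[OF S, of Basis w0] span_Basis by auto
      then have "0 < (\<Sum>b\<in>Basis. - \<beta> (S b) (S b))"
        using neg by (intro sum_pos2[of _ b]) auto
      then show ?thesis by (simp add: sum_negf)
    next
      fix a b \<omega>
      assume ab: "a \<in> W" "b \<in> W" "norm a = 1" "norm b = 1" "a \<bullet> b = 0"
        "\<Theta> a = \<omega> *\<^sub>R b" "\<Theta> b = - (\<omega> *\<^sub>R a)"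
      have Pa: "P (Y a) = \<omega> *\<^sub>R X b" "P (Y b) = - (\<omega> *\<^sub>R X a)"
        using X\<Theta>[of a] X\<Theta>[of b] ab by (simp_all add: linear_cmul[OF X] linear_neg[OF X])
      have "X a \<noteq> 0"
        using injW ab(1,3) subspace_0[OF W] linear_0[OF X] by (metis inj_onD norm_zero zero_neq_one)
      then have "\<beta> (S a) (S a) + \<beta> (S b) (S b) < 0"
        using freq[OF Pa] by (simp add: S_eq)
      moreover
      let ?S = "d a S"
      have S1: "linear ?S" by (rule d_lin[OF S])
      have Sb: "?S b = S b" using ab(5) by (simp add: d_def)
      have ortW: "w \<bullet> z = 0" if "w \<in> W" "S z = 0" for w z
        using that by (auto simp: W_def orthogonal_def S_eq zero_prod_def)
      have ort2: "b \<bullet> z = 0" if "?S z = 0" for z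
        using ortW[OF ab(2), of "z - (a \<bullet> z) *\<^sub>R a"] that ab(5) by (simp add: d_def inner_simps inner_commute)
      \<comment> \<open>Both deflations precede the use of \<open>le\<close>: removing a alone can
        violate the identity \<open>T\<close> = 0, but by \<open>Pa\<close> the contributions of a
        and b cancel.\<close>
      have "(\<Sum>u\<in>Basis. \<beta> (d b ?S u) (d b ?S u)) \<le> 0"
      proof (rule le)
        show "linear (d b ?S)" by (rule d_lin[OF S1])
        show "dim {w. S w = 0} < dim {w. d b ?S w = 0}"
          using d_ker[OF S ab(3) ortW[OF ab(1)]] d_ker[OF S1 ab(4) ort2] by simp
        show "T (d b ?S) \<xi> \<eta> = 0" for \<xi> \<eta>
          unfolding d_T[OF S1 ab(4)] d_T[OF S ab(3)] T0 Sb
          by (simp add: S_eq Pa algebra_simps)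
      qed
      ultimately show ?thesis
        using d_\<beta>[OF S1 ab(4)] d_\<beta>[OF S ab(3)] Sb by simp
    qed
  qed
qed

text \<open>The first component of \<open>\<phi>\<close> is the matrix P y x^T + x (P y)^T, so
  pairing it with B gives the form of B + B^T at (P y, x). A functional (B, \<tau>) that separates
  strictly has \<tau> < 0, and division by \<tau> yields X. If instead the convex hull of the form
  values met the half line, a convex combination would produce a map S excluded by
  \<open>frequency_condition_imp_trace_neg\<close>.\<close>

lemma kyp_separation:
  fixes P :: "real^'k \<Rightarrow> real^'k" and \<beta> :: "(real^'k) \<times> (real^'k) \<Rightarrow> (real^'k) \<times> (real^'k) \<Rightarrow> real"
  assumes P: "linear P" "inj P" and \<beta>: "bilinear \<beta>"
    and inf: "\<And>y. y \<noteq> 0 \<Longrightarrow> \<beta> (0, y) (0, y) < 0"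
    and freq: "\<And>\<omega> x1 x2 y1 y2. P y1 = \<omega> *\<^sub>R x2 \<Longrightarrow> P y2 = - (\<omega> *\<^sub>R x1) \<Longrightarrow> x1 \<noteq> 0 \<or> x2 \<noteq> 0 \<Longrightarrow>
        \<beta> (x1, y1) (x1, y1) + \<beta> (x2, y2) (x2, y2) < 0"
  shows "\<exists>X :: real^'k^'k. transpose X = X \<and> (\<forall>x y. P y \<bullet> (X *v x) + \<beta> (x, y) (x, y) \<le> 0)"
proof -
  define \<phi> where "\<phi> s = ((\<chi> i j. P (snd s) $ i * fst s $ j + fst s $ i * P (snd s) $ j) :: real^'k^'k, \<beta> s s)"
    for s :: "(real^'k) \<times> (real^'k)"
  define K where "K = \<phi> ` sphere 0 1"
  have "bounded_bilinear \<beta>" using \<beta> by (simp add: bilinear_conv_bounded_bilinear)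
  then have cont: "continuous_on UNIV \<phi>"
    unfolding \<phi>_def
    by (intro continuous_on_Pair continuous_on_vec_lambda continuous_on_add continuous_on_mult
        continuous_on_component bounded_bilinear.continuous_on[of \<beta>] continuous_on_id
        linear_continuous_on_compose[OF _ P(1)] continuous_on_fst continuous_on_snd)
  then have K: "compact K"
    unfolding K_def by (meson compact_continuous_image compact_sphere continuous_on_subset subset_UNIV)
  define T :: "((real^'k^'k) \<times> real) set" where "T = {0} \<times> {0..}"
  have T: "convex T" "closed T"
    unfolding T_def by (auto intro!: convex_Times closed_Times)
  obtain s0 :: "(real^'k) \<times> (real^'k)" where "norm s0 = 1"
    using vector_choose_size[of 1] by (metis zero_le_one)
  then have Kne: "K \<noteq> {}" by (force simp: K_def)
  have disj: "T \<inter> convex hull K = {}"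
  proof (rule ccontr)
    assume "T \<inter> convex hull K \<noteq> {}"
    then obtain r where r: "0 \<le> r" "(0, r) \<in> convex hull K" by (auto simp: T_def)
    obtain F where F: "finite F" "F \<subseteq> K" "card F \<le> DIM((real^'k^'k) \<times> real) + 1" "(0, r) \<in> convex hull F"
      using r(2) unfolding caratheodory[of K] by blast
    obtain u where u: "\<And>x. x \<in> F \<Longrightarrow> 0 \<le> u x" "sum u F = 1" "(\<Sum>x\<in>F. u x *\<^sub>R x) = (0, r)"
      using F(4) unfolding convex_hull_finite[OF F(1)] by blast
    \<comment> \<open>For k = CARD('k) the ambient space has dimension k^2 + 1, so Caratheodory
      leaves at most k^2 + 2 points. The type with two applications of \<open>option\<close> has
      exactly that many elements and can index the columns of S.\<close>
    have "card F \<le> CARD(('k \<times> 'k) option option)"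
      using F(3) by (simp add: card_UNIV_option)
    then obtain h :: "_ \<Rightarrow> ('k \<times> 'k) option option" where h: "inj_on h F"
      using card_le_inj[OF F(1), of "UNIV :: ('k \<times> 'k) option option set"] by auto
    have "\<forall>x\<in>F. \<exists>s. norm s = 1 \<and> x = \<phi> s"
    proof
      fix x assume "x \<in> F"
      then have "x \<in> \<phi> ` sphere 0 1" using F(2) by (auto simp only: K_def)
      then show "\<exists>s. norm s = 1 \<and> x = \<phi> s" by (metis imageE mem_sphere_0)
    qed
    then obtain e where e: "\<And>x. x \<in> F \<Longrightarrow> norm (e x) = 1 \<and> x = \<phi> (e x)"
      using bchoice[of F "\<lambda>x s. norm s = 1 \<and> x = \<phi> s"] by blast
    \<comment> \<open>The columns are weighted by square roots, so that summing a quadratic form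
      over them reproduces the convex combination of its values.\<close>
    define S :: "real^(('k \<times> 'k) option option) \<Rightarrow> _" where
      "S w = (\<Sum>x\<in>F. (w $ h x * sqrt (u x)) *\<^sub>R e x)" for w
    have S: "linear S"
      unfolding S_def by (rule linearI) (simp_all add: sum.distrib algebra_simps scaleR_sum_right)
    have S_axis: "S (axis (h x) 1) = sqrt (u x) *\<^sub>R e x" if "x \<in> F" for x
    proof -
      have "S (axis (h x) 1) = (\<Sum>y\<in>F. if y = x then sqrt (u x) *\<^sub>R e x else 0)"
        unfolding S_def
        by (rule sum.cong) (use that h in \<open>auto simp: axis_def inj_on_eq_iff\<close>)
      then show ?thesis using that F(1) by simp
    qed
    have S_axis0: "S (axis j 1) = 0" if "j \<notin> h ` F" for j
      unfolding S_def by (rule sum.neutral) (use that in \<open>auto simp: axis_def\<close>)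
    have S_sum: "(\<Sum>b\<in>Basis. q (S b)) = (\<Sum>x\<in>F. u x * q (e x))"
      if q: "\<And>c s. q (c *\<^sub>R s) = c\<^sup>2 * q s" for q :: "_ \<Rightarrow> real"
    proof -
      have q0: "q 0 = 0" using q[of 0 0] by simp
      have "(\<Sum>b\<in>Basis. q (S b)) = (\<Sum>j\<in>UNIV. q (S (axis j 1)))"
        unfolding Basis_vec_def
        by (subst sum.UNION_disjoint) (auto simp: axis_eq_axis)
      also have "\<dots> = (\<Sum>j\<in>h ` F. q (S (axis j 1)))"
        by (rule sum.mono_neutral_right) (auto simp: S_axis0 q0)
      also have "\<dots> = (\<Sum>x\<in>F. q (S (axis (h x) 1)))"
        by (simp add: sum.reindex[OF h])
      also have "\<dots> = (\<Sum>x\<in>F. u x * q (e x))"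
        by (rule sum.cong) (simp_all add: S_axis q u(1))
      finally show ?thesis .
    qed
    have u1: "(\<Sum>x\<in>F. u x *\<^sub>R fst (\<phi> (e x))) = 0" and u2: "(\<Sum>x\<in>F. u x * snd (\<phi> (e x))) = r"
    proof -
      have *: "(\<Sum>x\<in>F. u x *\<^sub>R \<phi> (e x)) = (0, r)"
        using u(3) e by (metis (no_types, lifting) sum.cong)
      show "(\<Sum>x\<in>F. u x *\<^sub>R fst (\<phi> (e x))) = 0" "(\<Sum>x\<in>F. u x * snd (\<phi> (e x))) = r"
        using arg_cong[OF *, of fst] arg_cong[OF *, of snd] by (simp_all add: fst_sum snd_sum)
    qed
    have "(\<Sum>b\<in>Basis. \<beta> (S b) (S b)) < 0"
    proof (rule frequency_condition_imp_trace_neg[OF P \<beta> inf freq S])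
      fix \<xi> \<eta> :: "real^'k"
      let ?q = "\<lambda>s. (\<xi> \<bullet> P (snd s)) * (\<eta> \<bullet> fst s) + (\<eta> \<bullet> P (snd s)) * (\<xi> \<bullet> fst s)"
      have q: "?q s = (\<Sum>i\<in>UNIV. \<Sum>j\<in>UNIV. \<xi> $ i * \<eta> $ j * fst (\<phi> s) $ i $ j)" for s
      proof -
        have "?q s = (\<xi> \<bullet> P (snd s)) * (\<eta> \<bullet> fst s) + (\<xi> \<bullet> fst s) * (\<eta> \<bullet> P (snd s))" by simp
        then show ?thesis
          unfolding \<phi>_def inner_vec_def sum_product by (simp add: sum.distrib algebra_simps)
      qed
      have "(\<Sum>b\<in>Basis. ?q (S b)) = (\<Sum>x\<in>F. u x * ?q (e x))"
        by (rule S_sum) (simp add: linear_cmul[OF P(1)] power2_eq_square algebra_simps)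
      also have "\<dots> = (\<Sum>i\<in>UNIV. \<Sum>j\<in>UNIV. \<xi> $ i * \<eta> $ j * (\<Sum>x\<in>F. u x *\<^sub>R fst (\<phi> (e x))) $ i $ j)"
        unfolding q sum_component vector_scaleR_component real_scaleR_def sum_distrib_left
        by (subst sum.swap, rule sum.cong[OF refl], subst sum.swap) (simp add: mult_ac)
      also have "\<dots> = 0" unfolding u1 by simp
      finally show "(\<Sum>b\<in>Basis. ?q (S b)) = 0" .
    next
      have "\<exists>x\<in>F. u x \<noteq> 0" using u(2) by (metis sum.neutral zero_neq_one)
      then obtain x where "x \<in> F" "u x \<noteq> 0" by blast
      then have "S (axis (h x) 1) \<noteq> 0" using S_axis[of x] e[of x] by auto
      then show "\<exists>w. S w \<noteq> 0" by blast
    qed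
    moreover have "(\<Sum>b\<in>Basis. \<beta> (S b) (S b)) = r"
      using S_sum[of "\<lambda>s. \<beta> s s"] u2
      by (simp add: bilinear_lmul[OF \<beta>] bilinear_rmul[OF \<beta>] power2_eq_square \<phi>_def)
    ultimately show False using r(1) by simp
  qed
  have "\<exists>A b. (\<forall>x\<in>T. A \<bullet> x < b) \<and> (\<forall>x\<in>convex hull K. b < A \<bullet> x)"
    by (rule separating_hyperplane_closed_compact[OF T convex_convex_hull compact_convex_hull[OF K] _ disj])
      (simp add: Kne)
  then obtain A b where Ab: "\<And>x. x \<in> T \<Longrightarrow> A \<bullet> x < b" "\<And>x. x \<in> convex hull K \<Longrightarrow> b < A \<bullet> x"
    by blast
  obtain B \<tau> where AB: "A = (B, \<tau>)" by (metis surj_pair)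
  have b: "0 < b" using Ab(1)[of "(0, 0)"] by (simp add: T_def AB)
  \<comment> \<open>The functional is bounded above by b on the whole half line in direction (0,
    1).\<close>
  have "\<tau> \<le> 0"
  proof (rule ccontr)
    assume "\<not> \<tau> \<le> 0"
    then show False using Ab(1)[of "(0, b / \<tau>)"] b by (simp add: T_def AB)
  qed
  have BP: "B \<bullet> fst (\<phi> (x, y)) = P y \<bullet> ((B + transpose B) *v x)" for x y
  proof -
    have "B \<bullet> fst (\<phi> (x, y)) = (\<Sum>i\<in>UNIV. \<Sum>j\<in>UNIV. B $ i $ j * (P y $ i * x $ j)) + (\<Sum>i\<in>UNIV. \<Sum>j\<in>UNIV. B $ i $ j * (x $ i * P y $ j))"
      by (simp add: \<phi>_def inner_vec_def algebra_simps sum.distrib)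
    also have "(\<Sum>i\<in>UNIV. \<Sum>j\<in>UNIV. B $ i $ j * (x $ i * P y $ j)) = (\<Sum>j\<in>UNIV. \<Sum>i\<in>UNIV. B $ i $ j * (x $ i * P y $ j))"
      by (rule sum.swap)
    finally show ?thesis
      by (simp add: inner_vec_def matrix_vector_mult_def transpose_def sum_distrib_left sum.distrib algebra_simps)
  qed
  have main: "b < P y \<bullet> ((B + transpose B) *v x) + \<tau> * \<beta> (x, y) (x, y)" if "norm (x, y) = 1" for x y
  proof -
    have "(x, y) \<in> sphere 0 1" using that by (metis mem_sphere_0)
    then have "\<phi> (x, y) \<in> convex hull K" unfolding K_def by (intro hull_inc imageI)
    from Ab(2)[OF this] have "b < B \<bullet> fst (\<phi> (x, y)) + \<tau> * snd (\<phi> (x, y))"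
      by (metis AB inner_Pair inner_real_def prod.collapse)
    then show ?thesis unfolding BP by (simp add: \<phi>_def)
  qed
  \<comment> \<open>At y = 0 the matrix part vanishes, so \<tau> = 0 would leave b < 0.\<close>
  have "\<tau> \<noteq> 0"
  proof
    assume "\<tau> = 0"
    moreover obtain x :: "real^'k" where "norm x = 1" using vector_choose_size[of 1] by auto
    ultimately show False using main[of x 0] b linear_0[OF P(1)] by (simp add: norm_Pair)
  qed
  then have \<tau>: "\<tau> < 0" using \<open>\<tau> \<le> 0\<close> by simp
  define X where "X = (1 / \<tau>) *\<^sub>R (B + transpose B)"
  have "transpose X = X" by (simp add: X_def transpose_def vec_eq_iff add.commute)
  moreover have "P y \<bullet> (X *v x) + \<beta> (x, y) (x, y) \<le> 0" for x y
  proof (cases "(x, y) = 0")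
    case True
    then show ?thesis using bilinear_lzero[OF \<beta>] by (simp add: zero_prod_def)
  next
    case False
    define c where "c = norm (x, y)"
    have c: "c > 0" using False by (simp add: c_def)
    have "norm ((1/c) *\<^sub>R x, (1/c) *\<^sub>R y) = norm ((1/c) *\<^sub>R (x, y))" by simp
    also have "\<dots> = 1" unfolding norm_scaleR using c by (simp add: c_def)
    finally have "b < P ((1/c) *\<^sub>R y) \<bullet> ((B + transpose B) *v ((1/c) *\<^sub>R x)) + \<tau> * \<beta> ((1/c) *\<^sub>R (x, y)) ((1/c) *\<^sub>R (x, y))"
      using main by simp
    then have "b < (1/c)\<^sup>2 * (P y \<bullet> ((B + transpose B) *v x) + \<tau> * \<beta> (x, y) (x, y))"
      unfolding linear_cmul[OF P(1)] bilinear_lmul[OF \<beta>] bilinear_rmul[OF \<beta>] matrix_vector_mult_scaleR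
      by (simp add: power2_eq_square algebra_simps)
    then have "0 < P y \<bullet> ((B + transpose B) *v x) + \<tau> * \<beta> (x, y) (x, y)"
      using b c by (smt (verit) zero_less_mult_pos zero_less_power divide_pos_pos)
    moreover have "1 / \<tau> < 0" using \<tau> by simp
    ultimately have "(1 / \<tau>) * (P y \<bullet> ((B + transpose B) *v x) + \<tau> * \<beta> (x, y) (x, y)) < 0"
      by (rule mult_neg_pos[rotated])
    then show ?thesis using \<tau> by (simp add: X_def scaleR_matrix_vector_assoc[symmetric] algebra_simps)
  qed
  ultimately show ?thesis by blast
qed


section \<open>The frequency condition\<close>

text \<open>
  The extremal \<open>\<omega>\<close> is the largest one at which the form
  \<open>\<bar>\<omega> F s - s\<bar>\<^sup>2 - k \<bar>s\<bar>\<^sup>2\<close> fails to be positive definite; there it is nonnegative with a zero,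
  so the zero lies in its kernel.
\<close>

lemma extremal_frequency:
  fixes F :: "'e::euclidean_space \<Rightarrow> 'e"
  assumes F: "linear F" "inj F" and s0: "s0 \<noteq> 0"
    and le: "(norm (\<omega>0 *\<^sub>R F s0 - s0))\<^sup>2 \<le> k * (norm s0)\<^sup>2"
  shows "\<exists>\<omega> s. s \<noteq> 0 \<and> (\<forall>v. (\<omega> *\<^sub>R F s - s) \<bullet> (\<omega> *\<^sub>R F v - v) = k * (s \<bullet> v))"
proof -
  define h where "h \<omega> s = (norm (\<omega> *\<^sub>R F s - s))\<^sup>2 - k * (norm s)\<^sup>2" for \<omega> s
  define C where "C = {(\<omega>, s). norm s = 1 \<and> h \<omega> s \<le> 0}"
  have h_scale: "h \<omega> (c *\<^sub>R s) = c\<^sup>2 * h \<omega> s" for \<omega> c s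
  proof -
    have *: "norm (\<omega> *\<^sub>R F (c *\<^sub>R s) - c *\<^sub>R s) = \<bar>c\<bar> * norm (\<omega> *\<^sub>R F s - s)"
      by (metis (no_types, lifting) linear_cmul[OF F(1)] norm_scaleR scaleR_left_commute scaleR_right_diff_distrib)
    show ?thesis unfolding h_def * by (simp add: power_mult_distrib algebra_simps)
  qed
  have F_bl: "bounded_linear F" using F(1) by (simp add: linear_conv_bounded_linear)
  have h_cont: "continuous_on UNIV (\<lambda>(\<omega>, s). h \<omega> s)"
    unfolding h_def case_prod_beta
    by (intro continuous_intros bounded_linear.continuous_on[OF F_bl])
  obtain B where B: "0 < B" "\<And>s. B * norm s \<le> norm (F s)"
    using linear_inj_bounded_below_pos[OF F] by blast
  \<comment> \<open>Since F is bounded below, |\<omega> F s - s| grows with |\<omega>| on the unit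
    sphere. Failures therefore occur at bounded frequencies only, and a largest one exists by
    compactness.\<close>
  have bd: "\<bar>\<omega>\<bar> \<le> (1 + sqrt \<bar>k\<bar>) / B" if "(\<omega>, s) \<in> C" for \<omega> s
  proof -
    have s: "norm s = 1" "(norm (\<omega> *\<^sub>R F s - s))\<^sup>2 \<le> k" using that by (auto simp: C_def h_def)
    then have "norm (\<omega> *\<^sub>R F s - s) \<le> sqrt \<bar>k\<bar>"
      by (smt (verit) real_le_rsqrt)
    then have "norm (\<omega> *\<^sub>R F s) \<le> 1 + sqrt \<bar>k\<bar>"
      using norm_triangle_sub[of "\<omega> *\<^sub>R F s" s] s(1) by simp
    moreover have "\<bar>\<omega>\<bar> * B \<le> \<bar>\<omega>\<bar> * norm (F s)"
      using B(2)[of s] s(1) by (intro mult_left_mono) auto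
    ultimately show ?thesis using B(1) by (simp add: field_simps)
  qed
  have "bounded C"
  proof (rule bounded_subset)
    show "bounded ({- ((1 + sqrt \<bar>k\<bar>) / B)..(1 + sqrt \<bar>k\<bar>) / B} \<times> cball (0 :: 'e) 1)"
      by (intro bounded_Times) auto
    show "C \<subseteq> {- ((1 + sqrt \<bar>k\<bar>) / B)..(1 + sqrt \<bar>k\<bar>) / B} \<times> cball (0 :: 'e) 1"
      using bd by (fastforce simp: C_def)
  qed
  moreover have "closed C"
  proof -
    have "C = (\<lambda>(\<omega>, s). h \<omega> s) -` {..0} \<inter> (UNIV \<times> sphere 0 1)"
      by (auto simp: C_def)
    moreover have "closed ((\<lambda>(\<omega>, s). h \<omega> s) -` {..0})"
      using h_cont by (intro closed_vimage) (auto simp: continuous_on_eq_continuous_at)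
    ultimately show ?thesis by (auto intro!: closed_Int closed_Times)
  qed
  ultimately have "compact C" by (simp add: compact_eq_bounded_closed)
  moreover have "C \<noteq> {}"
  proof -
    have "h \<omega>0 ((1 / norm s0) *\<^sub>R s0) \<le> 0"
      unfolding h_scale using le by (intro mult_nonneg_nonpos) (auto simp: h_def)
    then have "(\<omega>0, (1 / norm s0) *\<^sub>R s0) \<in> C" using s0 by (simp add: C_def)
    then show ?thesis by blast
  qed
  ultimately obtain m where m: "m \<in> C" "\<And>c. c \<in> C \<Longrightarrow> fst c \<le> fst m"
    using continuous_attains_sup[of C fst] continuous_on_fst[OF continuous_on_id] by blast
  obtain \<omega> s where ms: "m = (\<omega>, s)" by (metis surj_pair)
  have s: "norm s = 1" "h \<omega> s \<le> 0" using m(1) by (auto simp: C_def ms)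
  have pos: "0 \<le> h \<omega> v" for v
  proof (cases "v = 0")
    case True
    then show ?thesis using h_scale[of \<omega> 0 0] by simp
  next
    case False
    \<comment> \<open>Beyond the largest failing frequency the form is positive. Its sign at
      \<omega> itself is obtained by letting \<omega>' decrease to \<omega>.\<close>
    have "0 < h \<omega>' v" if "\<omega> < \<omega>'" for \<omega>'
    proof (rule ccontr)
      assume "\<not> 0 < h \<omega>' v"
      then have "h \<omega>' ((1 / norm v) *\<^sub>R v) \<le> 0"
        unfolding h_scale by (intro mult_nonneg_nonpos) auto
      then have "(\<omega>', (1 / norm v) *\<^sub>R v) \<in> C" using False by (simp add: C_def)
      then show False using m(2) that by (force simp: ms)
    qed
    then have "eventually (\<lambda>\<omega>'. 0 \<le> h \<omega>' v) (at_right \<omega>)"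
      by (auto simp: eventually_at_filter less_imp_le)
    moreover have "((\<lambda>\<omega>'. h \<omega>' v) \<longlongrightarrow> h \<omega> v) (at_right \<omega>)"
      unfolding h_def by (intro tendsto_intros)
    ultimately show ?thesis
      by (intro tendsto_lowerbound[of _ _ "at_right \<omega>"]) auto
  qed
  have "(\<omega> *\<^sub>R F s - s) \<bullet> (\<omega> *\<^sub>R F v - v) - k * (s \<bullet> v) = 0" for v
  proof (rule nonneg_quadratic_imp_linear_zero)
    fix t
    have *: "\<omega> *\<^sub>R F (s + t *\<^sub>R v) - (s + t *\<^sub>R v) = (\<omega> *\<^sub>R F s - s) + t *\<^sub>R (\<omega> *\<^sub>R F v - v)"
      by (simp add: linear_add[OF F(1)] linear_cmul[OF F(1)] algebra_simps)
    have n: "(norm (a + t *\<^sub>R b))\<^sup>2 = (norm a)\<^sup>2 + 2 * (a \<bullet> b) * t + (norm b)\<^sup>2 * t\<^sup>2" for a b :: 'e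
      by (simp add: power2_norm_eq_inner inner_simps inner_commute) (simp add: power2_eq_square algebra_simps)
    have "h \<omega> (s + t *\<^sub>R v) = h \<omega> s + 2 * ((\<omega> *\<^sub>R F s - s) \<bullet> (\<omega> *\<^sub>R F v - v) - k * (s \<bullet> v)) * t + h \<omega> v * t\<^sup>2"
      unfolding h_def * n by (simp add: algebra_simps)
    then show "0 \<le> 2 * ((\<omega> *\<^sub>R F s - s) \<bullet> (\<omega> *\<^sub>R F v - v) - k * (s \<bullet> v)) * t + h \<omega> v * t\<^sup>2"
      using pos[of "s + t *\<^sub>R v"] s(2) by linarith
  qed
  moreover have "s \<noteq> 0" using s(1) by auto
  ultimately show ?thesis by (metis eq_iff_diff_eq_0)
qed

section \<open>Matrix inverses, and complex eigenvectors in real coordinates\<close>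

lemma
  fixes A :: "'a::comm_ring_1^'k^'k"
  assumes "invertible A"
  shows matrix_inv_right: "A ** matrix_inv A = mat 1" and matrix_inv_left: "matrix_inv A ** A = mat 1"
  using someI_ex[OF assms[unfolded invertible_def]] by (auto simp: matrix_inv_def)

lemma mult_vec_uminus: "A *v (- x) = - (A *v x)" for A :: "real^'i^'k"
  by (simp add: matrix_vector_mult_def vec_eq_iff sum_negf)

lemma inner_transpose_mult_vec: "x \<bullet> (transpose A *v y) = y \<bullet> (A *v x)" for A :: "real^'i^'k"
  by (metis dot_lmul_matrix inner_commute transpose_matrix_vector)

definition cvec :: "real^'k \<Rightarrow> real^'k \<Rightarrow> complex^'k" where
  "cvec a b = (\<chi> i. Complex (a $ i) (b $ i))"

lemma cvec_eq_0: "cvec a b = 0 \<longleftrightarrow> a = 0 \<and> b = 0"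
  by (auto simp: cvec_def vec_eq_iff Complex_eq_0)

lemma map_matrix_of_real_mult_cvec:
  "map_matrix complex_of_real A *v cvec a b = cvec (A *v a) (A *v b)"
  by (simp add: vec_eq_iff cvec_def map_matrix_def matrix_vector_mult_def complex_eq_iff Re_sum Im_sum)

lemma eigenvalueI:
  assumes "A *v u = Re \<mu> *\<^sub>R u - Im \<mu> *\<^sub>R w" "A *v w = Im \<mu> *\<^sub>R u + Re \<mu> *\<^sub>R w" "u \<noteq> 0 \<or> w \<noteq> 0"
  shows "eigenvalue A \<mu>"
proof -
  have "map_matrix complex_of_real A *v cvec u w = \<mu> *s cvec u w"
    unfolding map_matrix_of_real_mult_cvec assms by (simp add: cvec_def vec_eq_iff complex_eq_iff algebra_simps)
  then show ?thesis
    unfolding eigenvalue_def using assms(3) cvec_eq_0 by blast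
qed

lemma hurwitz_invertible:
  assumes "hurwitz P"
  shows "invertible P"
proof -
  have "P *v x = 0 \<Longrightarrow> x = 0" for x
    using assms eigenvalueI[of P x 0 0] by (fastforce simp: hurwitz_def)
  then show ?thesis
    unfolding invertible_left_inverse matrix_left_invertible_ker by blast
qed

section \<open>Concatenated vectors and block matrices\<close>

lemma vjoin_add: "vjoin a b + vjoin c d = vjoin (a + c) (b + d)"
  by (simp add: vjoin_def vec_eq_iff split: sum.split)

lemma vjoin_scaleR: "k *\<^sub>R vjoin a b = vjoin (k *\<^sub>R a) (k *\<^sub>R b)" for a :: "real^'i" and b :: "real^'j"
  by (simp add: vjoin_def vec_eq_iff split: sum.split)

lemma vjoin_uminus: "- vjoin a b = vjoin (- a) (- b)" for a :: "real^'i" and b :: "real^'j"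
  by (simp add: vjoin_def vec_eq_iff split: sum.split)

lemma vjoin_eq_iff: "vjoin a b = vjoin c d \<longleftrightarrow> a = c \<and> b = d"
  by (force simp: vjoin_def vec_eq_iff split: sum.split)

lemma zero_vjoin: "(0 :: real^('i::finite + 'j::finite)) = vjoin 0 0"
  by (simp add: vjoin_def vec_eq_iff split: sum.split)

lemma sum_UNIV_sum:
  fixes f :: "'i::finite + 'j::finite \<Rightarrow> 'b::comm_monoid_add"
  shows "sum f UNIV = (\<Sum>i\<in>UNIV. f (Inl i)) + (\<Sum>j\<in>UNIV. f (Inr j))"
  using sum.Plus[of UNIV UNIV f] by (simp add: UNIV_Plus_UNIV o_def)

lemma inner_vjoin: "vjoin a b \<bullet> vjoin c d = a \<bullet> c + b \<bullet> d" for a :: "real^'i" and b :: "real^'j"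
  by (simp add: inner_vec_def sum_UNIV_sum vjoin_def)

lemma vjoin_mult_vec: "vjoin A B *v x = vjoin (A *v x) (B *v x)" for A :: "real^'k^'i" and B :: "real^'k^'j"
  by (simp add: vjoin_def vec_eq_iff matrix_vector_mult_def split: sum.split)

lemma hjoin_mult_vec: "hjoin A B *v vjoin x y = A *v x + B *v y" for A :: "real^'i^'k" and B :: "real^'j^'k"
  by (simp add: hjoin_def vjoin_def vec_eq_iff matrix_vector_mult_def sum_UNIV_sum)

lemma block_mult_vec:
  "block A B C D *v vjoin x y = vjoin (A *v x + B *v y) (C *v x + D *v y)"
  for A :: "real^'i^'k" and D :: "real^'j^'l"
  by (simp add: block_def vjoin_mult_vec hjoin_mult_vec)

lemma mat_mult_vec_scalar: "mat z *v x = z *s x" for x :: "'a::comm_ring_1^'k"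
proof -
  have "(\<Sum>j\<in>UNIV. (if i = j then z else 0) * x $ j) = (\<Sum>j\<in>UNIV. if i = j then z * x $ j else 0)" for i
    by (rule sum.cong) auto
  then show ?thesis by (simp add: mat_def matrix_vector_mult_def vec_eq_iff)
qed

lemma mat_mult_vec: "mat k *v x = k *\<^sub>R x" for x :: "real^'k"
  by (simp add: mat_mult_vec_scalar scalar_mult_eq_scaleR)

lemma uminus_mult_vec: "(- A) *v x = - (A *v x)" for A :: "real^'i^'k"
  by (simp add: matrix_vector_mult_def vec_eq_iff sum_negf)

lemma scaleR_mult_vec: "(k *\<^sub>R A) *v x = k *\<^sub>R (A *v x)" for A :: "real^'i^'k"
  by (simp add: matrix_vector_mult_def vec_eq_iff sum_distrib_left mult.assoc)

text \<open>With x = x1 + i x2 and y = y1 + i y2 the hypotheses say P y = - i \<omega> x. For v = y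
  - x this is (- i \<omega> - P) x = P v, so the conclusion is a gain bound from v to x. If it
  failed, there would be an extremal frequency, and the kernel vector found there would extend to an
  eigenvector of \<open>N3\<close> on the imaginary axis.\<close>

lemma N3_frequency_condition:
  fixes P :: "real^'k^'k"
  assumes inv: "invertible P" and c: "0 < 1 - \<alpha> / \<beta>"
    and N3: "\<And>\<mu>. eigenvalue (N3 P \<alpha> \<beta> \<epsilon>) \<mu> \<Longrightarrow> Re \<mu> \<noteq> 0"
    and y1: "P *v y1 = \<omega> *\<^sub>R x2" and y2: "P *v y2 = - (\<omega> *\<^sub>R x1)" and x: "x1 \<noteq> 0 \<or> x2 \<noteq> 0"
  shows "(1 - \<alpha> / \<beta>) * (1 - \<alpha> / \<beta> + \<epsilon>) * (x1 \<bullet> x1 + x2 \<bullet> x2) < (y1 - x1) \<bullet> (y1 - x1) + (y2 - x2) \<bullet> (y2 - x2)"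
proof (rule ccontr)
  let ?c = "1 - \<alpha> / \<beta>"
  let ?k = "?c * (?c + \<epsilon>)"
  assume contra: "\<not> ?thesis"
  define R where "R = matrix_inv P"
  have RP: "R *v (P *v x) = x" and PR: "P *v (R *v x) = x" for x
    using inv by (simp_all add: R_def matrix_vector_mul_assoc matrix_inv_left matrix_inv_right)
  have PR': "transpose P *v (transpose R *v x) = x" for x
  proof -
    have "transpose P ** transpose R = mat 1"
      using inv by (simp add: R_def matrix_inv_left transpose_mat flip: matrix_transpose_mul)
    then show ?thesis by (simp only: matrix_vector_mul_assoc matrix_vector_mul_lid)
  qed
  \<comment> \<open>multiplication by \<open>- \<i> P\<^sup>-\<^sup>1\<close> on \<open>x1 + \<i> x2\<close>\<close>
  define F where "F s = (R *v snd s, - (R *v fst s))" for s :: "(real^'k) \<times> (real^'k)"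
  have F1: "linear F"
    unfolding F_def by (rule linearI) (simp_all add: algebra_simps matrix_vector_right_distrib matrix_vector_mult_scaleR)
  have F2: "inj F"
    by (rule injI) (metis F_def PR neg_equal_iff_equal prod.inject prod_eqI)
  have ne: "(x1, x2) \<noteq> 0" using x by (simp add: zero_prod_def)
  have "y1 = \<omega> *\<^sub>R (R *v x2)" "y2 = - (\<omega> *\<^sub>R (R *v x1))"
    using RP[of y1] RP[of y2] unfolding y1 y2 by (simp_all add: matrix_vector_mult_scaleR mult_vec_uminus)
  then have le: "(norm (\<omega> *\<^sub>R F (x1, x2) - (x1, x2)))\<^sup>2 \<le> ?k * (norm (x1, x2))\<^sup>2"
    using contra by (simp add: F_def power2_norm_eq_inner)
  obtain w s where s: "s \<noteq> 0" "\<And>v. (w *\<^sub>R F s - s) \<bullet> (w *\<^sub>R F v - v) = ?k * (s \<bullet> v)"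
    using extremal_frequency[OF F1 F2 ne le] by blast
  obtain a b where ab: "s = (a, b)" by (metis surj_pair)
  define e f where "e = w *\<^sub>R (R *v b) - a" and "f = - (w *\<^sub>R (R *v a)) - b"
  have ef: "w *\<^sub>R F s - s = (e, f)" by (simp add: F_def ab e_def f_def)
  \<comment> \<open>Together with \<open>2\<close> this is the kernel equation in adjoint form: the
    adjoint of w F - 1 maps (e, f) to k (a, b), where k = c (c + \<epsilon>). Division by c makes it
    the second block row of \<open>N3\<close>.\<close>
  have 1: "- e - w *\<^sub>R (transpose R *v f) = ?k *\<^sub>R a"
  proof (rule vector_eq_ldot[THEN iffD1], rule allI)
    fix v show "v \<bullet> (- e - w *\<^sub>R (transpose R *v f)) = v \<bullet> (?k *\<^sub>R a)"
      using s(2)[of "(v, 0)"] unfolding ef by (simp add: F_def ab inner_simps inner_commute[of _ v] inner_transpose_mult_vec del: transpose_matrix_vector)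
  qed
  have 2: "w *\<^sub>R (transpose R *v e) - f = ?k *\<^sub>R b"
  proof (rule vector_eq_ldot[THEN iffD1], rule allI)
    fix v show "v \<bullet> (w *\<^sub>R (transpose R *v e) - f) = v \<bullet> (?k *\<^sub>R b)"
      using s(2)[of "(0, v)"] unfolding ef by (simp add: F_def ab inner_simps inner_commute[of _ v] inner_transpose_mult_vec del: transpose_matrix_vector)
  qed
  have Pe: "P *v a + P *v e = w *\<^sub>R b" "P *v b + P *v f = - (w *\<^sub>R a)"
    by (simp_all add: e_def f_def matrix_vector_mult_diff_distrib matrix_vector_mult_scaleR mult_vec_uminus PR)
  define c where "c = 1 - \<alpha> / \<beta>"
  have c0: "c \<noteq> 0" using c by (metis c_def less_irrefl)
  have q1: "(1 / c) *\<^sub>R (- e - w *\<^sub>R (transpose R *v f)) = (c + \<epsilon>) *\<^sub>R a"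
    and q2: "(1 / c) *\<^sub>R (w *\<^sub>R (transpose R *v e) - f) = (c + \<epsilon>) *\<^sub>R b"
    unfolding 1 2 c_def[symmetric] using c0 by simp_all
  have N3_mult: "N3 P \<alpha> \<beta> \<epsilon> *v vjoin x ((1 / c) *\<^sub>R (transpose R *v y)) =
      vjoin (P *v x + P *v y) (- ((c + \<epsilon>) *\<^sub>R x) - (1 / c) *\<^sub>R y)" for x y
  proof -
    have "(P ** transpose P) *v (transpose R *v y) = P *v y"
      by (simp only: PR' flip: matrix_vector_mul_assoc)
    then show ?thesis
      unfolding N3_def c_def[symmetric] block_mult_vec
      using c0 by (simp add: scaleR_mult_vec uminus_mult_vec mat_mult_vec matrix_vector_mult_scaleR PR'
          vjoin_eq_iff del: transpose_matrix_vector)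
  qed
  \<comment> \<open>Lower halves of the eigenvector. The block c P P^T sends them to P e and P f,
    which complete P a and P b to the left-hand sides of \<open>Pe\<close>.\<close>
  let ?p = "(1 / c) *\<^sub>R (transpose R *v e)" and ?r = "(1 / c) *\<^sub>R (transpose R *v f)"
  have "eigenvalue (N3 P \<alpha> \<beta> \<epsilon>) (Complex 0 (- w))"
  proof (rule eigenvalueI)
    have "- ((c + \<epsilon>) *\<^sub>R a) - (1 / c) *\<^sub>R e = w *\<^sub>R ?r" "- ((c + \<epsilon>) *\<^sub>R b) - (1 / c) *\<^sub>R f = - (w *\<^sub>R ?p)"
      unfolding q1[symmetric] q2[symmetric] by (simp_all add: algebra_simps del: transpose_matrix_vector)
    then show "N3 P \<alpha> \<beta> \<epsilon> *v vjoin a ?p = Re (Complex 0 (- w)) *\<^sub>R vjoin a ?p - Im (Complex 0 (- w)) *\<^sub>R vjoin b ?r"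
      "N3 P \<alpha> \<beta> \<epsilon> *v vjoin b ?r = Im (Complex 0 (- w)) *\<^sub>R vjoin a ?p + Re (Complex 0 (- w)) *\<^sub>R vjoin b ?r"
      unfolding N3_mult Pe by (simp_all add: vjoin_scaleR vjoin_uminus vjoin_eq_iff flip: zero_vjoin del: transpose_matrix_vector)
    show "vjoin a ?p \<noteq> 0 \<or> vjoin b ?r \<noteq> 0"
      using s(1) by (auto simp: ab zero_vjoin vjoin_eq_iff zero_prod_def)
  qed
  then show False using N3 by fastforce
qed


section \<open>Lyapunov inequalities and Hurwitz matrices\<close>

lemma perturbed_contraction_tendsto_0:
  fixes a b :: "nat \<Rightarrow> real"
  assumes z: "0 \<le> z" "z < 1" and a: "\<And>n. 0 \<le> a n" and rec: "\<And>n. a (Suc n) \<le> z * a n + b n"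
    and b: "b \<longlonglongrightarrow> 0"
  shows "a \<longlonglongrightarrow> 0"
proof (rule LIMSEQ_I)
  fix e :: real
  assume e: "0 < e"
  \<comment> \<open>With this d, the number e / 2 is the fixed point of s \<mapsto> z s + d.\<close>
  let ?d = "e * (1 - z) / 2"
  have "0 < ?d" using e z by simp
  then obtain N where N: "\<And>n. N \<le> n \<Longrightarrow> \<bar>b n\<bar> < ?d"
    using LIMSEQ_D[OF b, of ?d] by auto
  have bound: "a (N + k) \<le> z ^ k * a N + e / 2" for k
  proof (induction k)
    case 0
    then show ?case using e by simp
  next
    case (Suc k)
    have "a (N + Suc k) \<le> z * a (N + k) + ?d"
      using rec[of "N + k"] N[of "N + k"] by simp
    also have "\<dots> \<le> z * (z ^ k * a N + e / 2) + ?d"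
      using Suc z by (intro add_right_mono mult_left_mono) auto
    also have "\<dots> = z ^ Suc k * a N + e / 2" by (simp add: field_simps)
    finally show ?case .
  qed
  have "(\<lambda>k. z ^ k * a N) \<longlonglongrightarrow> 0 * a N"
    using z by (intro tendsto_mult LIMSEQ_power_zero tendsto_const) simp
  then obtain K where K: "\<And>k. K \<le> k \<Longrightarrow> z ^ k * a N < e / 2"
    using LIMSEQ_D[of "\<lambda>k. z ^ k * a N" 0 "e / 2"] e by fastforce
  show "\<exists>no. \<forall>n\<ge>no. norm (a n - 0) < e"
  proof (intro exI allI impI)
    fix n
    assume "N + K \<le> n"
    then have "K \<le> n - N" "N + (n - N) = n" by auto
    then have "a n < e"
      using bound[of "n - N"] K[of "n - N"] by simp
    then show "norm (a n - 0) < e" using a[of n] by simp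
  qed
qed

text \<open>\<open>ev p v\<close> stands for \<open>p(A) v\<close>; the roots of \<open>p\<close> are split off one at a time.\<close>

lemma iterates_tendsto_0_of_annihilator:
  fixes A :: "complex^'k^'k"
  assumes spec: "\<And>\<mu> w. A *v w = \<mu> *s w \<Longrightarrow> w \<noteq> 0 \<Longrightarrow> cmod \<mu> < 1"
    and ev0: "\<And>v. ev 0 v = 0"
    and evC: "\<And>a p v. ev (pCons a p) v = a *s v + ev p (A *v v)"
  shows "p \<noteq> 0 \<Longrightarrow> ev p v = 0 \<Longrightarrow> (\<lambda>n. ((*v) A ^^ n) v) \<longlonglongrightarrow> 0"
proof (induction "degree p" arbitrary: p v)
  case 0
  then obtain a where "p = [:a:]" "a \<noteq> 0" by (metis degree_eq_zeroE pCons_0_0)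
  then have "v = 0" using 0 by (simp add: evC ev0)
  moreover have "((*v) A ^^ n) 0 = 0" for n by (induction n) auto
  ultimately show ?case by simp
next
  case (Suc d)
  have ev_diff: "ev p (u - v) = ev p u - ev p v" for p u v
    by (induction p arbitrary: u v)
      (simp_all add: ev0 evC matrix_vector_mult_diff_distrib vector_sub_rdistrib vector_ssub_ldistrib algebra_simps)
  have ev_scale: "ev p (z *s v) = z *s ev p v" for p v z
    by (induction p arbitrary: v)
      (simp_all add: ev0 evC vector_add_ldistrib vector_scalar_commute vector_smult_assoc mult.commute)
  have ev_smult: "ev (smult z p) v = z *s ev p v" for p v z
    by (induction p arbitrary: v)
      (simp_all add: ev0 evC vector_add_ldistrib vector_smult_assoc)
  have ev_add: "ev (p + q) v = ev p v + ev q v" for p q v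
    by (induction p q arbitrary: v rule: poly_induct2)
      (simp_all add: ev0 evC vector_sadd_rdistrib)
  have it_lin: "((*v) A ^^ n) (u - z *s v) = ((*v) A ^^ n) u - z *s ((*v) A ^^ n) v" for n u v z
    by (induction n) (simp_all add: matrix_vector_mult_diff_distrib vector_scalar_commute)
  have "\<not> constant (poly p)" using Suc.hyps(2) by (simp add: constant_degree)
  then obtain z where "poly p z = 0" using fundamental_theorem_of_algebra by blast
  then obtain q where q: "p = [:- z, 1:] * q" by (metis dvdE poly_eq_0_iff_dvd)
  have q0: "q \<noteq> 0" using q Suc.prems(1) by auto
  have "degree p = Suc (degree q)"
    unfolding q using q0 by (subst degree_mult_eq) auto
  then have dq: "d = degree q" using Suc.hyps(2) by simp
  let ?w = "A *v v - z *s v"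
  have "ev q ?w = 0"
  proof -
    have "p = pCons 0 q + smult (- z) q" unfolding q by simp
    then show ?thesis
      using Suc.prems(2) unfolding ev_diff ev_scale by (simp only: ev_add ev_smult evC) simp
  qed
  then have w: "(\<lambda>n. ((*v) A ^^ n) ?w) \<longlonglongrightarrow> 0"
    by (rule Suc.hyps(1)[OF dq q0])
  have rec: "((*v) A ^^ Suc n) v = z *s ((*v) A ^^ n) v + ((*v) A ^^ n) ?w" for n
    unfolding it_lin by (simp add: funpow_swap1)
  \<comment> \<open>A root z of the annihilating polynomial need not be an eigenvalue. If it is one,
    |z| < 1 and \<open>rec\<close> is a contraction with vanishing perturbation. If not, A - z is
    invertible, and the iterates of v are recovered linearly from those of (A - z) v.\<close>
  show ?case
  proof (cases "\<exists>w. w \<noteq> 0 \<and> A *v w = z *s w")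
    case True
    then have z: "cmod z < 1" using spec by blast
    have nscale: "norm (z *s x) = cmod z * norm x" for x :: "complex^'k"
      by (simp add: norm_vec_def L2_set_def norm_mult power_mult_distrib real_sqrt_mult flip: sum_distrib_left)
    have "(\<lambda>n. norm (((*v) A ^^ n) v)) \<longlonglongrightarrow> 0"
    proof (rule perturbed_contraction_tendsto_0)
      show "norm (((*v) A ^^ Suc n) v) \<le> cmod z * norm (((*v) A ^^ n) v) + norm (((*v) A ^^ n) ?w)" for n
        unfolding rec by (metis norm_triangle_ineq nscale)
      show "(\<lambda>n. norm (((*v) A ^^ n) ?w)) \<longlonglongrightarrow> 0" using w by (rule tendsto_norm_zero)
    qed (use z in auto)
    then show ?thesis by (rule tendsto_norm_zero_cancel)
  next
    case False
    let ?B = "A - mat z"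
    have Bv: "?B *v x = A *v x - z *s x" for x
      by (simp add: matrix_vector_mult_diff_rdistrib mat_mult_vec_scalar)
    have "?B *v x = 0 \<Longrightarrow> x = 0" for x using False by (auto simp: Bv)
    then obtain C where C: "C ** ?B = mat 1"
      using matrix_left_invertible_ker by blast
    have "((*v) A ^^ n) v = C *v (((*v) A ^^ n) ?w)" for n
    proof -
      have "((*v) A ^^ n) ?w = ?B *v (((*v) A ^^ n) v)"
        unfolding it_lin Bv by (simp add: funpow_swap1)
      then show ?thesis by (simp add: matrix_vector_mul_assoc C)
    qed
    moreover have "(\<lambda>n. C *v (((*v) A ^^ n) ?w)) \<longlonglongrightarrow> C *v 0"
      unfolding matrix_vector_mult_def
      by (intro tendsto_vec_lambda tendsto_sum tendsto_mult tendsto_const tendsto_vec_nth w[unfolded matrix_vector_mult_def])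
    ultimately show ?thesis by simp
  qed
qed

text \<open>In dimension N the N + 1 vectors v, A v, ..., A^N v satisfy a linear relation, which is
  a nonzero polynomial annihilating this one v. That is all the preceding lemma asks for, so no
  characteristic polynomial or Jordan form enters.\<close>

lemma iterates_tendsto_0:
  fixes A :: "complex^'k^'k"
  assumes spec: "\<And>\<mu> w. A *v w = \<mu> *s w \<Longrightarrow> w \<noteq> 0 \<Longrightarrow> cmod \<mu> < 1"
  shows "(\<lambda>n. ((*v) A ^^ n) v) \<longlonglongrightarrow> 0"
proof -
  define ev where "ev p = fold_coeffs (\<lambda>a f v. a *s v + f (A *v v)) p (\<lambda>_. 0 :: complex^'k)" for p
  have ev0: "ev 0 v = 0" for v by (simp add: ev_def)
  have evC: "ev (pCons a p) v = a *s v + ev p (A *v v)" for a p v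
    by (cases "a = 0 \<and> p = 0") (auto simp: ev_def)
  have ev_add: "ev (p + q) v = ev p v + ev q v" for p q v
    by (induction p q arbitrary: v rule: poly_induct2)
      (simp_all add: ev0 evC vector_sadd_rdistrib)
  have ev_sum: "ev (sum f I) v = (\<Sum>i\<in>I. ev (f i) v)" for f :: "nat \<Rightarrow> _" and I v
    by (induction I rule: infinite_finite_induct) (simp_all add: ev0 ev_add)
  have ev_monom: "ev (monom c i) v = c *s (((*v) A ^^ i) v)" for c i v
    by (induction i arbitrary: v) (simp_all add: ev0 evC monom_0 monom_Suc funpow_swap1)
  define N where "N = CARD('k)"
  define w where "w i = ((*v) A ^^ i) v" for i
  have "\<exists>c. (\<exists>i\<le>N. c i \<noteq> 0) \<and> (\<Sum>i\<le>N. c i *s w i) = 0"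
  \<comment> \<open>Linear dependence is a property of sets. A repeated iterate is therefore a case
    of its own, with coefficients 1 and -1.\<close>
  proof (cases "inj_on w {..N}")
    case True
    have "vec.dim (w ` {..N}) < card (w ` {..N})"
      using dim_subset_UNIV_cart_gen[of "w ` {..N}"] unfolding card_image[OF True] by (simp add: N_def)
    then have "vec.dependent (w ` {..N})" by (intro vec.dependent_biggerset_general) auto
    then obtain u where u: "\<exists>x\<in>w ` {..N}. u x \<noteq> 0" "(\<Sum>x\<in>w ` {..N}. u x *s x) = 0"
      using vec.dependent_finite[of "w ` {..N}"] by auto
    then show ?thesis
      by (intro exI[of _ "\<lambda>i. u (w i)"]) (auto simp: sum.reindex[OF True])
  next
    case False
    then obtain i j where ij: "i \<le> N" "j \<le> N" "i \<noteq> j" "w i = w j" by (auto simp: inj_on_def)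
    have "(\<Sum>k\<le>N. (if k = i then 1 else if k = j then -1 else 0) *s w k) =
        (\<Sum>k\<le>N. (if k = i then w i else 0) - (if k = j then w j else 0))"
      by (rule sum.cong) (use ij in auto)
    also have "\<dots> = 0" using ij by (simp add: sum_subtractf)
    finally show ?thesis using ij by (intro exI[of _ "\<lambda>k. if k = i then 1 else if k = j then -1 else 0"]) auto
  qed
  then obtain c where c: "\<exists>i\<le>N. c i \<noteq> 0" "(\<Sum>i\<le>N. c i *s w i) = 0" by blast
  let ?p = "\<Sum>i\<le>N. monom (c i) i"
  show ?thesis
  proof (rule iterates_tendsto_0_of_annihilator[OF spec ev0 evC])
    show "ev ?p v = 0" using c(2) by (simp add: ev_sum ev_monom w_def)
    have "coeff ?p i = c i" if "i \<le> N" for i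
      using that by (simp add: coeff_sum coeff_monom)
    then show "?p \<noteq> 0" using c(1) by (metis coeff_0)
  qed
qed

lemma cvec_tendsto_0:
  assumes "(\<lambda>n. cvec (f n) 0) \<longlonglongrightarrow> 0"
  shows "f \<longlonglongrightarrow> 0"
proof (rule vec_tendstoI)
  fix i
  have "(\<lambda>n. Re (cvec (f n) 0 $ i)) \<longlonglongrightarrow> Re ((0 :: complex^'a) $ i)"
    by (intro tendsto_Re tendsto_vec_nth assms)
  then show "(\<lambda>n. f n $ i) \<longlonglongrightarrow> 0 $ i" by (simp add: cvec_def)
qed

lemma map_matrix_of_real_mult:
  "map_matrix complex_of_real (A ** B) = map_matrix complex_of_real A ** map_matrix complex_of_real B"
  by (simp add: map_matrix_def matrix_matrix_mult_def vec_eq_iff)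

text \<open>The form of X decreases strictly along the iterates of T = (1 - P)^-1 (1 + P), and these
  tend to 0. Its value at x thus exceeds the value at T x, which is at least the limit 0.\<close>

lemma lyapunov_hurwitz_pos:
  fixes P X :: "real^'k^'k"
  assumes P: "hurwitz P" and X: "transpose X = X"
    and neg: "\<And>x. x \<noteq> 0 \<Longrightarrow> (P *v x) \<bullet> (X *v x) < 0" and x: "x \<noteq> 0"
  shows "0 < x \<bullet> (X *v x)"
proof -
  let ?M = "mat 1 - P"
  have "?M *v x = 0 \<Longrightarrow> x = 0" for x
    using P eigenvalueI[of P x 1 0] by (fastforce simp: hurwitz_def matrix_vector_mult_diff_rdistrib)
  then have inv: "invertible ?M"
    unfolding invertible_left_inverse matrix_left_invertible_ker by blast
  \<comment> \<open>the Cayley transform maps the open left half plane to the open unit disc\<close>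
  define T where "T = matrix_inv ?M ** (mat 1 + P)"
  have MT: "?M ** T = mat 1 + P"
    using inv by (simp add: T_def matrix_mul_assoc matrix_inv_right)
  let ?C = "map_matrix complex_of_real"
  have C_diff: "?C (mat 1 - P) *v v = v - ?C P *v v" and C_add: "?C (mat 1 + P) *v v = v + ?C P *v v" for v
  proof -
    have "?C (mat 1 - P) = mat 1 - ?C P" "?C (mat 1 + P) = mat 1 + ?C P"
      by (simp_all add: map_matrix_def mat_def vec_eq_iff)
    then show "?C (mat 1 - P) *v v = v - ?C P *v v" "?C (mat 1 + P) *v v = v + ?C P *v v"
      by (simp_all add: matrix_vector_mult_diff_rdistrib matrix_vector_mult_add_rdistrib)
  qed
  have "cmod \<mu> < 1" if w: "?C T *v w = \<mu> *s w" "w \<noteq> 0" for \<mu> w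
  proof -
    have "?C (mat 1 - P) *v (?C T *v w) = ?C (mat 1 + P) *v w"
      by (simp add: matrix_vector_mul_assoc MT flip: map_matrix_of_real_mult)
    then have e: "\<mu> *s w - \<mu> *s (?C P *v w) = w + ?C P *v w"
      unfolding w(1) C_diff C_add by (simp add: vector_scalar_commute)
    then have e': "(1 + \<mu>) *s (?C P *v w) = (\<mu> - 1) *s w"
      by (simp add: vector_sadd_rdistrib vector_sub_rdistrib algebra_simps)
    have "1 + \<mu> \<noteq> 0"
    proof
      assume *: "1 + \<mu> = 0"
      then have "\<mu> - 1 \<noteq> 0" by (auto simp: add_eq_0_iff)
      moreover have "(\<mu> - 1) *s w = 0" unfolding e'[symmetric] * by (rule vector_smult_lzero)
      ultimately show False using w(2) by (metis vec.scale_eq_0_iff)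
    qed
    \<comment> \<open>The preimage of \<mu> under z \<mapsto> (1 + z) / (1 - z). It is an eigenvalue
      of P with the same eigenvector w.\<close>
    define l where "l = (\<mu> - 1) / (1 + \<mu>)"
    have "?C P *v w = (1 / (1 + \<mu>)) *s ((1 + \<mu>) *s (?C P *v w))"
    proof -
      have "1 / (1 + \<mu>) * (1 + \<mu>) = 1" using \<open>1 + \<mu> \<noteq> 0\<close> by simp
      then show ?thesis by (simp only: vector_smult_assoc vector_smult_lid)
    qed
    also have "\<dots> = l *s w" unfolding e' by (simp only: vector_smult_assoc l_def times_divide_eq_left mult_1)
    finally have "eigenvalue P l" using w(2) by (auto simp: eigenvalue_def)
    then have "Re l < 0" using P by (auto simp: hurwitz_def)
    \<comment> \<open>A negative real part means that l is nearer to -1 than to 1.\<close>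
    then have "(cmod (1 + l))\<^sup>2 < (cmod (1 - l))\<^sup>2"
      unfolding cmod_power2 by (simp add: power2_eq_square algebra_simps)
    then have lt: "cmod (1 + l) < cmod (1 - l)" by (rule power_less_imp_less_base) simp
    have "\<mu> * (1 - l) = 1 + l"
      using \<open>1 + \<mu> \<noteq> 0\<close> by (simp add: l_def field_simps)
    then have "cmod \<mu> * cmod (1 - l) = cmod (1 + l)" by (metis norm_mult)
    then show ?thesis using lt by (smt (verit) mult_le_cancel_right1 norm_ge_zero)
  qed
  then have lim: "(\<lambda>n. ((*v) (?C T) ^^ n) v) \<longlonglongrightarrow> 0" for v
    by (rule iterates_tendsto_0)
  have "((*v) (?C T) ^^ n) (cvec x 0) = cvec (((*v) T ^^ n) x) 0" for n
    by (induction n) (simp_all add: map_matrix_of_real_mult_cvec)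
  then have Tlim: "(\<lambda>n. ((*v) T ^^ n) x) \<longlonglongrightarrow> 0"
    using lim[of "cvec x 0"] by (intro cvec_tendsto_0) simp
  define V where "V y = y \<bullet> (X *v y)" for y
  have sym: "a \<bullet> (X *v b) = b \<bullet> (X *v a)" for a b
    by (metis X dot_lmul_matrix inner_commute transpose_matrix_vector)
  have dec: "V (T *v y) < V y" if "y \<noteq> 0" for y
  proof -
    \<comment> \<open>The relation (1 - P) T = 1 + P reads T y - y = P z for z = T y + y, and by
      symmetry of X the increment of V from y to T y is (P z) . X z.\<close>
    let ?z = "T *v y + y"
    have "?M *v (T *v y) = (mat 1 + P) *v y" by (simp add: matrix_vector_mul_assoc MT)
    then have Pz: "T *v y - y = P *v ?z"
      by (simp add: matrix_vector_mult_diff_rdistrib matrix_vector_mult_add_rdistrib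
          matrix_vector_right_distrib algebra_simps)
    have "?z \<noteq> 0"
    proof
      assume z: "?z = 0"
      then have "T *v y = y" using Pz by simp
      then have "2 *\<^sub>R y = 0" using z by (simp add: scaleR_2)
      then show False using that by simp
    qed
    then have "(P *v ?z) \<bullet> (X *v ?z) < 0" by (rule neg)
    moreover have "(T *v y - y) \<bullet> (X *v ?z) = V (T *v y) - V y"
      using sym[of "T *v y" y] by (simp add: V_def matrix_vector_right_distrib inner_simps)
    ultimately show ?thesis using Pz by simp
  qed
  have "V 0 = 0" by (simp add: V_def)
  then have "V (T *v y) \<le> V y" for y using dec[of y] by (cases "y = 0") auto
  then have "decseq (\<lambda>n. V (((*v) T ^^ n) (T *v x)))"
    by (intro decseq_SucI) simp
  moreover have "(\<lambda>n. V (((*v) T ^^ n) (T *v x))) \<longlonglongrightarrow> V 0"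
  proof -
    have "(\<lambda>n. ((*v) T ^^ n) (T *v x)) \<longlonglongrightarrow> 0"
      using LIMSEQ_Suc[OF Tlim] by (simp add: funpow_swap1)
    moreover have "isCont V 0"
      unfolding V_def by (intro continuous_intros linear_continuous_at linear_conv_bounded_linear[THEN iffD1] matrix_vector_mul_linear)
    ultimately show ?thesis by (rule isCont_tendsto_compose[rotated])
  qed
  ultimately have "V 0 \<le> V (((*v) T ^^ 0) (T *v x))" by (rule decseq_ge)
  then show ?thesis using dec[OF x] \<open>V 0 = 0\<close> by (simp add: V_def)
qed


section \<open>The contraction metric\<close>

lemma symmetric_inner_commute:
  fixes X :: "real^'k^'k"
  assumes "transpose X = X"
  shows "a \<bullet> (X *v b) = b \<bullet> (X *v a)"
  by (metis assms inner_transpose_mult_vec)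

text \<open>Testing the form at x - D x / c yields the norm bound without diagonalising D.\<close>

lemma norm_le_of_form_bounds:
  fixes D :: "real^'k^'k"
  assumes sym: "transpose D = D" and c: "0 < c"
    and D: "\<And>x. 0 \<le> x \<bullet> (D *v x)" "\<And>x. x \<bullet> (D *v x) \<le> c * (x \<bullet> x)"
  shows "(D *v x) \<bullet> (D *v x) \<le> c\<^sup>2 * (x \<bullet> x)"
proof -
  let ?v = "D *v x"
  have "0 \<le> (x - (1/c) *\<^sub>R ?v) \<bullet> (D *v (x - (1/c) *\<^sub>R ?v))" by (rule D(1))
  also have "\<dots> = x \<bullet> ?v - (2/c) * (?v \<bullet> ?v) + (1/c)\<^sup>2 * (?v \<bullet> (D *v ?v))"
    using symmetric_inner_commute[OF sym, of x ?v]
    by (simp add: matrix_vector_mult_diff_distrib matrix_vector_mult_scaleR inner_diff_left inner_diff_right power2_eq_square)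
      (simp add: diff_divide_distrib)
  also have "\<dots> \<le> c * (x \<bullet> x) - (2/c) * (?v \<bullet> ?v) + (1/c)\<^sup>2 * (c * (?v \<bullet> ?v))"
    using D(2)[of x] D(2)[of ?v] c by (intro add_mono diff_mono mult_left_mono) auto
  also have "\<dots> = (c\<^sup>2 * (x \<bullet> x) - ?v \<bullet> ?v) / c"
    using c by (simp add: power2_eq_square field_simps)
  finally show ?thesis using c by (simp add: zero_le_divide_iff)
qed

text \<open>The form of 1 - H / \<beta> lies between 0 and 1 - \<alpha> / \<beta>. This is where the
  constant 1 - \<alpha> / \<beta> of \<open>N3\<close> originates.\<close>

lemma hessian_deviation:
  fixes H :: "real^'k^'k"
  assumes ab: "0 < \<alpha>" "\<alpha> < \<beta>" and H: "mat \<alpha> \<prec> H" "H \<prec> mat \<beta>"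
  shows "((1 / \<beta>) *\<^sub>R (H *v x) - x) \<bullet> ((1 / \<beta>) *\<^sub>R (H *v x) - x) \<le> (1 - \<alpha> / \<beta>)\<^sup>2 * (x \<bullet> x)"
proof -
  have tr: "transpose (mat \<beta> - H) = mat \<beta> - H" using H(2) by (simp add: loewner_less_def pos_def_def)
  have lo: "\<alpha> * (x \<bullet> x) \<le> x \<bullet> (H *v x)" and hi: "x \<bullet> (H *v x) \<le> \<beta> * (x \<bullet> x)" for x
  proof -
    have "0 \<le> x \<bullet> ((H - mat \<alpha>) *v x)" "0 \<le> x \<bullet> ((mat \<beta> - H) *v x)"
      using H by (cases "x = 0"; simp add: loewner_less_def pos_def_def less_imp_le)+
    then show "\<alpha> * (x \<bullet> x) \<le> x \<bullet> (H *v x)" "x \<bullet> (H *v x) \<le> \<beta> * (x \<bullet> x)"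
      by (simp_all add: matrix_vector_mult_diff_rdistrib mat_mult_vec inner_diff_right)
  qed
  let ?D = "(1 / \<beta>) *\<^sub>R (mat \<beta> - H)"
  have Dx: "?D *v x = x - (1 / \<beta>) *\<^sub>R (H *v x)" for x
    using ab by (simp add: scaleR_mult_vec matrix_vector_mult_diff_rdistrib mat_mult_vec algebra_simps)
  have "(?D *v x) \<bullet> (?D *v x) \<le> (1 - \<alpha> / \<beta>)\<^sup>2 * (x \<bullet> x)"
  proof (rule norm_le_of_form_bounds)
    show "transpose ?D = ?D" using tr by (simp add: transpose_def vec_eq_iff)
    show "0 < 1 - \<alpha> / \<beta>" using ab by simp
    show "0 \<le> x \<bullet> (?D *v x)" "x \<bullet> (?D *v x) \<le> (1 - \<alpha> / \<beta>) * (x \<bullet> x)" for x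
      unfolding Dx using hi[of x] lo[of x] ab by (simp_all add: inner_diff_right field_simps)
  qed
  then show ?thesis unfolding Dx by (simp add: inner_diff_left inner_diff_right inner_commute)
qed

text \<open>The form \<open>B\<close> is an S-procedure for the constraint |y - x|^2 \<le> c^2
  |x|^2: with the multiplier 1 / c the constraint contributes at most c |x|^2, which the weight c +
  \<epsilon> exceeds by \<epsilon> |x|^2.\<close>

lemma contraction_certificate:
  fixes P :: "real^'k^'k"
  assumes P: "hurwitz P" and ab: "0 < \<alpha>" "\<alpha> < \<beta>" and \<epsilon>: "0 < \<epsilon>"
    and N3: "\<And>\<mu>. eigenvalue (N3 P \<alpha> \<beta> \<epsilon>) \<mu> \<Longrightarrow> Re \<mu> \<noteq> 0"
  obtains X :: "real^'k^'k" and \<delta> where "transpose X = X" "\<And>x. x \<noteq> 0 \<Longrightarrow> 0 < x \<bullet> (X *v x)" "0 < \<delta>"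
    "\<And>H x. mat \<alpha> \<prec> H \<Longrightarrow> H \<prec> mat \<beta> \<Longrightarrow> x \<bullet> (X *v (P *v (H *v x))) \<le> - \<delta> * (x \<bullet> x)"
proof -
  define c where "c = 1 - \<alpha> / \<beta>"
  have c: "0 < c" using ab by (simp add: c_def)
  have inv: "invertible P" by (rule hurwitz_invertible[OF P])
  define B :: "(real^'k) \<times> (real^'k) \<Rightarrow> (real^'k) \<times> (real^'k) \<Rightarrow> real" where
    "B s t = (c + \<epsilon>) * (fst s \<bullet> fst t) - (1 / c) * ((snd s - fst s) \<bullet> (snd t - fst t))" for s t
  have bil: "bilinear B"
    unfolding bilinear_def B_def by (auto intro!: linearI simp: inner_simps algebra_simps add_divide_distrib)
  have inf: "B (0, y) (0, y) < 0" if "y \<noteq> 0" for y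
    using c that by (simp add: B_def)
  have freq: "B (x1, y1) (x1, y1) + B (x2, y2) (x2, y2) < 0"
    if "P *v y1 = \<omega> *\<^sub>R x2" "P *v y2 = - (\<omega> *\<^sub>R x1)" "x1 \<noteq> 0 \<or> x2 \<noteq> 0" for \<omega> x1 x2 y1 y2
  proof -
    have "c * (c + \<epsilon>) * (x1 \<bullet> x1 + x2 \<bullet> x2) < (y1 - x1) \<bullet> (y1 - x1) + (y2 - x2) \<bullet> (y2 - x2)"
      using N3_frequency_condition[OF inv _ N3 that] c unfolding c_def by blast
    then have "(c + \<epsilon>) * (x1 \<bullet> x1 + x2 \<bullet> x2) < (1 / c) * ((y1 - x1) \<bullet> (y1 - x1) + (y2 - x2) \<bullet> (y2 - x2))"
      using c by (simp add: pos_less_divide_eq mult_ac)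
    then show ?thesis by (simp add: B_def algebra_simps)
  qed
  have inj: "inj ((*v) P)"
    using inv by (metis inj_matrix_vector_mult)
  have "\<exists>X :: real^'k^'k. transpose X = X \<and> (\<forall>x y. (P *v y) \<bullet> (X *v x) + B (x, y) (x, y) \<le> 0)"
    by (rule kyp_separation[OF matrix_vector_mul_linear inj bil inf freq])
  then obtain X :: "real^'k^'k" where X: "transpose X = X"
    and XB: "\<And>x y. (P *v y) \<bullet> (X *v x) + B (x, y) (x, y) \<le> 0"
    by blast
  have kyp: "(P *v y) \<bullet> (X *v x) + (c + \<epsilon>) * (x \<bullet> x) - (1 / c) * ((y - x) \<bullet> (y - x)) \<le> 0" for x y
    using XB[of y x] by (simp add: B_def)
  \<comment> \<open>The choice y = x, corresponding to H = \<beta> times the identity, leaves the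
    Lyapunov inequality of P itself.\<close>
  have neg: "(P *v x) \<bullet> (X *v x) < 0" if "x \<noteq> 0" for x
  proof -
    have "0 < (c + \<epsilon>) * (x \<bullet> x)" using that c \<epsilon> by simp
    then show ?thesis using kyp[of x x] by simp
  qed
  show ?thesis
  proof
    show "transpose X = X" by (rule X)
    show "0 < x \<bullet> (X *v x)" if "x \<noteq> 0" for x
      by (rule lyapunov_hurwitz_pos[OF P X neg that])
    \<comment> \<open>The factor \<beta> undoes the scaling of the Hessian.\<close>
    show "0 < \<beta> * \<epsilon>" using ab \<epsilon> by simp
    show "x \<bullet> (X *v (P *v (H *v x))) \<le> - (\<beta> * \<epsilon>) * (x \<bullet> x)" if H: "mat \<alpha> \<prec> H" "H \<prec> mat \<beta>" for H x
    proof -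
      let ?y = "(1 / \<beta>) *\<^sub>R (H *v x)"
      have "(1 / c) * ((?y - x) \<bullet> (?y - x)) \<le> (1 / c) * (c\<^sup>2 * (x \<bullet> x))"
        using hessian_deviation[OF ab H, of x] c unfolding c_def[symmetric] by (intro mult_left_mono) auto
      also have "\<dots> = c * (x \<bullet> x)" using c by (simp add: power2_eq_square)
      finally have "(P *v ?y) \<bullet> (X *v x) \<le> - \<epsilon> * (x \<bullet> x)"
        using kyp[of ?y x] by (simp add: algebra_simps)
      then have "\<beta> * ((P *v ?y) \<bullet> (X *v x)) \<le> \<beta> * (- \<epsilon> * (x \<bullet> x))"
        using ab by (intro mult_left_mono) auto
      moreover have "\<beta> * ((P *v ?y) \<bullet> (X *v x)) = x \<bullet> (X *v (P *v (H *v x)))"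
        using ab by (simp add: matrix_vector_mult_scaleR symmetric_inner_commute[OF X, of x])
      ultimately show ?thesis by simp
    qed
  qed
qed

section \<open>The norm of a constant metric and its Riemannian distance\<close>

lemma form_cauchy_schwarz:
  fixes X :: "real^'k^'k"
  assumes X: "transpose X = X" and pos: "\<And>x. 0 \<le> x \<bullet> (X *v x)"
  shows "u \<bullet> (X *v v) \<le> sqrt (u \<bullet> (X *v u)) * sqrt (v \<bullet> (X *v v))"
proof -
  define a b c where "a = u \<bullet> (X *v u)" and "b = u \<bullet> (X *v v)" and "c = v \<bullet> (X *v v)"
  have q: "0 \<le> a + 2 * b * t + c * t\<^sup>2" for t
    using pos[of "u + t *\<^sub>R v"] symmetric_inner_commute[OF X, of v u]
    by (simp add: a_def b_def c_def matrix_vector_right_distrib matrix_vector_mult_scaleR inner_simps power2_eq_square algebra_simps)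
  have ac: "0 \<le> a" "0 \<le> c" using pos by (simp_all add: a_def c_def)
  have "b\<^sup>2 \<le> a * c"
  proof (cases "c = 0")
    case True
    have "b = 0"
    proof (rule ccontr)
      assume b: "b \<noteq> 0"
      \<comment> \<open>For c = 0 the quadratic is affine in t, and this t is where it takes the
        value -1.\<close>
      have "a + 2 * b * (- (a + 1) / (2 * b)) + c * (- (a + 1) / (2 * b))\<^sup>2 = - 1" using b True by simp
      then show False using q[of "- (a + 1) / (2 * b)"] by simp
    qed
    then show ?thesis using True by simp
  next
    case False
    have "0 \<le> c * (a + 2 * b * (- b / c) + c * (- b / c)\<^sup>2)" by (rule mult_nonneg_nonneg[OF ac(2) q])
    also have "\<dots> = a * c - b\<^sup>2" using False by (simp add: power2_eq_square field_simps)
    finally show ?thesis by simp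
  qed
  then have "b \<le> sqrt (a * c)" by (rule real_le_rsqrt)
  then show ?thesis by (simp add: real_sqrt_mult a_def b_def c_def)
qed

lemma form_bounds:
  fixes X :: "real^'k^'k"
  assumes pos: "\<And>x. x \<noteq> 0 \<Longrightarrow> 0 < x \<bullet> (X *v x)"
  obtains c1 c2 where "0 < c1" "0 < c2" "\<And>x. c1 * (x \<bullet> x) \<le> x \<bullet> (X *v x)" "\<And>x. x \<bullet> (X *v x) \<le> c2 * (x \<bullet> x)"
proof -
  let ?q = "\<lambda>x. x \<bullet> (X *v x)"
  have cont: "continuous_on (sphere 0 1) ?q"
    by (intro continuous_intros linear_continuous_on linear_conv_bounded_linear[THEN iffD1] matrix_vector_mul_linear)
  obtain x0 :: "real^'k" where "norm x0 = 1" using vector_choose_size[of 1] by (metis zero_le_one)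
  then have ne: "sphere (0 :: real^'k) 1 \<noteq> {}" by force
  obtain a where a: "a \<in> sphere 0 1" "\<And>x. x \<in> sphere 0 1 \<Longrightarrow> ?q a \<le> ?q x"
    using continuous_attains_inf[OF compact_sphere ne cont] by blast
  obtain b where b: "b \<in> sphere 0 1" "\<And>x. x \<in> sphere 0 1 \<Longrightarrow> ?q x \<le> ?q b"
    using continuous_attains_sup[OF compact_sphere ne cont] by blast
  have scale: "?q x = (x \<bullet> x) * ?q ((1 / norm x) *\<^sub>R x)" if "x \<noteq> 0" for x
    using that by (simp add: matrix_vector_mult_scaleR power2_norm_eq_inner[symmetric] power2_eq_square)
  have sph: "(1 / norm x) *\<^sub>R x \<in> sphere 0 1" if "x \<noteq> 0" for x :: "real^'k"
    using that by simp
  show ?thesis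
  proof
    show "0 < ?q a" "0 < ?q b" using a(1) b(1) by (auto intro!: pos)
    show "?q a * (x \<bullet> x) \<le> ?q x" for x
    proof (cases "x = 0")
      case False
      then show ?thesis using a(2)[OF sph[OF False]] unfolding scale[OF False]
        by (subst mult.commute) (intro mult_left_mono, auto)
    qed simp
    show "?q x \<le> ?q b * (x \<bullet> x)" for x
    proof (cases "x = 0")
      case False
      then show ?thesis using b(2)[OF sph[OF False]] unfolding scale[OF False]
        by (subst (2) mult.commute) (intro mult_left_mono, auto)
    qed simp
  qed
qed

text \<open>The segment attains the infimum. Along any other path, integrating the velocity against
  the fixed vector X (y - x) gives exactly the squared X-norm of y - x, and Cauchy-Schwarz bounds
  the integrand by the speed times that norm.\<close>

lemma metric_dist_const:
  fixes X :: "real^'k^'k"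
  assumes X: "transpose X = X" and pos: "\<And>x. x \<noteq> 0 \<Longrightarrow> 0 < x \<bullet> (X *v x)"
  shows "metric_dist (\<lambda>_ _. X) t x y = sqrt ((y - x) \<bullet> (X *v (y - x)))"
  unfolding metric_dist_def
proof (rule cInf_eq_minimum)
  let ?v = "y - x"
  have "metric_length (\<lambda>_ _. X) t (linepath x y) = sqrt (?v \<bullet> (X *v ?v))"
  proof -
    have "vector_derivative (linepath x y) (at s) = ?v" for s
      by (rule vector_derivative_at) (rule has_vector_derivative_linepath_within)
    then show ?thesis by (simp add: metric_length_def)
  qed
  moreover have C1: "linepath x y C1_differentiable_on {0..1}" by (simp add: linepath_def)
  ultimately show "sqrt (?v \<bullet> (X *v ?v)) \<in> {metric_length (\<lambda>_ _. X) t \<gamma> |\<gamma>. \<gamma> C1_differentiable_on {0..1} \<and> pathstart \<gamma> = x \<and> pathfinish \<gamma> = y}"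
    using C1 by (intro CollectI exI[of _ "linepath x y"]) auto
next
  let ?v = "y - x"
  have pos0: "0 \<le> x \<bullet> (X *v x)" for x using pos[of x] by (cases "x = 0") auto
  fix z
  assume "z \<in> {metric_length (\<lambda>_ _. X) t \<gamma> |\<gamma>. \<gamma> C1_differentiable_on {0..1} \<and> pathstart \<gamma> = x \<and> pathfinish \<gamma> = y}"
  then obtain \<gamma> where z: "z = metric_length (\<lambda>_ _. X) t \<gamma>" and \<gamma>: "\<gamma> C1_differentiable_on {0..1}" "\<gamma> 0 = x" "\<gamma> 1 = y"
    by (auto simp: pathstart_def pathfinish_def)
  define D where "D s = vector_derivative \<gamma> (at s)" for s
  have D: "\<And>s. s \<in> {0..1} \<Longrightarrow> (\<gamma> has_vector_derivative D s) (at s)" "continuous_on {0..1} D"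
    using \<gamma>(1) by (auto simp: C1_differentiable_on_eq D_def[abs_def] vector_derivative_works[symmetric])
  have lc: "continuous_on {0..1} (\<lambda>s. X *v D s)"
    by (rule linear_continuous_on_compose[OF D(2) matrix_vector_mul_linear])
  let ?g = "\<lambda>s. sqrt (D s \<bullet> (X *v D s))"
  have g: "?g integrable_on {0..1}"
    by (intro integrable_continuous_interval continuous_intros D(2) lc)
  have "((\<lambda>s. D s \<bullet> (X *v ?v)) has_integral \<gamma> 1 \<bullet> (X *v ?v) - \<gamma> 0 \<bullet> (X *v ?v)) {0..1}"
  proof (rule fundamental_theorem_of_calculus[where f = "\<lambda>s. \<gamma> s \<bullet> (X *v ?v)"])
    fix s :: real assume "s \<in> {0..1}"
    then have "(\<gamma> has_vector_derivative D s) (at s within {0..1})"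
      by (rule has_vector_derivative_at_within[OF D(1)])
    then show "((\<lambda>s. \<gamma> s \<bullet> (X *v ?v)) has_vector_derivative D s \<bullet> (X *v ?v)) (at s within {0..1})"
      by (rule bounded_linear.has_vector_derivative[OF bounded_linear_inner_left[of "X *v ?v"]])
  qed simp
  then have h: "((\<lambda>s. D s \<bullet> (X *v ?v)) has_integral ?v \<bullet> (X *v ?v)) {0..1}"
    by (simp add: \<gamma> inner_diff_left)
  have i: "(\<lambda>s. ?g s * sqrt (?v \<bullet> (X *v ?v))) integrable_on {0..1}"
    by (intro integrable_continuous_interval continuous_intros D(2) lc)
  have "?v \<bullet> (X *v ?v) \<le> integral {0..1} (\<lambda>s. ?g s * sqrt (?v \<bullet> (X *v ?v)))"
    by (intro has_integral_le[OF h integrable_integral[OF i]] form_cauchy_schwarz[OF X pos0])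
  also have "\<dots> = z * sqrt (?v \<bullet> (X *v ?v))"
    by (simp add: z metric_length_def D_def)
  finally have le: "sqrt (?v \<bullet> (X *v ?v)) * sqrt (?v \<bullet> (X *v ?v)) \<le> z * sqrt (?v \<bullet> (X *v ?v))"
    using pos0[of ?v] by simp
  show "sqrt (?v \<bullet> (X *v ?v)) \<le> z"
  proof (cases "?v = 0")
    case True
    then have "sqrt (?v \<bullet> (X *v ?v)) = 0" by simp
    moreover have "0 \<le> z" unfolding z metric_length_def D_def[symmetric]
      by (intro integral_nonneg g) (simp add: pos0)
    ultimately show ?thesis by simp
  next
    case False
    then have "0 < sqrt (?v \<bullet> (X *v ?v))" using pos by simp
    then show ?thesis using le by (metis mult_le_cancel_right_pos)
  qed
qed

section \<open>Differential inequalities between two trajectories\<close>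

lemma exp_decay:
  fixes g g' :: "real \<Rightarrow> real"
  assumes ab: "a \<le> b"
    and g: "\<And>s. s \<in> {a..b} \<Longrightarrow> (g has_real_derivative g' s) (at s within {a..b})"
    and le: "\<And>s. s \<in> {a..b} \<Longrightarrow> g' s \<le> - 2 * \<rho> * g s"
  shows "g b \<le> exp (- 2 * \<rho> * (b - a)) * g a"
proof (cases "a = b")
  case False
  let ?h = "\<lambda>s. exp (2 * \<rho> * s) * g s"
  have "?h b \<le> ?h a"
  proof (rule DERIV_nonpos_imp_decreasing_open[of a b ?h])
    show "\<exists>y. (?h has_real_derivative y) (at s) \<and> y \<le> 0" if "a < s" "s < b" for s
    proof (intro exI conjI)
      have "(g has_real_derivative g' s) (at s)"
        using g[of s] that at_within_Icc_at[of a s b] by simp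
      then show "(?h has_real_derivative exp (2 * \<rho> * s) * (2 * \<rho> * g s + g' s)) (at s)"
        by (auto intro!: derivative_eq_intros simp: algebra_simps)
      show "exp (2 * \<rho> * s) * (2 * \<rho> * g s + g' s) \<le> 0"
        using le[of s] that by (intro mult_nonneg_nonpos) auto
    qed
    show "continuous_on {a..b} ?h"
      using g by (intro continuous_intros DERIV_continuous_on) auto
  qed (use ab in auto)
  then have "exp (- 2 * \<rho> * b) * ?h b \<le> exp (- 2 * \<rho> * b) * ?h a" by (intro mult_left_mono) auto
  then show ?thesis by (simp add: algebra_simps flip: exp_add mult.assoc)
qed simp

text \<open>The derivative has a sign only below the level R. Up to the first time c at which R is
  reached, g is nonincreasing, so g c \<le> g a < R, a contradiction.\<close>

lemma barrier:
  fixes g g' :: "real \<Rightarrow> real"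
  assumes ab: "a \<le> b"
    and g: "\<And>s. s \<in> {a..b} \<Longrightarrow> (g has_real_derivative g' s) (at s within {a..b})"
    and le: "\<And>s. s \<in> {a..b} \<Longrightarrow> g s < R \<Longrightarrow> g' s \<le> 0"
    and ga: "g a < R"
  shows "g b < R"
proof (rule ccontr)
  assume "\<not> g b < R"
  have cont: "continuous_on {a..b} g" using g by (intro DERIV_continuous_on) auto
  define S where "S = {s \<in> {a..b}. R \<le> g s}"
  have S: "closed S" "b \<in> S" "bdd_below S"
    using continuous_closed_preimage[OF cont, of "{R..}"] \<open>\<not> g b < R\<close> ab
    by (auto simp: S_def vimage_def Int_def)
  define c where "c = Inf S"
  have c: "c \<in> S" unfolding c_def using S by (intro closed_contains_Inf) auto
  then have cab: "a < c" "c \<le> b" using ga by (auto simp: S_def intro: order.not_eq_order_implies_strict)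
  have less: "g s < R" if "a \<le> s" "s < c" for s
  proof (rule ccontr)
    assume "\<not> g s < R"
    then have "s \<in> S" using that cab by (simp add: S_def)
    then have "c \<le> s" unfolding c_def using S(3) by (rule cInf_lower)
    then show False using that by simp
  qed
  have "g c \<le> g a"
  proof (rule DERIV_nonpos_imp_decreasing_open[of a c g])
    show "\<exists>y. (g has_real_derivative y) (at s) \<and> y \<le> 0" if "a < s" "s < c" for s
    proof (intro exI conjI)
      show "(g has_real_derivative g' s) (at s)"
        using g[of s] that cab at_within_Icc_at[of a s b] by simp
      show "g' s \<le> 0" using le[of s] less[of s] that cab by simp
    qed
    show "continuous_on {a..c} g" using cont cab by (elim continuous_on_subset) auto
  qed (use cab in auto)
  then show False using c ga by (simp add: S_def)
qed

text \<open>Pairing f with v = b - a through X makes it scalar along the segment, so the mean value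
  theorem gives one intermediate Jacobian, and the assumed bound holds for each of them.\<close>

lemma segment_contraction:
  fixes f :: "real^'k \<Rightarrow> real^'k"
  assumes jac: "\<And>z. z \<in> closed_segment a b \<Longrightarrow>
      \<exists>A. (f has_derivative (\<lambda>h. A *v h)) (at z) \<and> (\<forall>x. x \<bullet> (X *v (A *v x)) \<le> - \<rho> * (x \<bullet> (X *v x)))"
  shows "(b - a) \<bullet> (X *v (f b - f a)) \<le> - \<rho> * ((b - a) \<bullet> (X *v (b - a)))"
proof -
  let ?v = "b - a"
  have seg: "a + s *\<^sub>R ?v \<in> closed_segment a b" if "s \<in> {0..1}" for s
    using that by (auto simp: in_segment algebra_simps intro!: exI[of _ s])
  obtain A where A: "\<And>z. z \<in> closed_segment a b \<Longrightarrow>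
      (f has_derivative (\<lambda>h. A z *v h)) (at z) \<and> (\<forall>x. x \<bullet> (X *v (A z *v x)) \<le> - \<rho> * (x \<bullet> (X *v x)))"
    using jac by metis
  let ?\<phi> = "\<lambda>s. ?v \<bullet> (X *v f (a + s *\<^sub>R ?v))"
  have "(?\<phi> has_derivative (\<lambda>h. h * (?v \<bullet> (X *v (A (a + s *\<^sub>R ?v) *v ?v))))) (at s within {0..1})"
    if "s \<in> {0..1}" for s
  proof -
    have "((\<lambda>s. a + s *\<^sub>R ?v) has_derivative (\<lambda>h. h *\<^sub>R ?v)) (at s within {0..1})"
      by (auto intro!: derivative_eq_intros)
    from has_derivative_compose[OF this conjunct1[OF A[OF seg[OF that]]]]
    have 1: "((\<lambda>s. f (a + s *\<^sub>R ?v)) has_derivative (\<lambda>h. A (a + s *\<^sub>R ?v) *v (h *\<^sub>R ?v))) (at s within {0..1})"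
      by simp
    have "bounded_linear (\<lambda>z. ?v \<bullet> (X *v z))"
      by (intro bounded_linear_compose[OF bounded_linear_inner_right] linear_conv_bounded_linear[THEN iffD1] matrix_vector_mul_linear)
    from bounded_linear.has_derivative[OF this 1] show ?thesis
      by (simp add: matrix_vector_mult_scaleR)
  qed
  then obtain s where s: "s \<in> {0<..<1}" "?\<phi> 1 - ?\<phi> 0 = (1 - 0) * (?v \<bullet> (X *v (A (a + s *\<^sub>R ?v) *v ?v)))"
    using mvt_simple[of 0 1 ?\<phi> "\<lambda>s h. h * (?v \<bullet> (X *v (A (a + s *\<^sub>R ?v) *v ?v)))"] by auto
  have "?v \<bullet> (X *v (f b - f a)) = ?v \<bullet> (X *v (A (a + s *\<^sub>R ?v) *v ?v))"
    using s(2) by (simp add: matrix_vector_mult_diff_distrib inner_diff_right)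
  then show ?thesis using A[OF seg[of s]] s(1) by auto
qed

text \<open>The segment between the trajectories is known to lie in \<open>D\<close> only while
  their squared distance is below R. By \<open>barrier\<close> this persists up to t, and then
  \<open>exp_decay\<close> applies on all of [t0, t]. The second trajectory is given on an interval
  \<open>I\<close>, so its existence for all times is not presupposed.\<close>

lemma trajectory_contraction:
  fixes f :: "real^'k \<Rightarrow> real \<Rightarrow> real^'k"
  assumes X: "transpose X = X" and pos: "\<And>x. x \<noteq> 0 \<Longrightarrow> 0 < x \<bullet> (X *v x)" and \<rho>: "0 < \<rho>"
    and jac: "\<And>z t. z \<in> D \<Longrightarrow> 0 \<le> t \<Longrightarrow>
      \<exists>A. ((\<lambda>z. f z t) has_derivative (\<lambda>h. A *v h)) (at z) \<and> (\<forall>x. x \<bullet> (X *v (A *v x)) \<le> - \<rho> * (x \<bullet> (X *v x)))"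
    and s: "trajectory f {0..} s" and \<theta>: "trajectory f I \<theta>" and I: "is_interval I" "I \<subseteq> {0..}"
    and t: "t0 \<in> I" "t \<in> I" "t0 \<le> t"
    and seg: "\<And>u. 0 \<le> u \<Longrightarrow> (\<theta> u - s u) \<bullet> (X *v (\<theta> u - s u)) < R \<Longrightarrow> closed_segment (s u) (\<theta> u) \<subseteq> D"
    and init: "(\<theta> t0 - s t0) \<bullet> (X *v (\<theta> t0 - s t0)) < R"
  shows "(\<theta> t - s t) \<bullet> (X *v (\<theta> t - s t)) < R"
    and "(\<theta> t - s t) \<bullet> (X *v (\<theta> t - s t)) \<le> exp (- 2 * \<rho> * (t - t0)) * ((\<theta> t0 - s t0) \<bullet> (X *v (\<theta> t0 - s t0)))"
proof -
  define g where "g u = (\<theta> u - s u) \<bullet> (X *v (\<theta> u - s u))" for u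
  define g' where "g' u = 2 * ((\<theta> u - s u) \<bullet> (X *v (f (\<theta> u) u - f (s u) u)))" for u
  have sub: "{t0..t'} \<subseteq> I" if "t' \<in> {t0..t}" for t'
    using I(1) t that unfolding is_interval_1 by (meson atLeastAtMost_iff order_trans subsetI)
  have deriv: "(g has_real_derivative g' u) (at u within {t0..t'})" if "t' \<in> {t0..t}" "u \<in> {t0..t'}" for t' u
  proof -
    have sub': "{t0..t'} \<subseteq> I" by (rule sub[OF that(1)])
    have "(\<theta> has_vector_derivative f (\<theta> u) u) (at u within {t0..t'})"
      using \<theta> that(2) sub' unfolding trajectory_def by (meson has_vector_derivative_within_subset subsetD)
    moreover have "(s has_vector_derivative f (s u) u) (at u within {t0..t'})"
      using s that(2) sub' I(2) unfolding trajectory_def by (meson has_vector_derivative_within_subset order_trans subsetD)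
    ultimately have e: "((\<lambda>u. \<theta> u - s u) has_vector_derivative f (\<theta> u) u - f (s u) u) (at u within {t0..t'})"
      by (rule has_vector_derivative_diff)
    have bl: "bounded_linear (\<lambda>z. X *v z)"
      by (intro linear_conv_bounded_linear[THEN iffD1] matrix_vector_mul_linear)
    have "(g has_vector_derivative (\<theta> u - s u) \<bullet> (X *v (f (\<theta> u) u - f (s u) u)) + (f (\<theta> u) u - f (s u) u) \<bullet> (X *v (\<theta> u - s u)))
        (at u within {t0..t'})"
      unfolding g_def
      by (rule bounded_bilinear.has_vector_derivative[OF bounded_bilinear_inner e bounded_linear.has_vector_derivative[OF bl e]])
    then show ?thesis
      unfolding has_real_derivative_iff_has_vector_derivative g'_def
      by (simp add: symmetric_inner_commute[OF X, of "f (\<theta> u) u - f (s u) u"])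
  qed
  have le: "g' u \<le> - 2 * \<rho> * g u" if "u \<in> {t0..t}" "g u < R" for u
  proof -
    have "0 \<le> u" using that(1) t(1) I(2) by auto
    moreover from this have "closed_segment (s u) (\<theta> u) \<subseteq> D"
      using seg that(2) by (simp add: g_def)
    ultimately have "(\<theta> u - s u) \<bullet> (X *v (f (\<theta> u) u - f (s u) u)) \<le> - \<rho> * ((\<theta> u - s u) \<bullet> (X *v (\<theta> u - s u)))"
      using jac by (intro segment_contraction) blast
    then show ?thesis by (simp add: g_def g'_def)
  qed
  have g0: "0 \<le> g u" for u
    unfolding g_def using pos[of "\<theta> u - s u"] by (cases "\<theta> u - s u = 0") auto
  \<comment> \<open>\<open>barrier\<close> controls the right end point only, hence its use on every
    [t0, t'].\<close>
  have inside: "g t' < R" if "t' \<in> {t0..t}" for t'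
  proof (rule barrier[of t0 t' g g' R])
    show "g' u \<le> 0" if "u \<in> {t0..t'}" "g u < R" for u
    proof -
      have "g' u \<le> - 2 * \<rho> * g u" using that \<open>t' \<in> {t0..t}\<close> by (intro le) auto
      also have "\<dots> \<le> 0" using \<rho> g0[of u] by simp
      finally show ?thesis .
    qed
    show "g t0 < R" using init by (simp add: g_def)
  qed (use that deriv in auto)
  show "(\<theta> t - s t) \<bullet> (X *v (\<theta> t - s t)) < R"
    using inside[of t] t(3) by (simp add: g_def)
  have "g t \<le> exp (- 2 * \<rho> * (t - t0)) * g t0"
    using t(3) deriv[of t] le inside by (intro exp_decay) auto
  then show "(\<theta> t - s t) \<bullet> (X *v (\<theta> t - s t)) \<le> exp (- 2 * \<rho> * (t - t0)) * ((\<theta> t0 - s t0) \<bullet> (X *v (\<theta> t0 - s t0)))"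
    by (simp add: g_def)
qed


section \<open>The closed loop as a gradient system\<close>

lemma grad_component: "(f has_derivative f') (at x) \<Longrightarrow> grad f x $ i = f' (axis i 1)"
  by (simp add: grad_def flip: frechet_derivative_at)

lemma grad_eqI: "(f has_derivative (\<lambda>h. w \<bullet> h)) (at x) \<Longrightarrow> grad f x = w"
  by (simp add: vec_eq_iff grad_component inner_axis)

lemma linear_functional_axis:
  fixes f :: "real^'n \<Rightarrow> real"
  assumes "linear f"
  shows "f h = (\<chi> i. f (axis i 1)) \<bullet> h"
proof -
  have "f h = f (\<Sum>i\<in>UNIV. (h $ i) *\<^sub>R axis i 1)"
    using basis_expansion[of h] by (simp add: scalar_mult_eq_scaleR)
  also have "\<dots> = (\<Sum>i\<in>UNIV. (h $ i) * f (axis i 1))"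
    by (simp add: linear_sum[OF assms] linear_cmul[OF assms])
  finally show ?thesis by (simp add: inner_vec_def mult.commute)
qed

lemma has_derivative_grad:
  assumes "f differentiable (at x)"
  shows "(f has_derivative (\<lambda>h. grad f x \<bullet> h)) (at x)"
proof -
  obtain f' where f': "(f has_derivative f') (at x)" using assms by (auto simp: differentiable_def)
  have gx: "grad f x = (\<chi> i. f' (axis i 1))" by (simp add: vec_eq_iff grad_component[OF f'])
  have "f' h = grad f x \<bullet> h" for h
    unfolding gx by (rule linear_functional_axis[OF has_derivative_linear[OF f']])
  then have "f' = (\<lambda>h. grad f x \<bullet> h)" by (rule ext)
  then show ?thesis using f' by (simp only:)
qed

lemma differentiable_cart:
  fixes f :: "'a::real_normed_vector \<Rightarrow> real^'n"
  assumes "\<And>i. (\<lambda>x. f x $ i) differentiable (at a)"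
  shows "f differentiable (at a)"
proof -
  obtain f' where f': "\<And>i. ((\<lambda>x. f x $ i) has_derivative f' i) (at a)"
    using assms unfolding differentiable_def by metis
  have "(f has_derivative (\<lambda>h. \<chi> i. f' i h)) (at a)"
    unfolding has_derivative_componentwise_within[of f]
    using f' by (auto simp: Basis_vec_def inner_axis)
  then show ?thesis unfolding differentiable_def by blast
qed

lemma C2_differentiable: "C2 f \<Longrightarrow> f differentiable (at x)"
  unfolding C2_def differentiable_def by blast

text \<open>The components of the partial gradients are the values of the total derivative on (e_i,
  0) and (0, e_i). That derivative is itself differentiable, so both gradients are differentiable
  jointly in (q, z).\<close>

lemma C2_partial_gradients:
  fixes W :: "real^'n \<Rightarrow> real^'m \<Rightarrow> real"
  assumes "C2 (\<lambda>(q, z). W q z)"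
  shows C2_has_derivative: "((\<lambda>s. W (fst s) (snd s)) has_derivative
      (\<lambda>h. grad (\<lambda>q. W q z) q \<bullet> fst h + grad (\<lambda>z. W q z) z \<bullet> snd h)) (at (q, z))"
    and C2_grad_fst_differentiable: "(\<lambda>s. grad (\<lambda>q. W q (snd s)) (fst s)) differentiable (at (q, z))"
    and C2_grad_snd_differentiable: "(\<lambda>s. grad (\<lambda>z. W (fst s) z) (snd s)) differentiable (at (q, z))"
proof -
  obtain f' :: "(real^'n) \<times> (real^'m) \<Rightarrow> ((real^'n) \<times> (real^'m)) \<Rightarrow>\<^sub>L real" and f''
    where f': "\<And>s. ((\<lambda>(q, z). W q z) has_derivative blinfun_apply (f' s)) (at s)"
      and f'': "\<And>s. (f' has_derivative blinfun_apply (f'' s)) (at s)"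
    using assms unfolding C2_def by blast
  have W: "((\<lambda>s. W (fst s) (snd s)) has_derivative blinfun_apply (f' s)) (at s)" for s
    using f'[of s] by (simp add: case_prod_beta')
  have "((\<lambda>q. (q, z)) has_derivative (\<lambda>h. (h, 0))) (at q)" for q :: "real^'n" and z :: "real^'m"
    by (auto intro!: derivative_eq_intros)
  from has_derivative_compose[OF this W]
  have p1: "((\<lambda>q. W q z) has_derivative (\<lambda>h. f' (q, z) (h, 0))) (at q)" for q z by simp
  have "((\<lambda>z. (q, z)) has_derivative (\<lambda>h. (0, h))) (at z)" for q :: "real^'n" and z :: "real^'m"
    by (auto intro!: derivative_eq_intros)
  from has_derivative_compose[OF this W]
  have p2: "((\<lambda>z. W q z) has_derivative (\<lambda>h. f' (q, z) (0, h))) (at z)" for q z by simp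
  have g1: "grad (\<lambda>q. W q z) q \<bullet> h = f' (q, z) (h, 0)" for q z h
    using has_derivative_unique[OF has_derivative_grad p1] p1 by (metis differentiable_def)
  have g2: "grad (\<lambda>z. W q z) z \<bullet> h = f' (q, z) (0, h)" for q z h
    using has_derivative_unique[OF has_derivative_grad p2] p2 by (metis differentiable_def)
  have "blinfun_apply (f' (q, z)) h = grad (\<lambda>q. W q z) q \<bullet> fst h + grad (\<lambda>z. W q z) z \<bullet> snd h" for h
    unfolding g1 g2 by (simp flip: blinfun.add_right)
  then show "((\<lambda>s. W (fst s) (snd s)) has_derivative
      (\<lambda>h. grad (\<lambda>q. W q z) q \<bullet> fst h + grad (\<lambda>z. W q z) z \<bullet> snd h)) (at (q, z))"
    using W[of "(q, z)"] by (metis (no_types, lifting) ext)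
  have dv: "(\<lambda>s. blinfun_apply (f' s) v) differentiable (at s)" for v s
    unfolding differentiable_def
    by (rule exI) (rule bounded_linear.has_derivative[OF blinfun.bounded_linear_left f''])
  show "(\<lambda>s. grad (\<lambda>q. W q (snd s)) (fst s)) differentiable (at (q, z))"
    using dv by (intro differentiable_cart) (simp add: grad_component[OF p1])
  show "(\<lambda>s. grad (\<lambda>z. W (fst s) z) (snd s)) differentiable (at (q, z))"
    using dv by (intro differentiable_cart) (simp add: grad_component[OF p2])
qed

section \<open>Coordinates of the extended state\<close>

lemma q_of_ext_state [simp]: "q_of (ext_state q p z1 z2) = q"
  and p_of_ext_state [simp]: "p_of (ext_state q p z1 z2) = p"
  and z1_of_ext_state [simp]: "z1_of (ext_state q p z1 z2) = z1"
  and z2_of_ext_state [simp]: "z2_of (ext_state q p z1 z2) = z2"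
  by (simp_all add: ext_state_def vjoin_def q_of_def p_of_def z1_of_def z2_of_def)

lemma ext_state_of: "ext_state (q_of h) (p_of h) (z1_of h) (z2_of h) = h"
  by (simp add: ext_state_def vjoin_def q_of_def p_of_def z1_of_def z2_of_def vec_eq_iff split: sum.split)

lemma inner_ext_state: "ext_state a b c d \<bullet> h = a \<bullet> q_of h + b \<bullet> p_of h + (c \<bullet> z1_of h + d \<bullet> z2_of h)"
  by (subst ext_state_of[symmetric, of h]) (simp only: ext_state_def inner_vjoin)

lemma linear_of: "linear q_of" "linear p_of" "linear z1_of" "linear z2_of"
  by (auto intro!: linearI simp: q_of_def p_of_def z1_of_def z2_of_def vec_eq_iff)

lemmas bounded_linear_of = linear_of[unfolded linear_conv_bounded_linear]

lemma norm_ext_state: "(norm h)\<^sup>2 = (norm (q_of h))\<^sup>2 + (norm (p_of h))\<^sup>2 + ((norm (z1_of h))\<^sup>2 + (norm (z2_of h))\<^sup>2)"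
  unfolding power2_norm_eq_inner by (subst (1) ext_state_of[symmetric, of h]) (rule inner_ext_state)

lemma ext_state_add: "ext_state a b c d + ext_state a' b' c' d' = ext_state (a + a') (b + b') (c + c') (d + d')"
  by (simp add: ext_state_def vjoin_add)

lemma bounded_linear_ext_state:
  "bounded_linear (\<lambda>a. ext_state a 0 0 0)" "bounded_linear (\<lambda>b. ext_state 0 b 0 0)"
  "bounded_linear (\<lambda>c. ext_state 0 0 c 0)" "bounded_linear (\<lambda>d. ext_state 0 0 0 d)"
  unfolding linear_conv_bounded_linear[symmetric] ext_state_def
  by (auto intro!: linearI simp: vjoin_add vjoin_scaleR)

lemma has_vector_derivative_ext_state:
  assumes "(a has_vector_derivative a') F" "(b has_vector_derivative b') F"
    "(c has_vector_derivative c') F" "(d has_vector_derivative d') F"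
  shows "((\<lambda>t. ext_state (a t) (b t) (c t) (d t)) has_vector_derivative ext_state a' b' c' d') F"
proof -
  have "((\<lambda>t. ext_state (a t) 0 0 0 + ext_state 0 (b t) 0 0 + (ext_state 0 0 (c t) 0 + ext_state 0 0 0 (d t)))
      has_vector_derivative ext_state a' 0 0 0 + ext_state 0 b' 0 0 + (ext_state 0 0 c' 0 + ext_state 0 0 0 d')) F"
    by (intro has_vector_derivative_add bounded_linear.has_vector_derivative[OF bounded_linear_ext_state(1)]
        bounded_linear.has_vector_derivative[OF bounded_linear_ext_state(2)]
        bounded_linear.has_vector_derivative[OF bounded_linear_ext_state(3)]
        bounded_linear.has_vector_derivative[OF bounded_linear_ext_state(4)] assms)
  then show ?thesis by (simp add: ext_state_add)
qed

lemma bounded_linear_differentiable: "bounded_linear L \<Longrightarrow> f differentiable F \<Longrightarrow> (\<lambda>x. L (f x)) differentiable F"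
  unfolding differentiable_def using bounded_linear.has_derivative by blast

lemma differentiable_ext_state:
  assumes "a differentiable F" "b differentiable F" "c differentiable F" "d differentiable F"
  shows "(\<lambda>t. ext_state (a t) (b t) (c t) (d t)) differentiable F"
proof -
  have "(\<lambda>t. ext_state (a t) 0 0 0 + ext_state 0 (b t) 0 0 + (ext_state 0 0 (c t) 0 + ext_state 0 0 0 (d t))) differentiable F"
    by (intro differentiable_add bounded_linear_differentiable[OF bounded_linear_ext_state(1)]
        bounded_linear_differentiable[OF bounded_linear_ext_state(2)]
        bounded_linear_differentiable[OF bounded_linear_ext_state(3)]
        bounded_linear_differentiable[OF bounded_linear_ext_state(4)] assms)
  then show ?thesis by (simp add: ext_state_add)
qed

lemma bounded_linear_mult_vec: "bounded_linear (\<lambda>x. A *v x)" for A :: "real^'i^'k"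
  unfolding linear_conv_bounded_linear[symmetric] by (rule matrix_vector_mul_linear)

lemma has_derivative_quadratic_form:
  fixes A :: "real^'k^'k"
  assumes A: "transpose A = A" and f: "(f has_derivative f') (at x)"
  shows "((\<lambda>x. 1/2 * (f x \<bullet> (A *v f x))) has_derivative (\<lambda>h. (A *v f x) \<bullet> f' h)) (at x)"
proof -
  have "((\<lambda>x. f x \<bullet> (A *v f x)) has_derivative (\<lambda>h. f x \<bullet> (A *v f' h) + f' h \<bullet> (A *v f x))) (at x)"
    by (rule has_derivative_inner[OF f bounded_linear.has_derivative[OF bounded_linear_mult_vec f]])
  moreover have "f x \<bullet> (A *v f' h) = f' h \<bullet> (A *v f x)" for h
    by (metis A inner_transpose_mult_vec)
  ultimately have "((\<lambda>x. f x \<bullet> (A *v f x)) has_derivative (\<lambda>h. 2 * ((A *v f x) \<bullet> f' h))) (at x)"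
    by (simp add: inner_commute)
  from has_derivative_mult_right[OF this, of "1/2"] show ?thesis by simp
qed

lemma pos_def_invertible: "pos_def M \<Longrightarrow> invertible M"
  unfolding invertible_left_inverse matrix_left_invertible_ker pos_def_def by (metis inner_zero_right less_irrefl)

lemma transpose_matrix_inv:
  fixes M :: "real^'k^'k"
  assumes "invertible M" "transpose M = M"
  shows "transpose (matrix_inv M) = matrix_inv M"
proof -
  have "transpose (matrix_inv M) ** M = mat 1"
    using matrix_transpose_mul[of M "matrix_inv M"] assms by (simp add: matrix_inv_right transpose_mat)
  then have "transpose (matrix_inv M) ** (M ** matrix_inv M) = matrix_inv M"
    by (simp add: matrix_mul_assoc)
  then show ?thesis using assms by (simp add: matrix_inv_right)
qed

lemma q_dot_eq:
  assumes "pos_def M"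
  shows "q_dot M V q p = matrix_inv M *v p"
proof -
  have "transpose (matrix_inv M) = matrix_inv M"
    using assms by (intro transpose_matrix_inv pos_def_invertible) (auto simp: pos_def_def)
  from has_derivative_add[OF has_derivative_quadratic_form[OF this has_derivative_ident] has_derivative_const]
  show ?thesis unfolding q_dot_def hamiltonian_def by (intro grad_eqI) simp
qed

lemma p_dot_eq:
  assumes "V differentiable (at q)"
  shows "p_dot M V G q p v = - grad V q + G *v v"
proof -
  have "grad (\<lambda>q. hamiltonian M V q p) q = grad V q"
    unfolding hamiltonian_def
    using has_derivative_add[OF has_derivative_const has_derivative_grad[OF assms]] by (intro grad_eqI) simp
  then show ?thesis by (simp add: p_dot_def)
qed

definition grad_H_d3 ::
    "real^'n^'n \<Rightarrow> (real^'n \<Rightarrow> real^'m \<Rightarrow> real \<Rightarrow> real) \<Rightarrow> real^'m^'m \<Rightarrow> (real \<Rightarrow> real^'m) \<Rightarrow> real^'m \<Rightarrow>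
     real^('n, 'm) ext \<Rightarrow> real \<Rightarrow> real^('n, 'm) ext" where
  "grad_H_d3 Md W Kz \<gamma>2 \<mu>2 \<theta> t = ext_state (grad_q W (q_of \<theta>) (z1_of \<theta>) t) (matrix_inv Md *v p_of \<theta>)
     (grad_z W (q_of \<theta>) (z1_of \<theta>) t) (Kz *v (z2_of \<theta> - \<gamma>2 t + \<mu>2))"

lemma has_derivative_q_z1: "((\<lambda>\<theta>. (q_of \<theta>, z1_of \<theta>)) has_derivative (\<lambda>h. (q_of h, z1_of h))) (at \<theta>)"
  by (intro has_derivative_Pair bounded_linear_imp_has_derivative bounded_linear_of)

lemma grad_H_d3_eq:
  assumes W: "C2 (\<lambda>(q, z1). W q z1 t)" and Md: "pos_def Md" and Kz: "pos_def Kz"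
  shows "grad (\<lambda>\<theta>. H_d3 Md W Kz \<gamma>2 \<mu>2 \<theta> t) \<theta> = grad_H_d3 Md W Kz \<gamma>2 \<mu>2 \<theta> t"
proof (rule grad_eqI)
  have "transpose (matrix_inv Md) = matrix_inv Md"
    using Md by (intro transpose_matrix_inv pos_def_invertible) (auto simp: pos_def_def)
  note d1 = has_derivative_quadratic_form[OF this bounded_linear_imp_has_derivative[OF bounded_linear_of(2)]]
  note d2 = has_derivative_compose[OF has_derivative_q_z1 C2_has_derivative[OF W]]
  have "transpose Kz = Kz" using Kz by (simp add: pos_def_def)
  moreover have "((\<lambda>\<theta>. z2_of \<theta> - \<gamma>2 t + \<mu>2) has_derivative z2_of) (at \<theta>)"
    using bounded_linear_imp_has_derivative[OF bounded_linear_of(4)] by (auto intro!: derivative_eq_intros)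
  ultimately have d3: "((\<lambda>\<theta>. 1/2 * ((z2_of \<theta> - \<gamma>2 t + \<mu>2) \<bullet> (Kz *v (z2_of \<theta> - \<gamma>2 t + \<mu>2)))) has_derivative
      (\<lambda>h. (Kz *v (z2_of \<theta> - \<gamma>2 t + \<mu>2)) \<bullet> z2_of h)) (at \<theta>)"
    by (rule has_derivative_quadratic_form)
  show "((\<lambda>\<theta>. H_d3 Md W Kz \<gamma>2 \<mu>2 \<theta> t) has_derivative (\<lambda>h. grad_H_d3 Md W Kz \<gamma>2 \<mu>2 \<theta> t \<bullet> h)) (at \<theta>)"
    unfolding H_d3_def
    by (rule has_derivative_eq_rhs[OF has_derivative_add[OF has_derivative_add[OF d1] d3]])
      (use d2 in \<open>auto simp: grad_H_d3_def inner_ext_state grad_q_def grad_z_def\<close>)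
qed

text \<open>\<open>hess\<close> is defined as a Jacobian, which is the derivative of the gradient
  only once that gradient is known to be differentiable.\<close>

lemma grad_H_d3_differentiable:
  assumes W: "C2 (\<lambda>(q, z1). W q z1 t)"
  shows "(\<lambda>\<theta>. grad_H_d3 Md W Kz \<gamma>2 \<mu>2 \<theta> t) differentiable (at \<theta>)"
  unfolding grad_H_d3_def grad_q_def grad_z_def
proof (intro differentiable_ext_state)
  have qz: "(\<lambda>\<theta>. (q_of \<theta>, z1_of \<theta>)) differentiable (at \<theta>)"
    using has_derivative_q_z1 unfolding differentiable_def by blast
  show "(\<lambda>\<theta>. grad (\<lambda>q. W q (z1_of \<theta>) t) (q_of \<theta>)) differentiable (at \<theta>)"
    using differentiable_compose[OF C2_grad_fst_differentiable[OF W] qz] by simp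
  show "(\<lambda>\<theta>. grad (\<lambda>z1. W (q_of \<theta>) z1 t) (z1_of \<theta>)) differentiable (at \<theta>)"
    using differentiable_compose[OF C2_grad_snd_differentiable[OF W] qz] by simp
  show "(\<lambda>\<theta>. matrix_inv Md *v p_of \<theta>) differentiable (at \<theta>)"
    by (intro bounded_linear_differentiable[OF bounded_linear_mult_vec] bounded_linear_imp_differentiable bounded_linear_of)
  show "(\<lambda>\<theta>. Kz *v (z2_of \<theta> - \<gamma>2 t + \<mu>2)) differentiable (at \<theta>)"
    by (intro bounded_linear_differentiable[OF bounded_linear_mult_vec] differentiable_add differentiable_diff
        differentiable_const bounded_linear_imp_differentiable bounded_linear_of)
qed

lemma P3_mult_ext_state:
  "P3 J \<Gamma>11 \<Gamma>12 \<Gamma>21 \<Gamma>22 \<Gamma>33 *v ext_state a b c d =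
     ext_state (J *v b) (- (transpose J *v a) + (\<Gamma>11 *v c + \<Gamma>12 *v d)) (\<Gamma>21 *v a - \<Gamma>33 *v c) (\<Gamma>22 *v a)"
  unfolding P3_def ext_state_def block_mult_vec hjoin_mult_vec vjoin_mult_vec
  by (simp add: uminus_mult_vec vjoin_add del: transpose_matrix_vector)

lemma transpose_add: "transpose (A + B) = transpose A + transpose B"
  by (simp add: transpose_def vec_eq_iff)

lemma transpose_diff: "transpose (A - B) = transpose A - transpose B"
  by (simp add: transpose_def vec_eq_iff)

lemma transpose_uminus: "transpose (- A) = - transpose A"
  by (simp add: transpose_def vec_eq_iff)

lemma transpose_scaleR: "transpose (k *\<^sub>R A) = k *\<^sub>R transpose A" for A :: "real^'i^'k"
  by (simp add: transpose_def vec_eq_iff)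

section \<open>Pseudo-inverses and left annihilators\<close>

lemma transpose_mult_self_inj:
  fixes g :: "real^'m^'n"
  assumes "inj ((*v) g)" "transpose g *v (g *v w) = 0"
  shows "w = 0"
proof -
  have "(g *v w) \<bullet> (g *v w) = w \<bullet> (transpose g *v (g *v w))"
    by (simp only: inner_transpose_mult_vec)
  then have "g *v w = g *v 0" using assms(2) by simp
  then show ?thesis using assms(1) by (simp only: inj_eq)
qed

lemma pinv_mult:
  fixes g :: "real^'m^'n"
  assumes "inj ((*v) g)"
  shows "pinv g *v (g *v w) = w"
proof -
  have "x = 0" if "(transpose g ** g) *v x = 0" for x
    using transpose_mult_self_inj[OF assms, of x] that by (simp only: matrix_vector_mul_assoc)
  then have "invertible (transpose g ** g)"
    unfolding invertible_left_inverse matrix_left_invertible_ker by blast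
  then show ?thesis
    unfolding pinv_def by (simp add: matrix_vector_mul_assoc matrix_inv_left flip: matrix_mul_assoc)
qed

text \<open>The orthogonal complement of n - m independent rows has dimension m. It contains the
  range of G, which has the same dimension, so the two agree; for n = m both are the whole
  space.\<close>

lemma in_range_of_left_annihilator:
  fixes G :: "real^'m^'n"
  assumes dims: "CARD('m) \<le> CARD('n)" and G: "rank G = CARD('m)" and N: "left_annihilator N G"
    and x: "\<And>i. i < CARD('n) - CARD('m) \<Longrightarrow> N i \<bullet> x = 0"
  shows "x \<in> range ((*v) G)"
proof -
  let ?I = "{..<CARD('n) - CARD('m)}"
  let ?K = "{y. \<forall>x\<in>span (N ` ?I). orthogonal x y}"
  have "dim (span (N ` ?I)) = CARD('n) - CARD('m)"
    using N by (simp add: left_annihilator_def dim_eq_card_independent card_image)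
  moreover have "dim ?K + dim (span (N ` ?I)) = dim (UNIV :: (real^'n) set)"
    using dim_subspace_orthogonal_to_vectors[OF subspace_span[of "N ` ?I"] subspace_UNIV] by simp
  ultimately have dK: "dim ?K = CARD('m)" using dims by simp
  have N0: "N i \<bullet> (G *v w) = 0" if "i \<in> ?I" for i w
    using N that by (simp add: left_annihilator_def flip: dot_lmul_matrix)
  have sub: "y \<in> ?K" if "\<And>i. i \<in> ?I \<Longrightarrow> N i \<bullet> y = 0" for y
  proof -
    have "orthogonal y z" if "z \<in> span (N ` ?I)" for z
      by (rule orthogonal_to_span[OF that]) (use \<open>\<And>i. i \<in> ?I \<Longrightarrow> N i \<bullet> y = 0\<close> in \<open>auto simp: orthogonal_def inner_commute\<close>)
    then show ?thesis by (simp add: orthogonal_commute)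
  qed
  have "range ((*v) G) = ?K"
  proof (rule subspace_dim_equal)
    show "subspace (range ((*v) G))"
      by (rule linear_subspace_image[OF matrix_vector_mul_linear subspace_UNIV])
    show "subspace ?K" unfolding subspace_def orthogonal_def by (auto simp: inner_simps)
    show "range ((*v) G) \<subseteq> ?K" using sub N0 by blast
    show "dim ?K \<le> dim (range ((*v) G))" using dK G by (simp add: rank_dim_range)
  qed
  then show ?thesis using sub x by blast
qed

lemma matching_range:
  fixes G B :: "real^'m^'n"
  assumes dims: "CARD('m) \<le> CARD('n)" and G: "rank G = CARD('m)" and N: "left_annihilator N G"
    and B: "inj ((*v) B)" and B0: "\<And>i w. i < CARD('n) - CARD('m) \<Longrightarrow> N i \<bullet> (B *v w) = 0"
  shows "range ((*v) B) = range ((*v) G)"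
proof (rule subspace_dim_equal)
  show "subspace (range ((*v) B))" "subspace (range ((*v) G))"
    by (rule linear_subspace_image[OF matrix_vector_mul_linear subspace_UNIV])+
  show "range ((*v) B) \<subseteq> range ((*v) G)"
    using in_range_of_left_annihilator[OF dims G N B0] by blast
  show "dim (range ((*v) G)) \<le> dim (range ((*v) B))"
    using G full_rank_injective[of B] B by (simp add: rank_dim_range)
qed

text \<open>Matching puts the bracket of the control law into the range of G, where
  \<open>pinv G\<close> followed by G is the identity, so the intended force is realised exactly.
  The formula for \<open>\<gamma>2\<close> is the momentum equation along the reference, solved for
  the value that balances it when \<open>z2\<close> equals - \<open>\<mu>2\<close>.\<close>

lemma closed_loop_gradient_system:
  fixes M Md J :: "real^'n^'n"
    and V :: "real^'n \<Rightarrow> real"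
    and G \<Gamma>11 \<Gamma>12 :: "real^'m^'n"
    and Gperp :: "nat \<Rightarrow> real^'n"
    and d \<mu>2 :: "real^'m"
    and qs ps :: "real \<Rightarrow> real^'n"
    and Vd3 :: "real^'n \<Rightarrow> real^'m \<Rightarrow> real \<Rightarrow> real"
    and Kz \<Gamma>33 :: "real^'m^'m"
    and \<Gamma>21 \<Gamma>22 :: "real^'n^'m"
    and z1s \<gamma>2 :: "real \<Rightarrow> real^'m"
  assumes dims: "CARD('m) \<le> CARD('n)"
    and M: "pos_def M"
    and V: "C2 V"
    and G: "rank G = CARD('m)"
    and Gperp: "left_annihilator Gperp G"
    and feasible: "feasible M V G qs ps"
    and Kz: "pos_def Kz"
    and \<Gamma>12_rank: "rank \<Gamma>12 = CARD('m)"
    and \<gamma>2: "\<gamma>2 = (\<lambda>t. matrix_inv (transpose G ** \<Gamma>12 ** Kz) *v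
                (transpose G *v (- (transpose J *v grad_q Vd3 (qs t) (z1s t) t)
                                 + \<Gamma>11 *v grad_z Vd3 (qs t) (z1s t) t)
                 - transpose G *v vector_derivative ps (at t within {0..})))"
    and \<mu>2: "\<mu>2 = pinv (\<Gamma>12 ** Kz) *v (G *v d)"
    and matching_p: "\<And>p. matrix_inv M *v p = J *v (matrix_inv Md *v p)"
    and matching_q: "\<And>q z1 z2 t i. 0 \<le> t \<Longrightarrow> i < CARD('n) - CARD('m) \<Longrightarrow>
          Gperp i \<bullet> (grad V q - transpose J *v grad_q Vd3 q z1 t + \<Gamma>11 *v grad_z Vd3 q z1 t
                     + \<Gamma>12 *v (Kz *v (z2 - \<gamma>2 t))) = 0"
    and z1s: "\<And>t. 0 \<le> t \<Longrightarrow>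
          (z1s has_vector_derivative
             \<Gamma>21 *v grad_q Vd3 (qs t) (z1s t) t - \<Gamma>33 *v grad_z Vd3 (qs t) (z1s t) t) (at t within {0..})"
             "\<And>t. 0 \<le> t \<Longrightarrow> 0 = \<Gamma>22 *v grad_q Vd3 (qs t) (z1s t) t"
  shows closed_loop_eq: "0 \<le> t \<Longrightarrow> closed_loop M V G d J Vd3 \<Gamma>11 \<Gamma>12 \<Gamma>21 \<Gamma>22 \<Gamma>33 Kz \<gamma>2 \<theta> t =
      P3 J \<Gamma>11 \<Gamma>12 \<Gamma>21 \<Gamma>22 \<Gamma>33 *v grad_H_d3 Md Vd3 Kz \<gamma>2 \<mu>2 \<theta> t"
    and trajectory_closed_loop: "trajectory (closed_loop M V G d J Vd3 \<Gamma>11 \<Gamma>12 \<Gamma>21 \<Gamma>22 \<Gamma>33 Kz \<gamma>2) {0..}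
      (\<lambda>t. ext_state (qs t) (ps t) (z1s t) (- \<mu>2))"
proof -
  define B where "B = \<Gamma>12 ** Kz"
  have B_mult: "\<Gamma>12 *v (Kz *v w) = B *v w" for w by (simp add: B_def matrix_vector_mul_assoc)
  have injG: "inj ((*v) G)" using G full_rank_injective by blast
  have injB: "inj ((*v) B)"
  proof -
    have "inj ((*v) \<Gamma>12)" using \<Gamma>12_rank full_rank_injective by blast
    moreover have "inj ((*v) Kz)" by (rule inj_matrix_vector_mult[OF pos_def_invertible[OF Kz]])
    moreover have "((*v) B) = (*v) \<Gamma>12 \<circ> (*v) Kz" by (auto simp: B_mult)
    ultimately show ?thesis by (simp add: inj_compose)
  qed
  \<comment> \<open>Difference of the matching equations at two values of \<open>z2\<close>, at time
    0; q and z1 are arbitrary.\<close>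
  have B0: "Gperp i \<bullet> (B *v w) = 0" if "i < CARD('n) - CARD('m)" for i w
    using matching_q[OF order_refl that, of undefined undefined "\<gamma>2 0 + w"]
      matching_q[OF order_refl that, of undefined undefined "\<gamma>2 0"]
    by (simp add: B_mult inner_add_right)
  have BG: "range ((*v) B) = range ((*v) G)"
    by (rule matching_range[OF dims G Gperp injB B0])
  have match: "grad V q - transpose J *v grad_q Vd3 q z1 t + \<Gamma>11 *v grad_z Vd3 q z1 t
                     + \<Gamma>12 *v (Kz *v (z2 - \<gamma>2 t)) \<in> range ((*v) G)" if "0 \<le> t" for q z1 z2 t
    by (rule in_range_of_left_annihilator[OF dims G Gperp matching_q[OF that]])
  have Gd: "G *v d = B *v \<mu>2"
  proof -
    obtain w where "G *v d = B *v w" using BG by (metis rangeE rangeI)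
    then show ?thesis unfolding \<mu>2 B_def[symmetric] by (simp add: pinv_mult[OF injB])
  qed
  have Vd: "V differentiable (at q)" for q by (rule C2_differentiable[OF V])
  have p_comp: "p_dot M V G q p (control V G J Vd3 \<Gamma>11 \<Gamma>12 Kz \<gamma>2 q z1 z2 t + d) =
      - (transpose J *v grad_q Vd3 q z1 t) + (\<Gamma>11 *v grad_z Vd3 q z1 t + \<Gamma>12 *v (Kz *v (z2 - \<gamma>2 t + \<mu>2)))"
    if t: "0 \<le> t" for q p z1 z2 t
  proof -
    let ?x = "- (transpose J *v grad_q Vd3 q z1 t) + \<Gamma>11 *v grad_z Vd3 q z1 t + \<Gamma>12 *v (Kz *v (z2 - \<gamma>2 t)) + grad V q"
    have "?x = grad V q - transpose J *v grad_q Vd3 q z1 t + \<Gamma>11 *v grad_z Vd3 q z1 t + \<Gamma>12 *v (Kz *v (z2 - \<gamma>2 t))"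
      by simp
    then obtain w where w: "?x = G *v w" using match[OF t, of q z1 z2] by (metis rangeE)
    have "G *v control V G J Vd3 \<Gamma>11 \<Gamma>12 Kz \<gamma>2 q z1 z2 t = ?x"
      unfolding control_def w pinv_mult[OF injG] ..
    then show ?thesis
      unfolding p_dot_eq[OF Vd]
      by (simp add: matrix_vector_right_distrib Gd B_mult del: transpose_matrix_vector)
  qed
  show cl: "closed_loop M V G d J Vd3 \<Gamma>11 \<Gamma>12 \<Gamma>21 \<Gamma>22 \<Gamma>33 Kz \<gamma>2 \<theta> t =
      P3 J \<Gamma>11 \<Gamma>12 \<Gamma>21 \<Gamma>22 \<Gamma>33 *v grad_H_d3 Md Vd3 Kz \<gamma>2 \<mu>2 \<theta> t" if "0 \<le> t" for \<theta> t
    unfolding closed_loop_def Let_def grad_H_d3_def P3_mult_ext_state p_comp[OF that] q_dot_eq[OF M] matching_p ..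
  show "trajectory (closed_loop M V G d J Vd3 \<Gamma>11 \<Gamma>12 \<Gamma>21 \<Gamma>22 \<Gamma>33 Kz \<gamma>2) {0..}
      (\<lambda>t. ext_state (qs t) (ps t) (z1s t) (- \<mu>2))"
    unfolding trajectory_def
  proof
    fix t :: real assume "t \<in> {0..}"
    then have t: "0 \<le> t" by simp
    obtain us :: "real \<Rightarrow> real^'m" where
      q': "(qs has_vector_derivative q_dot M V (qs t) (ps t)) (at t within {0..})" and
      p': "(ps has_vector_derivative p_dot M V G (qs t) (ps t) (us t)) (at t within {0..})"
      using feasible t unfolding feasible_def by blast
    \<comment> \<open>The derivative within the half line is unique, even one-sidedly at t = 0, so
      the \<open>vector_derivative\<close> in \<open>\<gamma>2\<close> is the one supplied by
      feasibility.\<close>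
    have "at t within {0..} \<noteq> bot"
      using t islimpt_subset[of t "{t..t + 1}" "{0..}"] by (auto simp: trivial_limit_within)
    then have vd: "vector_derivative ps (at t within {0..}) = p_dot M V G (qs t) (ps t) (us t)"
      using p' by (rule vector_derivative_within)
    let ?y = "- (transpose J *v grad_q Vd3 (qs t) (z1s t) t) + \<Gamma>11 *v grad_z Vd3 (qs t) (z1s t) t"
    let ?p' = "p_dot M V G (qs t) (ps t) (us t)"
    \<comment> \<open>The choice \<open>z2\<close> = \<open>\<gamma>2 t\<close> removes the last
      term of the matching equation.\<close>
    obtain w where w: "?y + grad V (qs t) = G *v w"
      using match[OF t, of "qs t" "z1s t" "\<gamma>2 t"] by (auto simp: algebra_simps)
    have "?y - ?p' = G *v (w - us t)"
      unfolding p_dot_eq[OF Vd] using w by (simp add: matrix_vector_mult_diff_distrib algebra_simps)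
    then obtain v where v: "?y - ?p' = B *v v" using BG by (metis rangeE rangeI)
    have inv: "invertible (transpose G ** \<Gamma>12 ** Kz)"
    proof -
      have "x = 0" if "(transpose G ** \<Gamma>12 ** Kz) *v x = 0" for x
      proof -
        obtain u where u: "B *v x = G *v u" using BG by (metis rangeE rangeI)
        have "transpose G *v (G *v u) = 0"
          using that by (simp only: B_mult flip: u matrix_vector_mul_assoc)
        then have "u = 0" by (rule transpose_mult_self_inj[OF injG])
        then have "B *v x = B *v 0" using u by simp
        then show ?thesis using injB by (simp only: inj_eq)
      qed
      then show ?thesis
        unfolding invertible_left_inverse matrix_left_invertible_ker by blast
    qed
    \<comment> \<open>So \<open>\<gamma>2 t\<close> is the coordinate v of the defect with respect
      to B. Applying the transpose of G makes the system square and loses nothing, since the defect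
      lies in the range of B.\<close>
    have "\<gamma>2 t = matrix_inv (transpose G ** \<Gamma>12 ** Kz) *v (transpose G *v (?y - ?p'))"
      unfolding \<gamma>2 vd by (simp only: matrix_vector_mult_diff_distrib)
    also have "\<dots> = matrix_inv (transpose G ** \<Gamma>12 ** Kz) *v ((transpose G ** \<Gamma>12 ** Kz) *v v)"
      unfolding v by (simp only: B_mult flip: matrix_vector_mul_assoc)
    also have "\<dots> = v" by (simp only: matrix_vector_mul_assoc matrix_inv_left[OF inv] matrix_vector_mul_lid)
    finally have "?p' = ?y - B *v \<gamma>2 t" using v by (simp add: algebra_simps)
    moreover have "\<Gamma>12 *v (Kz *v (- \<mu>2 - \<gamma>2 t + \<mu>2)) = - (B *v \<gamma>2 t)"
      by (simp add: B_mult mult_vec_uminus)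
    ultimately have p_eq: "p_dot M V G (qs t) (ps t) (control V G J Vd3 \<Gamma>11 \<Gamma>12 Kz \<gamma>2 (qs t) (z1s t) (- \<mu>2) t + d) = ?p'"
      unfolding p_comp[OF t] by simp
    have "((\<lambda>t. ext_state (qs t) (ps t) (z1s t) (- \<mu>2)) has_vector_derivative
        ext_state (q_dot M V (qs t) (ps t)) ?p' (\<Gamma>21 *v grad_q Vd3 (qs t) (z1s t) t - \<Gamma>33 *v grad_z Vd3 (qs t) (z1s t) t) 0)
        (at t within {0..})"
      by (intro has_vector_derivative_ext_state q' p' z1s(1)[OF t] has_vector_derivative_const)
    then show "((\<lambda>t. ext_state (qs t) (ps t) (z1s t) (- \<mu>2)) has_vector_derivative
        closed_loop M V G d J Vd3 \<Gamma>11 \<Gamma>12 \<Gamma>21 \<Gamma>22 \<Gamma>33 Kz \<gamma>2 (ext_state (qs t) (ps t) (z1s t) (- \<mu>2)) t) (at t within {0..})"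
      unfolding closed_loop_def Let_def q_of_ext_state p_of_ext_state z1_of_ext_state z2_of_ext_state p_eq z1s(2)[OF t, symmetric] .
  qed
qed

theorem theorem4:
  fixes M Md J :: "real^'n^'n"
    and V :: "real^'n \<Rightarrow> real"
    and G \<Gamma>11 \<Gamma>12 :: "real^'m^'n"
    and Gperp :: "nat \<Rightarrow> real^'n"
    and d \<mu>2 :: "real^'m"
    and qs ps :: "real \<Rightarrow> real^'n"
    and Vd3 :: "real^'n \<Rightarrow> real^'m \<Rightarrow> real \<Rightarrow> real"
    and Kz \<Gamma>33 :: "real^'m^'m"
    and \<Gamma>21 \<Gamma>22 :: "real^'n^'m"
    and z1s \<gamma>2 :: "real \<Rightarrow> real^'m"
    and D3 :: "(real^('n, 'm) ext) set"
    and \<alpha>3 \<beta>3 \<epsilon>3 :: real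
  assumes dims: "CARD('m) \<le> CARD('n)"
    and M: "pos_def M"
    and V: "C2 V" "\<And>q. 0 \<le> V q"
    and G: "rank G = CARD('m)"
    and Gperp: "left_annihilator Gperp G"
    and feasible: "feasible M V G qs ps"
    and Md: "pos_def Md"
    and Vd3: "\<And>t. 0 \<le> t \<Longrightarrow> C2 (\<lambda>(q, z1). Vd3 q z1 t)"
             "\<And>q z1 t. 0 \<le> t \<Longrightarrow> 0 \<le> Vd3 q z1 t"
    and Kz: "pos_def Kz"
    and \<Gamma>_rank: "rank \<Gamma>11 = CARD('m)" "rank \<Gamma>12 = CARD('m)"
                "rank \<Gamma>21 = CARD('m)" "rank \<Gamma>22 = CARD('m)"
    and \<Gamma>33: "pos_def \<Gamma>33"
    and \<gamma>2: "\<gamma>2 = (\<lambda>t. matrix_inv (transpose G ** \<Gamma>12 ** Kz) *v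
                (transpose G *v (- (transpose J *v grad_q Vd3 (qs t) (z1s t) t)
                                 + \<Gamma>11 *v grad_z Vd3 (qs t) (z1s t) t)
                 - transpose G *v vector_derivative ps (at t within {0..})))"
    and \<mu>2: "\<mu>2 = pinv (\<Gamma>12 ** Kz) *v (G *v d)"
    and matching_p: "\<And>p. matrix_inv M *v p = J *v (matrix_inv Md *v p)"
    and matching_q: "\<And>q z1 z2 t i. 0 \<le> t \<Longrightarrow> i < CARD('n) - CARD('m) \<Longrightarrow>
          Gperp i \<bullet> (grad V q - transpose J *v grad_q Vd3 q z1 t + \<Gamma>11 *v grad_z Vd3 q z1 t
                     + \<Gamma>12 *v (Kz *v (z2 - \<gamma>2 t))) = 0"
    and P3_hurwitz: "hurwitz (P3 J \<Gamma>11 \<Gamma>12 \<Gamma>21 \<Gamma>22 \<Gamma>33)"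
    and \<alpha>\<beta>: "0 < \<alpha>3" "\<alpha>3 < \<beta>3"
    and D3: "open D3"
    and hessian: "\<And>\<theta> t. \<theta> \<in> D3 \<Longrightarrow> 0 \<le> t \<Longrightarrow>
          mat \<alpha>3 \<prec> hess (\<lambda>\<theta>. H_d3 Md Vd3 Kz \<gamma>2 \<mu>2 \<theta> t) \<theta> \<and>
          hess (\<lambda>\<theta>. H_d3 Md Vd3 Kz \<gamma>2 \<mu>2 \<theta> t) \<theta> \<prec> mat \<beta>3"
    and \<epsilon>3: "0 < \<epsilon>3"
    and N3: "\<And>\<mu>. eigenvalue (N3 (P3 J \<Gamma>11 \<Gamma>12 \<Gamma>21 \<Gamma>22 \<Gamma>33) \<alpha>3 \<beta>3 \<epsilon>3) \<mu> \<Longrightarrow> Re \<mu> \<noteq> 0"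
    and z1s: "\<And>t. 0 \<le> t \<Longrightarrow>
          (z1s has_vector_derivative
             \<Gamma>21 *v grad_q Vd3 (qs t) (z1s t) t - \<Gamma>33 *v grad_z Vd3 (qs t) (z1s t) t) (at t within {0..})"
             "\<And>t. 0 \<le> t \<Longrightarrow> 0 = \<Gamma>22 *v grad_q Vd3 (qs t) (z1s t) t"
  shows "\<exists>(z2s :: real \<Rightarrow> real^'m) Q \<rho> \<kappa>.
    let f = closed_loop M V G d J Vd3 \<Gamma>11 \<Gamma>12 \<Gamma>21 \<Gamma>22 \<Gamma>33 Kz \<gamma>2;
        \<theta>s = (\<lambda>t. ext_state (qs t) (ps t) (z1s t) (z2s t))
    in trajectory f {0..} \<theta>s \<and>
       contraction_metric f D3 Q \<rho> \<and> 0 < \<kappa> \<and>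
       (\<forall>\<theta> I t0.
          is_interval I \<longrightarrow> I \<subseteq> {0..} \<longrightarrow> t0 \<in> I \<longrightarrow> trajectory f I \<theta> \<longrightarrow>
          (\<forall>r>0. (\<forall>t\<ge>0. metric_ball Q t (\<theta>s t) r \<subseteq> D3) \<longrightarrow> \<theta> t0 \<in> metric_ball Q t0 (\<theta>s t0) r \<longrightarrow>
             (\<forall>t\<in>I. t0 \<le> t \<longrightarrow> \<theta> t \<in> metric_ball Q t (\<theta>s t) r)) \<and>
          (D3 = UNIV \<or>
             (\<exists>r>0. (\<forall>t\<ge>0. metric_ball Q t (\<theta>s t) r \<subseteq> D3) \<and> \<theta> t0 \<in> metric_ball Q t0 (\<theta>s t0) r) \<longrightarrow>
             (\<forall>t\<in>I. t0 \<le> t \<longrightarrow>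
                norm (\<theta> t - \<theta>s t) \<le> \<kappa> * exp (- \<rho> * (t - t0)) * norm (\<theta> t0 - \<theta>s t0) \<and>
                norm ((q_of (\<theta> t), p_of (\<theta> t)) - (qs t, ps t))
                  \<le> \<kappa> * exp (- \<rho> * (t - t0)) * norm (\<theta> t0 - \<theta>s t0))))"
proof -
  let ?P = "P3 J \<Gamma>11 \<Gamma>12 \<Gamma>21 \<Gamma>22 \<Gamma>33"
  define f where "f = closed_loop M V G d J Vd3 \<Gamma>11 \<Gamma>12 \<Gamma>21 \<Gamma>22 \<Gamma>33 Kz \<gamma>2"
  \<comment> \<open>The reference for \<open>z2\<close> is the constant - \<open>\<mu>2\<close>, the
    integrator value that compensates the disturbance; it is stationary by the second part of
    \<open>z1s\<close>.\<close>
  define \<theta>s where "\<theta>s = (\<lambda>t. ext_state (qs t) (ps t) (z1s t) (- \<mu>2))"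
  have f_eq: "f \<theta> t = ?P *v grad_H_d3 Md Vd3 Kz \<gamma>2 \<mu>2 \<theta> t" if "0 \<le> t" for \<theta> t
    unfolding f_def by (rule closed_loop_eq[OF dims M V(1) G Gperp feasible Kz \<Gamma>_rank(2) \<gamma>2 \<mu>2 matching_p matching_q z1s that])
  have traj: "trajectory f {0..} \<theta>s"
    unfolding f_def \<theta>s_def by (rule trajectory_closed_loop[OF dims M V(1) G Gperp feasible Kz \<Gamma>_rank(2) \<gamma>2 \<mu>2 matching_p matching_q z1s])
  obtain X \<delta> where X: "transpose X = X" and pos: "\<And>x. x \<noteq> 0 \<Longrightarrow> 0 < x \<bullet> (X *v x)" and \<delta>: "0 < \<delta>"
    and dec: "\<And>H x. mat \<alpha>3 \<prec> H \<Longrightarrow> H \<prec> mat \<beta>3 \<Longrightarrow> x \<bullet> (X *v (?P *v (H *v x))) \<le> - \<delta> * (x \<bullet> x)"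
    using contraction_certificate[OF P3_hurwitz \<alpha>\<beta> \<epsilon>3 N3] by metis
  obtain c1 c2 where c: "0 < c1" "0 < c2" and lo: "\<And>x. c1 * (x \<bullet> x) \<le> x \<bullet> (X *v x)"
    and hi: "\<And>x. x \<bullet> (X *v x) \<le> c2 * (x \<bullet> x)"
    using form_bounds[OF pos] by metis
  define Q :: "real^('n, 'm) ext \<Rightarrow> real \<Rightarrow> real^('n, 'm) ext^('n, 'm) ext" where "Q = (\<lambda>_ _. X)"
  \<comment> \<open>The rate \<delta> refers to the Euclidean norm, and c2 converts it to the
    metric. In \<kappa>, the factor c2 comes from passing to the metric at t0 and 1 / c1 from
    returning at t.\<close>
  define \<rho> where "\<rho> = \<delta> / c2"
  define \<kappa> where "\<kappa> = sqrt (c2 / c1)"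
  have \<rho>: "0 < \<rho>" and \<kappa>: "0 < \<kappa>" using \<delta> c by (simp_all add: \<rho>_def \<kappa>_def)
  have jac: "\<exists>A. ((\<lambda>z. f z t) has_derivative (\<lambda>h. A *v h)) (at z) \<and> (\<forall>x. x \<bullet> (X *v (A *v x)) \<le> - \<rho> * (x \<bullet> (X *v x)))"
    if z: "z \<in> D3" and t: "0 \<le> t" for z t
  proof -
    let ?H = "hess (\<lambda>\<theta>. H_d3 Md Vd3 Kz \<gamma>2 \<mu>2 \<theta> t) z"
    have grad_eq: "grad (\<lambda>\<theta>. H_d3 Md Vd3 Kz \<gamma>2 \<mu>2 \<theta> t) = (\<lambda>\<theta>. grad_H_d3 Md Vd3 Kz \<gamma>2 \<mu>2 \<theta> t)"
      by (rule ext) (rule grad_H_d3_eq[where W = Vd3 and t = t, OF Vd3(1)[OF t] Md Kz])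
    have "((\<lambda>\<theta>. grad_H_d3 Md Vd3 Kz \<gamma>2 \<mu>2 \<theta> t) has_derivative (\<lambda>h. ?H *v h)) (at z)"
      unfolding hess_def grad_eq by (rule jacobian_works[THEN iffD1]) (rule grad_H_d3_differentiable[where W = Vd3 and t = t, OF Vd3(1)[OF t]])
    from bounded_linear.has_derivative[OF bounded_linear_mult_vec this, of ?P]
    have "((\<lambda>z. f z t) has_derivative (\<lambda>h. (?P ** ?H) *v h)) (at z)"
      by (simp add: f_eq[OF t] matrix_vector_mul_assoc)
    moreover have "x \<bullet> (X *v ((?P ** ?H) *v x)) \<le> - \<rho> * (x \<bullet> (X *v x))" for x
    proof -
      have "x \<bullet> (X *v ((?P ** ?H) *v x)) \<le> - \<delta> * (x \<bullet> x)"
        using dec hessian[OF z t] by (simp flip: matrix_vector_mul_assoc)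
      also have "\<dots> = - \<rho> * (c2 * (x \<bullet> x))" using c by (simp add: \<rho>_def)
      also have "\<dots> \<le> - \<rho> * (x \<bullet> (X *v x))" using hi[of x] \<rho> by simp
      finally show ?thesis .
    qed
    ultimately show ?thesis by blast
  qed
  have metric: "contraction_metric f D3 Q \<rho>"
    unfolding contraction_metric_def
  proof (intro conjI ballI allI impI)
    show "0 < \<rho>" by (rule \<rho>)
    have "mat c1 \<preceq> X" "X \<preceq> mat c2"
      using lo hi X
      by (auto simp: loewner_le_def pos_semidef_def matrix_vector_mult_diff_rdistrib mat_mult_vec inner_diff_right transpose_diff transpose_mat)
    then show "\<exists>c1 c2. 0 < c1 \<and> (\<forall>x. \<forall>t\<ge>0. transpose (Q x t) = Q x t \<and> mat c1 \<preceq> Q x t \<and> Q x t \<preceq> mat c2)"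
      using c X unfolding Q_def by blast
    show "(\<lambda>(x, t). Q x t) differentiable at (x, t) within UNIV \<times> {0..}" for x t
      by (simp add: Q_def case_prod_beta')
    fix z and t :: real assume z: "z \<in> D3" and t: "0 \<le> t"
    obtain A where A: "((\<lambda>z. f z t) has_derivative (\<lambda>h. A *v h)) (at z)" "\<And>x. x \<bullet> (X *v (A *v x)) \<le> - \<rho> * (x \<bullet> (X *v x))"
      using jac[OF z t] by blast
    \<comment> \<open>The derivative of the constant metric is 0, and by symmetry of X the matrix
      inequality is twice the form inequality of \<open>jac\<close>.\<close>
    have "transpose A ** X + X ** A + 0 \<preceq> (- 2 * \<rho>) *\<^sub>R X"
      unfolding loewner_le_def pos_semidef_def
    proof (intro conjI allI)
      show "transpose ((- 2 * \<rho>) *\<^sub>R X - (transpose A ** X + X ** A + 0)) = (- 2 * \<rho>) *\<^sub>R X - (transpose A ** X + X ** A + 0)"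
        by (simp add: transpose_diff transpose_add transpose_uminus transpose_scaleR matrix_transpose_mul X add.commute)
      fix x
      have "x \<bullet> (transpose A *v (X *v x)) = x \<bullet> (X *v (A *v x))"
        by (metis X inner_transpose_mult_vec inner_commute)
      then show "0 \<le> x \<bullet> (((- 2 * \<rho>) *\<^sub>R X - (transpose A ** X + X ** A + 0)) *v x)"
        using A(2)[of x]
        by (simp add: matrix_vector_mult_diff_rdistrib matrix_vector_mult_add_rdistrib scaleR_mult_vec
            inner_diff_right inner_add_right uminus_mult_vec del: transpose_matrix_vector flip: matrix_vector_mul_assoc)
    qed
    then show "\<exists>A Q'. ((\<lambda>x. f x t) has_derivative (\<lambda>h. A *v h)) (at z) \<and>
        ((\<lambda>(x, t). Q x t) has_derivative Q') (at (z, t) within UNIV \<times> {0..}) \<and>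
        transpose A ** Q z t + Q z t ** A + Q' (f z t, 1) \<preceq> (- 2 * \<rho>) *\<^sub>R Q z t"
      using A(1) by (intro exI[of _ A] exI[of _ "\<lambda>_. 0"]) (auto simp: Q_def case_prod_beta')
  qed
  have ball: "metric_ball Q t x r = {y. sqrt ((y - x) \<bullet> (X *v (y - x))) < r}" for t x r
    by (simp add: metric_ball_def Q_def metric_dist_const[OF X pos])
  have pos0: "0 \<le> x \<bullet> (X *v x)" for x using pos[of x] by (cases "x = 0") auto
  have sqrt_less: "sqrt a < r \<longleftrightarrow> a < r\<^sup>2" if "0 < r" for a r :: real
    using that by (metis real_sqrt_less_iff real_sqrt_unique less_imp_le)
  have seg: "closed_segment x y \<subseteq> D3"
    if "metric_ball Q t x r \<subseteq> D3" "0 < r" "(y - x) \<bullet> (X *v (y - x)) < r\<^sup>2" for t x y r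
  proof
    fix w assume "w \<in> closed_segment x y"
    then obtain s where s: "0 \<le> s" "s \<le> 1" "w = (1 - s) *\<^sub>R x + s *\<^sub>R y" by (auto simp: in_segment)
    then have "w - x = s *\<^sub>R (y - x)" by (simp add: algebra_simps)
    then have "(w - x) \<bullet> (X *v (w - x)) = (s * s) * ((y - x) \<bullet> (X *v (y - x)))"
      by (simp add: matrix_vector_mult_scaleR)
    also have "\<dots> \<le> 1 * ((y - x) \<bullet> (X *v (y - x)))"
      using s pos0 by (intro mult_right_mono) (auto simp: mult_le_one)
    finally have "w \<in> metric_ball Q t x r" using that(2,3) by (simp add: ball sqrt_less)
    then show "w \<in> D3" using that(1) by blast
  qed
  have bounds: "norm (\<theta> t - \<theta>s t) \<le> \<kappa> * exp (- \<rho> * (t - t0)) * norm (\<theta> t0 - \<theta>s t0) \<and>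
      norm ((q_of (\<theta> t), p_of (\<theta> t)) - (qs t, ps t)) \<le> \<kappa> * exp (- \<rho> * (t - t0)) * norm (\<theta> t0 - \<theta>s t0)"
    if le: "(\<theta> t - \<theta>s t) \<bullet> (X *v (\<theta> t - \<theta>s t)) \<le> exp (- 2 * \<rho> * (t - t0)) * ((\<theta> t0 - \<theta>s t0) \<bullet> (X *v (\<theta> t0 - \<theta>s t0)))" for \<theta> t t0
  proof -
    let ?a = "\<theta> t - \<theta>s t" and ?b = "\<theta> t0 - \<theta>s t0"
    have "c1 * (norm ?a)\<^sup>2 \<le> exp (- 2 * \<rho> * (t - t0)) * (?b \<bullet> (X *v ?b))"
      using le lo[of ?a] unfolding power2_norm_eq_inner by linarith
    also have "\<dots> \<le> exp (- 2 * \<rho> * (t - t0)) * (c2 * (norm ?b)\<^sup>2)"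
      using hi[of ?b] unfolding power2_norm_eq_inner by (intro mult_left_mono) auto
    finally have "(norm ?a)\<^sup>2 \<le> (c2 / c1) * exp (- 2 * \<rho> * (t - t0)) * (norm ?b)\<^sup>2"
      using c by (simp add: field_simps)
    also have "\<dots> = (\<kappa> * exp (- \<rho> * (t - t0)) * norm ?b)\<^sup>2"
      using c by (simp add: \<kappa>_def power_mult_distrib exp_double[symmetric] algebra_simps)
    finally have 1: "norm ?a \<le> \<kappa> * exp (- \<rho> * (t - t0)) * norm ?b"
      by (rule power2_le_imp_le) (use \<kappa> in simp)
    have "norm ((q_of (\<theta> t), p_of (\<theta> t)) - (qs t, ps t)) = norm (q_of ?a, p_of ?a)"
      by (simp add: linear_diff[OF linear_of(1)] linear_diff[OF linear_of(2)] \<theta>s_def)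
    also have "\<dots> \<le> norm ?a"
      unfolding norm_Pair by (rule real_le_lsqrt) (auto simp: norm_ext_state[of ?a])
    finally show ?thesis using 1 by simp
  qed
  have main: "(\<forall>r>0. (\<forall>t\<ge>0. metric_ball Q t (\<theta>s t) r \<subseteq> D3) \<longrightarrow> \<theta> t0 \<in> metric_ball Q t0 (\<theta>s t0) r \<longrightarrow>
             (\<forall>t\<in>I. t0 \<le> t \<longrightarrow> \<theta> t \<in> metric_ball Q t (\<theta>s t) r)) \<and>
          (D3 = UNIV \<or>
             (\<exists>r>0. (\<forall>t\<ge>0. metric_ball Q t (\<theta>s t) r \<subseteq> D3) \<and> \<theta> t0 \<in> metric_ball Q t0 (\<theta>s t0) r) \<longrightarrow>
             (\<forall>t\<in>I. t0 \<le> t \<longrightarrow>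
                norm (\<theta> t - \<theta>s t) \<le> \<kappa> * exp (- \<rho> * (t - t0)) * norm (\<theta> t0 - \<theta>s t0) \<and>
                norm ((q_of (\<theta> t), p_of (\<theta> t)) - (qs t, ps t))
                  \<le> \<kappa> * exp (- \<rho> * (t - t0)) * norm (\<theta> t0 - \<theta>s t0)))"
    if I: "is_interval I" "I \<subseteq> {0..}" "t0 \<in> I" and \<theta>: "trajectory f I \<theta>" for \<theta> I t0
  proof (intro conjI allI impI ballI)
    fix t assume t: "t \<in> I" "t0 \<le> t"
    \<comment> \<open>R will be the squared radius of the ball or, when \<open>D3\<close> is the
      whole space, any number above the initial squared distance.\<close>
    have tc: "(\<theta> t - \<theta>s t) \<bullet> (X *v (\<theta> t - \<theta>s t)) < R"
        "(\<theta> t - \<theta>s t) \<bullet> (X *v (\<theta> t - \<theta>s t)) \<le> exp (- 2 * \<rho> * (t - t0)) * ((\<theta> t0 - \<theta>s t0) \<bullet> (X *v (\<theta> t0 - \<theta>s t0)))"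
      if "\<And>u. 0 \<le> u \<Longrightarrow> (\<theta> u - \<theta>s u) \<bullet> (X *v (\<theta> u - \<theta>s u)) < R \<Longrightarrow> closed_segment (\<theta>s u) (\<theta> u) \<subseteq> D3"
        and "(\<theta> t0 - \<theta>s t0) \<bullet> (X *v (\<theta> t0 - \<theta>s t0)) < R" for R
      by (rule trajectory_contraction[OF X pos \<rho> jac traj \<theta> I t that]; assumption)+
    show "\<theta> t \<in> metric_ball Q t (\<theta>s t) r"
      if r: "0 < r" "\<forall>t\<ge>0. metric_ball Q t (\<theta>s t) r \<subseteq> D3" "\<theta> t0 \<in> metric_ball Q t0 (\<theta>s t0) r" for r
    proof -
      have "closed_segment (\<theta>s u) (\<theta> u) \<subseteq> D3" if "0 \<le> u" "(\<theta> u - \<theta>s u) \<bullet> (X *v (\<theta> u - \<theta>s u)) < r\<^sup>2" for u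
        using seg[OF _ r(1) that(2)] r(2) that(1) by blast
      from tc(1)[OF this] show ?thesis using r by (simp add: ball sqrt_less)
    qed
    assume "D3 = UNIV \<or> (\<exists>r>0. (\<forall>t\<ge>0. metric_ball Q t (\<theta>s t) r \<subseteq> D3) \<and> \<theta> t0 \<in> metric_ball Q t0 (\<theta>s t0) r)"
    then have "(\<theta> t - \<theta>s t) \<bullet> (X *v (\<theta> t - \<theta>s t)) \<le> exp (- 2 * \<rho> * (t - t0)) * ((\<theta> t0 - \<theta>s t0) \<bullet> (X *v (\<theta> t0 - \<theta>s t0)))"
    proof
      assume "D3 = UNIV"
      then show ?thesis
        by (intro tc(2)[of "(\<theta> t0 - \<theta>s t0) \<bullet> (X *v (\<theta> t0 - \<theta>s t0)) + 1"]) auto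
    next
      assume "\<exists>r>0. (\<forall>t\<ge>0. metric_ball Q t (\<theta>s t) r \<subseteq> D3) \<and> \<theta> t0 \<in> metric_ball Q t0 (\<theta>s t0) r"
      then obtain r where r: "0 < r" "\<forall>t\<ge>0. metric_ball Q t (\<theta>s t) r \<subseteq> D3" "\<theta> t0 \<in> metric_ball Q t0 (\<theta>s t0) r" by blast
      have "closed_segment (\<theta>s u) (\<theta> u) \<subseteq> D3" if "0 \<le> u" "(\<theta> u - \<theta>s u) \<bullet> (X *v (\<theta> u - \<theta>s u)) < r\<^sup>2" for u
        using seg[OF _ r(1) that(2)] r(2) that(1) by blast
      from tc(2)[OF this] show ?thesis using r by (simp add: ball sqrt_less)
    qed
    note b = bounds[OF this]
    show "norm (\<theta> t - \<theta>s t) \<le> \<kappa> * exp (- \<rho> * (t - t0)) * norm (\<theta> t0 - \<theta>s t0)"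
      "norm ((q_of (\<theta> t), p_of (\<theta> t)) - (qs t, ps t)) \<le> \<kappa> * exp (- \<rho> * (t - t0)) * norm (\<theta> t0 - \<theta>s t0)"
      by (rule conjunct1[OF b], rule conjunct2[OF b])
  qed
  show ?thesis
    unfolding Let_def f_def[symmetric]
    by (intro exI[of _ "\<lambda>_. - \<mu>2"] exI[of _ Q] exI[of _ \<rho>] exI[of _ \<kappa>]
        conjI[OF traj[unfolded \<theta>s_def]] conjI[OF metric] conjI[OF \<kappa>] allI impI main[unfolded \<theta>s_def])
qed

end
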